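(* Let $S$ be a connected smooth surface and let $\sigma\colon S\to SL(2,\mathbb{C})$ be an admissible immersion with pull-back complex metric $g$ and shape operator $\Psi$. Then: (a) $\sigma(S)$ is contained in the image of an isometric embedding of $\mathbb{H}^3$ into $SL(2,\mathbb C)$ if and only if $g$ is Riemannian and $\Psi$ is real. (b) $\sigma(S)$ is contained in the image of an isometric embedding of $AdS^3$ if and only if either $g$ is Riemannian and $i\Psi$ is real, or $g$ has signature $(1,1)$ and $\Psi$ is real. (c) $\sigma(S)$ is contained in the image of an isometric embedding of $-dS^3$ if and only if either $g$ has signature $(1,1)$ and $i\Psi$ is real, or $g$ is negative definite and $\Psi$ is real. (d) $\sigma(S)$ is contained in the image of an isometric embedding of $-S^3$ if and only if $g$ is negative definite and $i\Psi$ is real.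
   Context: $SL(2,\mathbb{C})$ carries the holomorphic Riemannian metric $\langle AV,AW\rangle_A=\tfrac12\mathrm{tr}(VW)$, $V,W\in\mathfrak{sl}(2,\mathbb{C})$, with Levi-Civita connection $D$ and complex structure $\mathbb{J}$. $\mathbb{C}TS=TS\otimes_{\mathbb R}\mathbb{C}$; the differential of a smooth map $\sigma\colon S\to SL(2,\mathbb{C})$ is extended by $\sigma_*(X+iY)=\sigma_*X+\mathbb{J}\sigma_*Y$ for real $X,Y$. An immersion $\sigma$ is admissible if $g=\sigma^*\langle\cdot,\cdot\rangle$, $g(X,Y)=\langle\sigma_*X,\sigma_*Y\rangle$, is a non-degenerate $\mathbb{C}$-bilinear form on each $\mathbb{C}T_pS$ (i.e. a complex metric). Then $\mathbb{C}TS\subset\sigma^*TSL(2,\mathbb{C})$. Locally choose a normal field $\nu$, i.e. a section of $\sigma^*TSL(2,\mathbb{C})$ orthogonal to $\mathbb{C}TS$ with $\langle\nu,\nu\rangle=1$ (unique up to sign). The shape operator is $\Psi=\overline\nabla\nu\colon\mathbb{C}TS\to\mathbb{C}TS$, where $\overline\nabla=\sigma^*D$ is extended $\mathbb{C}$-linearly; it is defined up to sign. "$g$ is Riemannian / of signature $(1,1)$ / negative definite" means that $g$ restricted to the real tangent bundle $TS$ is real valued and a real bilinear form of that type. "$\Psi$ (resp. $i\Psi$) is real" means that $\Psi$ (resp. $i\Psi$) maps $TS$ to $TS$; this does not depend on the sign. $\mathbb{H}^3$ is hyperbolic space. For $(a,b)\in\{(2,1),(1,2),(0,3)\}$ let $Q^{a,b}=\{x\in\mathbb{R}^4: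 x_1^2+\dots+x_a^2-x_{a+1}^2-\dots-x_4^2=-1\}$ with the metric of signature $(a,b)$ induced from the corresponding flat pseudo-Riemannian metric on $\mathbb{R}^4$. Then $AdS^3=Q^{2,1}$, $-dS^3=Q^{1,2}$ (de Sitter space with the opposite metric), $-S^3=Q^{0,3}$ (the round unit sphere with the opposite metric); all have constant curvature $-1$. An isometric embedding of a pseudo-Riemannian manifold $N$ into $SL(2,\mathbb{C})$ is a smooth embedding $f$ with $f^*\langle\cdot,\cdot\rangle$ equal to the metric of $N$ on $TN$. *)

theory Defs
  imports "HOL-Analysis.Analysis"
begin

section \<open>Smooth maps\<close>

text \<open>\<open>Ck_on k U f\<close> is only meant for open \<open>U\<close> and finite-dimensional domains.\<close>

primrec Ck_on :: "nat \<Rightarrow> 'a::real_normed_vector set \<Rightarrow> ('a \<Rightarrow> 'b::real_normed_vector) \<Rightarrow> bool" where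
  "Ck_on 0 U f \<longleftrightarrow> continuous_on U f"
| "Ck_on (Suc k) U f \<longleftrightarrow>
     f differentiable_on U \<and> (\<forall>v. Ck_on k U (\<lambda>x. frechet_derivative f (at x) v))"

definition smooth_on :: "'a::real_normed_vector set \<Rightarrow> ('a \<Rightarrow> 'b::real_normed_vector) \<Rightarrow> bool" where
  "smooth_on U f \<longleftrightarrow> (\<forall>k. Ck_on k U f)"

text \<open>Smoothness on an arbitrary subset \<open>N\<close> of a vector space: local smooth extendability. It is
  used for embedded submanifolds \<open>N\<close>. For such \<open>N\<close>, the value of
  \<open>frechet_derivative f (at x within N)\<close> on vectors tangent to \<open>N\<close> at \<open>x\<close> is the differential of
  \<open>f\<close> (on other vectors it is not determined); below it is only applied to tangent vectors.\<close>

definition smooth_on_subset ::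
    "'a::real_normed_vector set \<Rightarrow> ('a \<Rightarrow> 'b::real_normed_vector) \<Rightarrow> bool" where
  "smooth_on_subset N f \<longleftrightarrow>
     (\<forall>x\<in>N. \<exists>U F. open U \<and> x \<in> U \<and> smooth_on U F \<and> (\<forall>y\<in>U \<inter> N. F y = f y))"


section \<open>The holomorphic Riemannian manifold SL(2,C)\<close>

type_synonym cmat = "complex^2^2"

definition SL2 :: "cmat set" where
  "SL2 = {A. det A = 1}"

definition tangent_SL2 :: "cmat \<Rightarrow> cmat set" where
  "tangent_SL2 A = {A ** V | V. trace V = 0}"

definition cscale :: "complex \<Rightarrow> cmat \<Rightarrow> cmat" where
  "cscale c X = (\<chi> i j. c * X $ i $ j)"

text \<open>The complex structure of \<open>SL2\<close>.\<close>

definition JJ :: "cmat \<Rightarrow> cmat" where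
  "JJ = cscale \<i>"

definition hol_metric :: "cmat \<Rightarrow> cmat \<Rightarrow> cmat \<Rightarrow> complex" where
  "hol_metric A X Y = trace ((matrix_inv A ** X) ** (matrix_inv A ** Y)) / 2"

definition vector_field_SL2 :: "(cmat \<Rightarrow> cmat) \<Rightarrow> bool" where
  "vector_field_SL2 X \<longleftrightarrow> smooth_on_subset SL2 X \<and> (\<forall>A\<in>SL2. X A \<in> tangent_SL2 A)"

definition dir_deriv :: "(cmat \<Rightarrow> cmat) \<Rightarrow> (cmat \<Rightarrow> 'b::real_normed_vector) \<Rightarrow> cmat \<Rightarrow> 'b" where
  "dir_deriv X f A = frechet_derivative f (at A within SL2) (X A)"

text \<open>For vector fields tangent to a submanifold, the Lie bracket can be computed with the flat
  derivative of the ambient space.\<close>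

definition lie_bracket :: "(cmat \<Rightarrow> cmat) \<Rightarrow> (cmat \<Rightarrow> cmat) \<Rightarrow> cmat \<Rightarrow> cmat" where
  "lie_bracket X Y A = dir_deriv X Y A - dir_deriv Y X A"

text \<open>Connections act on global smooth real vector fields (\<open>D X Y\<close> is the derivative of \<open>Y\<close> in
  direction \<open>X\<close>); values off \<open>SL2\<close> are irrelevant.\<close>

definition affine_connection_SL2 :: "((cmat \<Rightarrow> cmat) \<Rightarrow> (cmat \<Rightarrow> cmat) \<Rightarrow> cmat \<Rightarrow> cmat) \<Rightarrow> bool" where
  "affine_connection_SL2 D \<longleftrightarrow>
     (\<forall>X Y. vector_field_SL2 X \<longrightarrow> vector_field_SL2 Y \<longrightarrow> vector_field_SL2 (D X Y)) \<and>
     (\<forall>X X' Y. vector_field_SL2 X \<longrightarrow> vector_field_SL2 X' \<longrightarrow> vector_field_SL2 Y \<longrightarrow>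
        (\<forall>A\<in>SL2. D (\<lambda>B. X B + X' B) Y A = D X Y A + D X' Y A)) \<and>
     (\<forall>(f::cmat \<Rightarrow> real) X Y. smooth_on_subset SL2 f \<longrightarrow> vector_field_SL2 X \<longrightarrow> vector_field_SL2 Y \<longrightarrow>
        (\<forall>A\<in>SL2. D (\<lambda>B. f B *\<^sub>R X B) Y A = f A *\<^sub>R D X Y A)) \<and>
     (\<forall>X Y Y'. vector_field_SL2 X \<longrightarrow> vector_field_SL2 Y \<longrightarrow> vector_field_SL2 Y' \<longrightarrow>
        (\<forall>A\<in>SL2. D X (\<lambda>B. Y B + Y' B) A = D X Y A + D X Y' A)) \<and>
     (\<forall>(f::cmat \<Rightarrow> real) X Y. smooth_on_subset SL2 f \<longrightarrow> vector_field_SL2 X \<longrightarrow> vector_field_SL2 Y \<longrightarrow>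
        (\<forall>A\<in>SL2. D X (\<lambda>B. f B *\<^sub>R Y B) A = dir_deriv X f A *\<^sub>R Y A + f A *\<^sub>R D X Y A))"

definition levi_civita_SL2 :: "((cmat \<Rightarrow> cmat) \<Rightarrow> (cmat \<Rightarrow> cmat) \<Rightarrow> cmat \<Rightarrow> cmat) \<Rightarrow> bool" where
  "levi_civita_SL2 D \<longleftrightarrow>
     affine_connection_SL2 D \<and>
     (\<forall>X Y. vector_field_SL2 X \<longrightarrow> vector_field_SL2 Y \<longrightarrow>
        (\<forall>A\<in>SL2. D X Y A - D Y X A = lie_bracket X Y A)) \<and>
     (\<forall>X Y Z. vector_field_SL2 X \<longrightarrow> vector_field_SL2 Y \<longrightarrow> vector_field_SL2 Z \<longrightarrow>
        (\<forall>A\<in>SL2. dir_deriv X (\<lambda>B. hol_metric B (Y B) (Z B)) A =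
           hol_metric A (D X Y A) (Z A) + hol_metric A (Y A) (D X Z A)))"

definition left_field :: "cmat \<Rightarrow> cmat \<Rightarrow> cmat" where
  "left_field V A = A ** V"


section \<open>Smooth surfaces and maps from surfaces\<close>

text \<open>A surface is a type together with an atlas; a chart is a pair of its domain and its coordinate
  map. A tangent vector at \<open>p\<close> is represented by its components in a chart around \<open>p\<close>, a complexified
  tangent vector by complex components; chart-dependent notions below are always quantified
  over all charts around \<open>p\<close>.\<close>

type_synonym 'a chart = "'a set \<times> ('a \<Rightarrow> real^2)"

definition coord :: "'a chart \<Rightarrow> ('a \<Rightarrow> 'b) \<Rightarrow> real^2 \<Rightarrow> 'b" where
  "coord c f = f \<circ> inv_into (fst c) (snd c)"

definition surface_atlas :: "('a::{t2_space, second_countable_topology}) chart set \<Rightarrow> bool" where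
  "surface_atlas \<A> \<longleftrightarrow>
     (\<Union>c\<in>\<A>. fst c) = UNIV \<and>
     (\<forall>c\<in>\<A>. open (fst c) \<and> open (snd c ` fst c) \<and>
        (\<exists>\<psi>. homeomorphism (fst c) (snd c ` fst c) (snd c) \<psi>)) \<and>
     (\<forall>c\<in>\<A>. \<forall>c'\<in>\<A>. smooth_on (snd c ` (fst c \<inter> fst c')) (coord c (snd c')))"

definition smooth_map_on ::
    "'a chart set \<Rightarrow> 'a set \<Rightarrow> ('a \<Rightarrow> 'b::real_normed_vector) \<Rightarrow> bool" where
  "smooth_map_on \<A> V f \<longleftrightarrow> (\<forall>c\<in>\<A>. smooth_on (snd c ` (fst c \<inter> V)) (coord c f))"

definition dmap :: "'a chart \<Rightarrow> ('a \<Rightarrow> 'b::real_normed_vector) \<Rightarrow> 'a \<Rightarrow> real^2 \<Rightarrow> 'b" where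
  "dmap c f p u = frechet_derivative (coord c f) (at (snd c p)) u"

definition cplx :: "real^2 \<Rightarrow> complex^2" where
  "cplx u = (\<chi> i. complex_of_real (u $ i))"

text \<open>The extension of a real linear map to the complexified tangent plane.\<close>

definition cext :: "(real^2 \<Rightarrow> cmat) \<Rightarrow> complex^2 \<Rightarrow> cmat" where
  "cext L z = L (\<chi> i. Re (z $ i)) + JJ (L (\<chi> i. Im (z $ i)))"

definition cdmap :: "'a chart \<Rightarrow> ('a \<Rightarrow> cmat) \<Rightarrow> 'a \<Rightarrow> complex^2 \<Rightarrow> cmat" where
  "cdmap c \<sigma> p = cext (dmap c \<sigma> p)"

definition pullback_metric ::
    "'a chart \<Rightarrow> ('a \<Rightarrow> cmat) \<Rightarrow> 'a \<Rightarrow> complex^2 \<Rightarrow> complex^2 \<Rightarrow> complex" where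
  "pullback_metric c \<sigma> p z w = hol_metric (\<sigma> p) (cdmap c \<sigma> p z) (cdmap c \<sigma> p w)"

definition immersion_SL2 :: "'a chart set \<Rightarrow> ('a \<Rightarrow> cmat) \<Rightarrow> bool" where
  "immersion_SL2 \<A> \<sigma> \<longleftrightarrow>
     range \<sigma> \<subseteq> SL2 \<and> smooth_map_on \<A> UNIV \<sigma> \<and> (\<forall>c\<in>\<A>. \<forall>p\<in>fst c. inj (dmap c \<sigma> p))"

definition admissible_immersion :: "'a chart set \<Rightarrow> ('a \<Rightarrow> cmat) \<Rightarrow> bool" where
  "admissible_immersion \<A> \<sigma> \<longleftrightarrow>
     immersion_SL2 \<A> \<sigma> \<and>
     (\<forall>c\<in>\<A>. \<forall>p\<in>fst c. \<forall>z. z \<noteq> 0 \<longrightarrow> (\<exists>w. pullback_metric c \<sigma> p z w \<noteq> 0))"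


section \<open>The shape operator\<close>

definition normal_field ::
    "'a::topological_space chart set \<Rightarrow> ('a \<Rightarrow> cmat) \<Rightarrow> 'a set \<Rightarrow> ('a \<Rightarrow> cmat) \<Rightarrow> bool" where
  "normal_field \<A> \<sigma> V \<nu> \<longleftrightarrow>
     open V \<and> smooth_map_on \<A> V \<nu> \<and>
     (\<forall>p\<in>V. \<nu> p \<in> tangent_SL2 (\<sigma> p) \<and> hol_metric (\<sigma> p) (\<nu> p) (\<nu> p) = 1) \<and>
     (\<forall>c\<in>\<A>. \<forall>p\<in>fst c \<inter> V. \<forall>z. hol_metric (\<sigma> p) (\<nu> p) (cdmap c \<sigma> p z) = 0)"

text \<open>The pull-back of \<open>D\<close> by \<open>\<sigma>\<close>, in the global frame of left invariant fields: write a section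
  \<open>\<xi>\<close> of the pulled back tangent bundle as \<open>\<Sum>\<^sub>i w\<^sub>i (E\<^sub>i \<circ> \<sigma>)\<close>, where the \<open>E\<^sub>i\<close> are left invariant and
  \<open>W = \<sigma>\<inverse> \<xi> = \<Sum>\<^sub>i w\<^sub>i E\<^sub>i(1)\<close>. The first summand is \<open>\<Sum>\<^sub>i dw\<^sub>i(u) E\<^sub>i\<close>, and the second one is
  \<open>\<Sum>\<^sub>i w\<^sub>i D E\<^sub>i\<close> in direction \<open>d\<sigma>(u)\<close>, where \<open>d\<sigma>(u)\<close> is extended to a left invariant field.\<close>

definition pullback_connection ::
    "((cmat \<Rightarrow> cmat) \<Rightarrow> (cmat \<Rightarrow> cmat) \<Rightarrow> cmat \<Rightarrow> cmat) \<Rightarrow>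
     'a chart \<Rightarrow> ('a \<Rightarrow> cmat) \<Rightarrow> ('a \<Rightarrow> cmat) \<Rightarrow> 'a \<Rightarrow> real^2 \<Rightarrow> cmat" where
  "pullback_connection D c \<sigma> \<xi> p u =
     \<sigma> p ** dmap c (\<lambda>q. matrix_inv (\<sigma> q) ** \<xi> q) p u +
     D (left_field (matrix_inv (\<sigma> p) ** dmap c \<sigma> p u)) (left_field (matrix_inv (\<sigma> p) ** \<xi> p)) (\<sigma> p)"

text \<open>For a local normal field \<open>\<nu>\<close>, the covariant derivative of \<open>\<nu>\<close> lies in the image of the injective
  map \<open>cdmap c \<sigma> p\<close>, by which the complexified tangent plane is identified with that image.\<close>

definition shape_operator ::
    "((cmat \<Rightarrow> cmat) \<Rightarrow> (cmat \<Rightarrow> cmat) \<Rightarrow> cmat \<Rightarrow> cmat) \<Rightarrow>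
     'a chart \<Rightarrow> ('a \<Rightarrow> cmat) \<Rightarrow> ('a \<Rightarrow> cmat) \<Rightarrow> 'a \<Rightarrow> complex^2 \<Rightarrow> complex^2" where
  "shape_operator D c \<sigma> \<nu> p z =
     (THE w. cdmap c \<sigma> p w = cext (pullback_connection D c \<sigma> \<nu> p) z)"

definition real_operator :: "(complex^2 \<Rightarrow> complex^2) \<Rightarrow> bool" where
  "real_operator L \<longleftrightarrow> L ` range cplx \<subseteq> range cplx"

definition shape_real ::
    "((cmat \<Rightarrow> cmat) \<Rightarrow> (cmat \<Rightarrow> cmat) \<Rightarrow> cmat \<Rightarrow> cmat) \<Rightarrow>
     'a::topological_space chart set \<Rightarrow> ('a \<Rightarrow> cmat) \<Rightarrow> bool" where
  "shape_real D \<A> \<sigma> \<longleftrightarrow>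
     (\<forall>V \<nu>. normal_field \<A> \<sigma> V \<nu> \<longrightarrow>
        (\<forall>c\<in>\<A>. \<forall>p\<in>fst c \<inter> V. real_operator (shape_operator D c \<sigma> \<nu> p)))"

definition i_shape_real ::
    "((cmat \<Rightarrow> cmat) \<Rightarrow> (cmat \<Rightarrow> cmat) \<Rightarrow> cmat \<Rightarrow> cmat) \<Rightarrow>
     'a::topological_space chart set \<Rightarrow> ('a \<Rightarrow> cmat) \<Rightarrow> bool" where
  "i_shape_real D \<A> \<sigma> \<longleftrightarrow>
     (\<forall>V \<nu>. normal_field \<A> \<sigma> V \<nu> \<longrightarrow>
        (\<forall>c\<in>\<A>. \<forall>p\<in>fst c \<inter> V. real_operator (\<lambda>z. \<i> *s shape_operator D c \<sigma> \<nu> p z)))"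


section \<open>Types of the pull-back metric\<close>

definition pos_definite :: "(real^2 \<Rightarrow> real^2 \<Rightarrow> real) \<Rightarrow> bool" where
  "pos_definite b \<longleftrightarrow> (\<forall>u. u \<noteq> 0 \<longrightarrow> b u u > 0)"

definition neg_definite :: "(real^2 \<Rightarrow> real^2 \<Rightarrow> real) \<Rightarrow> bool" where
  "neg_definite b \<longleftrightarrow> (\<forall>u. u \<noteq> 0 \<longrightarrow> b u u < 0)"

definition signature_1_1 :: "(real^2 \<Rightarrow> real^2 \<Rightarrow> real) \<Rightarrow> bool" where
  "signature_1_1 b \<longleftrightarrow> (\<exists>e\<^sub>1 e\<^sub>2. e\<^sub>1 \<noteq> e\<^sub>2 \<and> independent {e\<^sub>1, e\<^sub>2} \<and> b e\<^sub>1 e\<^sub>1 = 1 \<and> b e\<^sub>2 e\<^sub>2 = -1 \<and> b e\<^sub>1 e\<^sub>2 = 0)"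

definition metric_of_type ::
    "((real^2 \<Rightarrow> real^2 \<Rightarrow> real) \<Rightarrow> bool) \<Rightarrow> 'a chart set \<Rightarrow> ('a \<Rightarrow> cmat) \<Rightarrow> bool" where
  "metric_of_type T \<A> \<sigma> \<longleftrightarrow>
     (\<forall>c\<in>\<A>. \<forall>p\<in>fst c. \<exists>b. (\<forall>u v. pullback_metric c \<sigma> p (cplx u) (cplx v) = complex_of_real (b u v)) \<and> T b)"


section \<open>Pseudo-Riemannian space forms of constant curvature -1\<close>

text \<open>Here \<open>of_nat 4 = (0::4)\<close> is the fourth index.\<close>

definition pform :: "nat \<Rightarrow> real^4 \<Rightarrow> real^4 \<Rightarrow> real" where
  "pform a x y = (\<Sum>k=1..4. (if k \<le> a then 1 else -1) * x $ of_nat k * y $ of_nat k)"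

text \<open>The quadric whose induced metric has signature \<open>(a, 3 - a)\<close>, for \<open>a \<le> 3\<close>.\<close>

definition pquadric :: "nat \<Rightarrow> (real^4) set" where
  "pquadric a = {x. pform a x x = -1}"

text \<open>The upper sheet of the hyperboloid.\<close>

definition hyperbolic_space :: "(real^4) set" where
  "hyperbolic_space = {x \<in> pquadric 3. x $ 4 > 0}"

definition pquadric_tangent :: "nat \<Rightarrow> real^4 \<Rightarrow> (real^4) set" where
  "pquadric_tangent a x = {v. pform a x v = 0}"

text \<open>\<open>N\<close> is a relatively open subset of \<open>pquadric a\<close>, with the induced metric.\<close>

definition isometric_embedding_SL2 :: "nat \<Rightarrow> (real^4) set \<Rightarrow> (real^4 \<Rightarrow> cmat) \<Rightarrow> bool" where
  "isometric_embedding_SL2 a N f \<longleftrightarrow>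
     f ` N \<subseteq> SL2 \<and> smooth_on_subset N f \<and>
     (\<forall>x\<in>N. inj_on (frechet_derivative f (at x within N)) (pquadric_tangent a x)) \<and>
     (\<exists>h. homeomorphism N (f ` N) f h) \<and>
     (\<forall>x\<in>N. \<forall>v\<in>pquadric_tangent a x. \<forall>w\<in>pquadric_tangent a x.
        hol_metric (f x) (frechet_derivative f (at x within N) v) (frechet_derivative f (at x within N) w) =
        complex_of_real (pform a v w))"

end

theory Submission
  imports Defs
begin

text \<open>
  The space of complex two by two matrices with the form \<open>bf\<close>, the polarisation of \<open>- det\<close>, is a flat
  complex quadratic space of dimension four, and \<open>SL2\<close> is the quadric \<open>bf A A = - 1\<close> in it, exactly as
  each model space of the theorem is the quadric \<open>pform a x x = - 1\<close> in real four-space, or one sheet of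
  it. In this picture the shape operator is the flat derivative of the unit normal
  (\<open>pullback_connection_normal\<close>). The isometric embeddings of the model spaces are locally restrictions
  of isometric real linear maps \<open>L\<close>, so the theorem is about the surfaces that lie in a real form
  \<open>E = range L\<close> of the space of matrices.

  Rigidity. An isometric map \<open>f\<close> of a model space extends to the cone over it by \<open>r x \<mapsto> r f x\<close>. The
  extension is an isometry between flat spaces, so its second derivative vanishes
  (\<open>flat_isometry_second_derivative\<close>) and its derivative is locally constant. By connectedness of the
  surface, \<open>\<sigma>\<close> takes values in the range of one linear map (\<open>linear_container\<close>).

  From the real form to the second fundamental form. If \<open>\<sigma>\<close> takes values in \<open>E\<close>, then so do its
  derivatives, and \<open>bf\<close> is real on \<open>E\<close>; hence the metric is real. A unit normal is either in \<open>E\<close> or in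
  \<open>\<i> E\<close> (\<open>unit_normal_dichotomy\<close>), and this alternative is constant on the surface. In the first case the
  derivative of the normal is in \<open>E\<close> and \<open>\<Psi>\<close> is real; in the second case \<open>\<i> \<Psi>\<close> is real. By Sylvester's
  law of inertia, the number \<open>a\<close> of positive directions of \<open>E\<close> is the number \<open>m\<close> of positive directions of
  the metric, plus one in the first case (\<open>type_of_linear_section\<close>).

  From the second fundamental form to the real form. Let \<open>\<kappa>\<close> be \<open>1\<close> or \<open>\<i>\<close>, according to which of \<open>\<Psi>\<close> and
  \<open>\<i> \<Psi>\<close> is real. Derivatives of the frame consisting of \<open>\<sigma>\<close>, two coordinate fields and \<open>\<kappa> \<nu>\<close> are then real
  combinations of the frame (\<open>frame_derivative_real\<close>). Hence its real span is locally constant, by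
  uniqueness for linear differential equations (\<open>transport\<close>), and constant because the surface is
  connected (\<open>real_form_constant\<close>). It contains \<open>\<sigma>\<close>, and an orthonormal basis of it defines the linear
  map (\<open>linear_section_exists\<close>).

  The pairs of \<open>m \<in> {0, 1, 2}\<close> and \<open>\<kappa> \<in> {1, \<i>}\<close> that give the same \<open>a\<close> are the alternatives in the
  four parts of the theorem.
\<close>

section \<open>Calculus of smooth maps\<close>

text \<open>The congruence premise is \<open>Ck_on_cong\<close> below, whose own proof by induction applies this rule with
  the induction hypothesis in its place.\<close>

lemma Ck_on_SucI:
  assumes "open U" and "\<And>x. x \<in> U \<Longrightarrow> (f has_derivative f' x) (at x)"
    and "\<And>v. Ck_on k U (\<lambda>x. f' x v)"
    and cong: "\<And>(g::'a::real_normed_vector \<Rightarrow> 'b::real_normed_vector) h.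
      Ck_on k U g \<Longrightarrow> (\<And>x. x \<in> U \<Longrightarrow> g x = h x) \<Longrightarrow> Ck_on k U h"
  shows "Ck_on (Suc k) U (f :: 'a \<Rightarrow> 'b)"
proof -
  have "f differentiable_on U"
    using assms(1,2) by (meson differentiable_at_imp_differentiable_on differentiableI)
  moreover have "f' x = frechet_derivative f (at x)" if "x \<in> U" for x
    using assms(2)[OF that] by (rule frechet_derivative_at)
  ultimately show ?thesis
    using cong[OF assms(3)] by simp
qed

lemma Ck_on_has_derivative:
  assumes "Ck_on (Suc k) U f" "open U" "x \<in> U"
  shows "(f has_derivative frechet_derivative f (at x)) (at x)"
  using assms by (metis Ck_on.simps(2) at_within_open differentiable_on_def frechet_derivative_works)

lemma Ck_on_cong:
  assumes "open U" "Ck_on k U f" "\<And>x. x \<in> U \<Longrightarrow> f x = g x"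
  shows "Ck_on k U g"
  using assms(2,3)
proof (induction k arbitrary: f g)
  case 0
  then show ?case using continuous_on_eq by fastforce
next
  case (Suc k)
  show ?case
  proof (rule Ck_on_SucI[OF \<open>open U\<close>])
    show "(g has_derivative frechet_derivative f (at x)) (at x)" if "x \<in> U" for x
      using Ck_on_has_derivative[OF Suc.prems(1) \<open>open U\<close> that] has_derivative_transform_within_open
        \<open>open U\<close> that Suc.prems(2) by blast
    show "Ck_on k U (\<lambda>x. frechet_derivative f (at x) v)" for v
      using Suc.prems(1) by simp
  qed (use Suc.IH in blast)
qed

lemmas Ck_on_SucI' = Ck_on_SucI[OF _ _ _ Ck_on_cong]

lemma Ck_on_Suc_imp: "Ck_on (Suc k) U f \<Longrightarrow> Ck_on k U f"
  by (induction k arbitrary: f) (auto intro: differentiable_imp_continuous_on)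

lemma Ck_on_subset: "Ck_on k U f \<Longrightarrow> V \<subseteq> U \<Longrightarrow> Ck_on k V f"
  by (induction k arbitrary: f) (auto intro: continuous_on_subset differentiable_on_subset)

lemma Ck_on_const: "Ck_on k U (\<lambda>x. c)"
  by (induction k arbitrary: c) auto

lemma Ck_on_bounded_linear:
  assumes "bounded_linear h" shows "Ck_on k U h"
proof (cases k)
  case 0
  then show ?thesis using assms by (simp add: linear_continuous_on)
next
  case (Suc k)
  have "frechet_derivative h (at x) = h" for x
    using assms bounded_linear_imp_has_derivative frechet_derivative_at by metis
  moreover have "h differentiable_on U"
    using assms bounded_linear_imp_differentiable_on by blast
  ultimately show ?thesis using Suc by (simp add: Ck_on_const)
qed

lemma Ck_on_add:
  assumes "open U" "Ck_on k U f" "Ck_on k U g"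
  shows "Ck_on k U (\<lambda>x. f x + g x)"
  using assms(2,3)
proof (induction k arbitrary: f g)
  case 0
  then show ?case by (auto intro: continuous_on_add)
next
  case (Suc k)
  show ?case
  proof (rule Ck_on_SucI'[OF \<open>open U\<close> _ _ \<open>open U\<close>])
    show "((\<lambda>x. f x + g x) has_derivative
        (\<lambda>v. frechet_derivative f (at x) v + frechet_derivative g (at x) v)) (at x)" if "x \<in> U" for x
      using Suc.prems that \<open>open U\<close> by (intro has_derivative_add Ck_on_has_derivative)
    show "Ck_on k U (\<lambda>x. frechet_derivative f (at x) v + frechet_derivative g (at x) v)" for v
      using Suc by simp
  qed
qed

lemma Ck_on_bilinear:
  assumes "open U" and h: "bounded_bilinear h" and "Ck_on k U f" "Ck_on k U g"
  shows "Ck_on k U (\<lambda>x. h (f x) (g x))"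
  using assms(3,4)
proof (induction k arbitrary: f g)
  case 0
  then show ?case using bounded_bilinear.continuous_on[OF h] by auto
next
  case (Suc k)
  show ?case
  proof (rule Ck_on_SucI'[OF \<open>open U\<close> _ _ \<open>open U\<close>])
    show "((\<lambda>x. h (f x) (g x)) has_derivative
        (\<lambda>v. h (f x) (frechet_derivative g (at x) v) + h (frechet_derivative f (at x) v) (g x))) (at x)"
      if "x \<in> U" for x
      using Suc.prems that \<open>open U\<close> by (intro bounded_bilinear.FDERIV[OF h] Ck_on_has_derivative)
    show "Ck_on k U (\<lambda>x. h (f x) (frechet_derivative g (at x) v) + h (frechet_derivative f (at x) v) (g x))" for v
      using Suc.prems Ck_on_Suc_imp[OF Suc.prems(1)] Ck_on_Suc_imp[OF Suc.prems(2)]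
      by (intro Ck_on_add \<open>open U\<close> Suc.IH) simp_all
  qed
qed

lemma Ck_on_linear_comp:
  assumes "open U" and h: "bounded_linear h" and "Ck_on k U f"
  shows "Ck_on k U (\<lambda>x. h (f x))"
proof -
  have "bounded_bilinear (\<lambda>(c::real) y. c *\<^sub>R h y)"
    using bounded_bilinear.comp[OF bounded_bilinear_scaleR bounded_linear_ident h] by simp
  from Ck_on_bilinear[OF \<open>open U\<close> this Ck_on_const[of k U 1] assms(3)] show ?thesis by simp
qed

lemma Ck_on_sum:
  assumes "open U" "\<And>i. i \<in> I \<Longrightarrow> Ck_on k U (f i)"
  shows "Ck_on k U (\<lambda>x. \<Sum>i\<in>I. f i x)"
  using assms(2) by (induction I rule: infinite_finite_induct) (auto intro: Ck_on_const Ck_on_add[OF \<open>open U\<close>])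

text \<open>\<open>Ck_on\<close> speaks about derivatives in a constant direction only, whereas the chain rule evaluates the
  derivative of \<open>g\<close> in the moving direction \<open>Df x v\<close>. Expanding this direction in the standard basis
  turns the derivative into a sum of products to which the induction hypothesis applies.\<close>

lemma Ck_on_compose:
  fixes f :: "'a::real_normed_vector \<Rightarrow> 'b::euclidean_space" and g :: "'b \<Rightarrow> 'c::real_normed_vector"
  assumes "open U" "open V" "f ` U \<subseteq> V" and "Ck_on k U f" "Ck_on k V g"
  shows "Ck_on k U (\<lambda>x. g (f x))"
  using assms(4,5)
proof (induction k arbitrary: g)
  case 0
  then show ?case using \<open>f ` U \<subseteq> V\<close> continuous_on_compose2 by auto
next
  case (Suc k)
  let ?g' = "\<lambda>y. frechet_derivative g (at y)"
  show ?case
  proof (rule Ck_on_SucI'[OF \<open>open U\<close> _ _ \<open>open U\<close>])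
    fix x assume "x \<in> U"
    have f: "(f has_derivative frechet_derivative f (at x)) (at x)"
      using Suc.prems \<open>x \<in> U\<close> \<open>open U\<close> by (intro Ck_on_has_derivative)
    have g: "(g has_derivative ?g' (f x)) (at (f x))"
      using Suc.prems \<open>x \<in> U\<close> \<open>open V\<close> \<open>f ` U \<subseteq> V\<close> by (intro Ck_on_has_derivative) auto
    have "?g' (f x) w = (\<Sum>b\<in>Basis. (w \<bullet> b) *\<^sub>R ?g' (f x) b)" for w
    proof -
      have l: "linear (?g' (f x))" using g has_derivative_linear by blast
      have "?g' (f x) w = ?g' (f x) (\<Sum>b\<in>Basis. (w \<bullet> b) *\<^sub>R b)"
        by (simp add: euclidean_representation)
      also have "\<dots> = (\<Sum>b\<in>Basis. (w \<bullet> b) *\<^sub>R ?g' (f x) b)"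
        using l by (simp add: linear_sum linear_cmul)
      finally show ?thesis .
    qed
    then have "(\<lambda>v. ?g' (f x) (frechet_derivative f (at x) v)) =
        (\<lambda>v. \<Sum>b\<in>Basis. (frechet_derivative f (at x) v \<bullet> b) *\<^sub>R ?g' (f x) b)"
      by (rule ext)
    with has_derivative_compose[OF f g] show "((\<lambda>x. g (f x)) has_derivative
        (\<lambda>v. \<Sum>b\<in>Basis. (frechet_derivative f (at x) v \<bullet> b) *\<^sub>R ?g' (f x) b)) (at x)"
      by (rule has_derivative_eq_rhs)
  next
    fix v
    have "Ck_on k U (\<lambda>x. ?g' (f x) b)" for b
      using Suc.prems(2) by (intro Suc.IH Ck_on_Suc_imp[OF Suc.prems(1)]) simp
    moreover have "Ck_on k U (\<lambda>x. frechet_derivative f (at x) v \<bullet> b)" for b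
      using Suc.prems(1) by (intro Ck_on_linear_comp[OF \<open>open U\<close> bounded_linear_inner_left]) simp
    ultimately show "Ck_on k U (\<lambda>x. \<Sum>b\<in>Basis. (frechet_derivative f (at x) v \<bullet> b) *\<^sub>R ?g' (f x) b)"
      by (intro Ck_on_sum Ck_on_bilinear[OF _ bounded_bilinear_scaleR] \<open>open U\<close>) auto
  qed
qed

text \<open>For \<open>r = 1 / sqrt f\<close> one has \<open>r' = - r\<^sup>3 f' / 2\<close>: the derivative is a polynomial in \<open>r\<close> and \<open>f'\<close>,
  so the induction involves no other powers of \<open>f\<close>.\<close>

lemma Ck_on_inverse_sqrt:
  fixes f :: "'a::real_normed_vector \<Rightarrow> real"
  assumes "open U" and pos: "\<And>x. x \<in> U \<Longrightarrow> f x > 0" and "Ck_on k U f"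
  shows "Ck_on k U (\<lambda>x. inverse (sqrt (f x)))"
  using assms(3)
proof (induction k)
  case 0
  then show ?case
    using less_imp_neq[OF pos] by (auto intro!: continuous_on_inverse continuous_on_real_sqrt)
next
  case (Suc k)
  let ?r = "\<lambda>x. inverse (sqrt (f x))"
  show ?case
  proof (rule Ck_on_SucI'[OF \<open>open U\<close> _ _ \<open>open U\<close>])
    fix x assume x: "x \<in> U"
    have "(f has_derivative frechet_derivative f (at x)) (at x)"
      using Suc.prems x \<open>open U\<close> by (intro Ck_on_has_derivative)
    from Deriv.has_derivative_inverse[OF _ has_derivative_real_sqrt[OF pos[OF x] this]]
    show "(?r has_derivative (\<lambda>v. (?r x * (?r x * (?r x * (- 1 / 2)))) * frechet_derivative f (at x) v)) (at x)"
      using pos[OF x] by (auto elim!: has_derivative_eq_rhs simp: field_simps)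
  next
    fix v
    have r: "Ck_on k U ?r" by (rule Suc.IH[OF Ck_on_Suc_imp[OF Suc.prems]])
    note m = Ck_on_bilinear[OF \<open>open U\<close> bounded_bilinear_mult]
    show "Ck_on k U (\<lambda>x. (?r x * (?r x * (?r x * (- 1 / 2)))) * frechet_derivative f (at x) v)"
      by (intro m r Ck_on_const) (use Suc.prems in simp)
  qed
qed

lemma smooth_on_has_derivative:
  assumes "smooth_on U f" "open U" "x \<in> U"
  shows "(f has_derivative frechet_derivative f (at x)) (at x)"
  using assms Ck_on_has_derivative unfolding smooth_on_def by blast

lemma smooth_on_directional:
  "smooth_on U f \<Longrightarrow> smooth_on U (\<lambda>x. frechet_derivative f (at x) v)"
  unfolding smooth_on_def using Ck_on.simps(2) by blast

lemma smooth_on_continuous: "smooth_on U f \<Longrightarrow> continuous_on U f"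
  unfolding smooth_on_def using Ck_on.simps(1) by blast

lemma smooth_on_subset: "smooth_on U f \<Longrightarrow> V \<subseteq> U \<Longrightarrow> smooth_on V f"
  unfolding smooth_on_def using Ck_on_subset by blast

lemma smooth_on_const: "smooth_on U (\<lambda>x. c)"
  unfolding smooth_on_def using Ck_on_const by blast

lemma smooth_on_linear:
  fixes h :: "'a::euclidean_space \<Rightarrow> 'b::real_normed_vector"
  shows "linear h \<Longrightarrow> smooth_on U h"
  unfolding smooth_on_def using Ck_on_bounded_linear linear_conv_bounded_linear by blast

lemma smooth_on_linear_comp:
  fixes h :: "'b::euclidean_space \<Rightarrow> 'c::real_normed_vector"
  shows "open U \<Longrightarrow> linear h \<Longrightarrow> smooth_on U f \<Longrightarrow> smooth_on U (\<lambda>x. h (f x))"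
  unfolding smooth_on_def using Ck_on_linear_comp linear_conv_bounded_linear by blast

lemma smooth_on_add:
  "open U \<Longrightarrow> smooth_on U f \<Longrightarrow> smooth_on U g \<Longrightarrow> smooth_on U (\<lambda>x. f x + g x)"
  unfolding smooth_on_def using Ck_on_add by blast

lemma smooth_on_bilinear:
  "open U \<Longrightarrow> bounded_bilinear h \<Longrightarrow> smooth_on U f \<Longrightarrow> smooth_on U g \<Longrightarrow> smooth_on U (\<lambda>x. h (f x) (g x))"
  unfolding smooth_on_def using Ck_on_bilinear by blast

lemma smooth_on_compose:
  fixes f :: "'a::real_normed_vector \<Rightarrow> 'b::euclidean_space"
  shows "open U \<Longrightarrow> open V \<Longrightarrow> f ` U \<subseteq> V \<Longrightarrow> smooth_on U f \<Longrightarrow> smooth_on V g \<Longrightarrow> smooth_on U (\<lambda>x. g (f x))"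
  unfolding smooth_on_def using Ck_on_compose by blast

lemma smooth_on_inverse_sqrt:
  fixes f :: "'a::real_normed_vector \<Rightarrow> real"
  shows "open U \<Longrightarrow> (\<And>x. x \<in> U \<Longrightarrow> f x > 0) \<Longrightarrow> smooth_on U f \<Longrightarrow> smooth_on U (\<lambda>x. inverse (sqrt (f x)))"
  unfolding smooth_on_def using Ck_on_inverse_sqrt by blast

section \<open>Symmetry of second derivatives\<close>

text \<open>The mean value theorem, applied first in direction \<open>u\<close> and then in direction \<open>v\<close>, expresses the
  second difference as \<open>h\<^sup>2\<close> times a mixed second derivative at a nearby point.\<close>

lemma second_difference:
  fixes f :: "'a::real_normed_vector \<Rightarrow> real"
  assumes "open U" "smooth_on U f" "x \<in> U"
    and e: "e > 0"
  shows "eventually (\<lambda>h. \<bar>(f (x + h *\<^sub>R u + h *\<^sub>R v) - f (x + h *\<^sub>R u) - f (x + h *\<^sub>R v) + f x) / h\<^sup>2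
    - frechet_derivative (\<lambda>y. frechet_derivative f (at y) u) (at x) v\<bar> < e) (at_right 0)"
proof -
  define fu where "fu y = frechet_derivative f (at y) u" for y
  define fuv where "fuv y = frechet_derivative fu (at y) v" for y
  have sfu: "smooth_on U fu" unfolding fu_def by (intro smooth_on_directional assms)
  have sfuv: "smooth_on U fuv" unfolding fuv_def by (intro smooth_on_directional sfu)
  have "continuous_on U fuv" by (rule smooth_on_continuous[OF sfuv])
  then have "isCont fuv x" using assms by (simp add: continuous_on_eq_continuous_at)
  then have "\<forall>\<^sub>F y in at x. dist (fuv y) (fuv x) < e"
    using e unfolding isCont_def by (rule tendstoD)
  moreover have "\<forall>\<^sub>F y in at x. y \<in> U" using assms by (simp add: eventually_at_in_open')
  ultimately have "\<forall>\<^sub>F y in at x. y \<in> U \<and> \<bar>fuv y - fuv x\<bar> < e"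
    by eventually_elim (auto simp: dist_real_def)
  then obtain d where "d > 0" and d: "\<And>y. dist y x < d \<Longrightarrow> y \<noteq> x \<Longrightarrow> y \<in> U \<and> \<bar>fuv y - fuv x\<bar> < e"
    unfolding eventually_at by blast
  then have d: "y \<in> U \<and> \<bar>fuv y - fuv x\<bar> < e" if "dist y x < d" for y
    using that assms(3) e by (cases "y = x") auto
  define M where "M = norm u + norm v + 1"
  have "M > 0" unfolding M_def by (smt (verit) norm_ge_zero)
  have near: "dist (x + s *\<^sub>R u + t *\<^sub>R v) x < d" if "0 \<le> s" "s \<le> h" "0 \<le> t" "t \<le> h" "h < d / M" for s t h
  proof -
    have "dist (x + s *\<^sub>R u + t *\<^sub>R v) x \<le> norm (s *\<^sub>R u) + norm (t *\<^sub>R v)"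
      by (simp add: dist_norm) (metis norm_scaleR norm_triangle_ineq)
    also have "\<dots> \<le> h * norm u + h * norm v"
      using that by (auto intro!: add_mono mult_right_mono)
    also have "\<dots> \<le> h * M" using that unfolding M_def by (simp add: algebra_simps)
    also have "\<dots> < d" using that \<open>M > 0\<close> by (simp add: field_simps)
    finally show ?thesis .
  qed
  have main: "\<bar>(f (x + h *\<^sub>R u + h *\<^sub>R v) - f (x + h *\<^sub>R u) - f (x + h *\<^sub>R v) + f x) / h\<^sup>2 - fuv x\<bar> < e"
    if h: "0 < h" "h < d / M" for h
  proof -
    have der: "((\<lambda>s. g (a + s *\<^sub>R w)) has_real_derivative frechet_derivative g (at (a + s *\<^sub>R w)) w) (at s)"
      if "smooth_on U g" "a + s *\<^sub>R w \<in> U" for g :: "'a \<Rightarrow> real" and s a w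
    proof -
      have l: "((\<lambda>s. a + s *\<^sub>R w) has_derivative (\<lambda>t. t *\<^sub>R w)) (at s)"
        by (auto intro!: derivative_eq_intros)
      have g: "(g has_derivative frechet_derivative g (at (a + s *\<^sub>R w))) (at (a + s *\<^sub>R w))"
        by (rule smooth_on_has_derivative[OF that(1) \<open>open U\<close> that(2)])
      from has_derivative_compose[OF l g] show ?thesis
        unfolding has_field_derivative_def
        by (rule has_derivative_eq_rhs)
          (auto simp: linear_cmul[OF has_derivative_linear[OF g]] mult.commute)
    qed
    \<comment> \<open>The difference in direction \<open>v\<close>, as a function on the segment in direction \<open>u\<close>.\<close>
    let ?\<phi> = "\<lambda>s. f ((x + h *\<^sub>R v) + s *\<^sub>R u) - f (x + s *\<^sub>R u)"
    have inU: "x + s *\<^sub>R u + t *\<^sub>R v \<in> U" if "0 \<le> s" "s \<le> h" "0 \<le> t" "t \<le> h" for s t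
      using d[OF near[OF that h(2)]] by simp
    have d\<phi>: "(?\<phi> has_real_derivative fu ((x + h *\<^sub>R v) + s *\<^sub>R u) - fu (x + s *\<^sub>R u)) (at s)"
      if "0 \<le> s" "s \<le> h" for s
      unfolding fu_def using inU[of s h] inU[of s 0] that h
      by (intro DERIV_diff der assms) (auto simp: algebra_simps)
    obtain \<xi> where \<xi>: "0 < \<xi>" "\<xi> < h"
      "?\<phi> h - ?\<phi> 0 = (h - 0) * (fu ((x + h *\<^sub>R v) + \<xi> *\<^sub>R u) - fu (x + \<xi> *\<^sub>R u))"
      using MVT2[OF h(1) d\<phi>] by blast
    have d\<psi>: "((\<lambda>t. fu (x + \<xi> *\<^sub>R u + t *\<^sub>R v)) has_real_derivative fuv (x + \<xi> *\<^sub>R u + t *\<^sub>R v)) (at t)"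
      if "0 \<le> t" "t \<le> h" for t
      unfolding fuv_def using inU[of \<xi> t] that \<xi> by (intro der sfu) auto
    obtain \<eta> where \<eta>: "0 < \<eta>" "\<eta> < h"
      "fu (x + \<xi> *\<^sub>R u + h *\<^sub>R v) - fu (x + \<xi> *\<^sub>R u + 0 *\<^sub>R v) = (h - 0) * fuv (x + \<xi> *\<^sub>R u + \<eta> *\<^sub>R v)"
      using MVT2[OF h(1) d\<psi>] by blast
    have "f (x + h *\<^sub>R u + h *\<^sub>R v) - f (x + h *\<^sub>R u) - f (x + h *\<^sub>R v) + f x = h\<^sup>2 * fuv (x + \<xi> *\<^sub>R u + \<eta> *\<^sub>R v)"
      using \<xi>(3) \<eta>(3) by (simp add: power2_eq_square algebra_simps)
    then have "(f (x + h *\<^sub>R u + h *\<^sub>R v) - f (x + h *\<^sub>R u) - f (x + h *\<^sub>R v) + f x) / h\<^sup>2 = fuv (x + \<xi> *\<^sub>R u + \<eta> *\<^sub>R v)"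
      using h by simp
    then show ?thesis using d[OF near, of \<xi> h \<eta>] \<xi> \<eta> h by auto
  qed
  show ?thesis
    using main \<open>M > 0\<close> \<open>d > 0\<close> unfolding fu_def[symmetric] fuv_def[symmetric]
    by (auto simp: eventually_at_right[OF zero_less_one] intro!: exI[of _ "d / M"])
qed

text \<open>The second difference is symmetric in \<open>u\<close> and \<open>v\<close>, and its quotient by \<open>h\<^sup>2\<close> tends to either mixed
  derivative.\<close>

lemma second_derivative_commute_real:
  fixes f :: "'a::real_normed_vector \<Rightarrow> real"
  assumes "open U" "smooth_on U f" "x \<in> U"
  shows "frechet_derivative (\<lambda>y. frechet_derivative f (at y) u) (at x) v =
    frechet_derivative (\<lambda>y. frechet_derivative f (at y) v) (at x) u" (is "?a = ?b")
proof (rule ccontr)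
  assume "?a \<noteq> ?b"
  then have e: "\<bar>?a - ?b\<bar> / 2 > 0" by simp
  have "eventually (\<lambda>h::real. False) (at_right 0)"
    using second_difference[OF assms e, of u v] second_difference[OF assms e, of v u]
  proof eventually_elim
    case (elim h)
    have "f (x + h *\<^sub>R v + h *\<^sub>R u) - f (x + h *\<^sub>R v) - f (x + h *\<^sub>R u) + f x =
      f (x + h *\<^sub>R u + h *\<^sub>R v) - f (x + h *\<^sub>R u) - f (x + h *\<^sub>R v) + f x"
      by (simp add: algebra_simps)
    moreover have "\<bar>p - q\<bar> < \<bar>q - r\<bar> / 2 \<Longrightarrow> \<bar>p - r\<bar> < \<bar>q - r\<bar> / 2 \<Longrightarrow> False" for p q r :: real
      using abs_triangle_ineq4[of "p - r" "p - q"] by simp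
    ultimately show ?case using elim by metis
  qed
  then show False by simp
qed

lemma second_derivative_commute:
  fixes f :: "'a::real_normed_vector \<Rightarrow> 'b::euclidean_space"
  assumes "open U" "smooth_on U f" "x \<in> U"
  shows "frechet_derivative (\<lambda>y. frechet_derivative f (at y) u) (at x) v =
    frechet_derivative (\<lambda>y. frechet_derivative f (at y) v) (at x) u"
proof (rule euclidean_eqI)
  fix b :: 'b
  have lin: "linear (\<lambda>z. z \<bullet> b)" by (simp add: bounded_linear.linear bounded_linear_inner_left)
  have *: "frechet_derivative (\<lambda>y. g y \<bullet> b) (at y) w = frechet_derivative g (at y) w \<bullet> b"
    if "smooth_on U g" "y \<in> U" for g :: "'a \<Rightarrow> 'b" and y w
    using has_derivative_inner_left[OF smooth_on_has_derivative[OF that(1) \<open>open U\<close> that(2)]]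
    by (metis frechet_derivative_at)
  have **: "frechet_derivative (\<lambda>y. frechet_derivative (\<lambda>y. f y \<bullet> b) (at y) w) (at x) w' =
    frechet_derivative (\<lambda>y. frechet_derivative f (at y) w) (at x) w' \<bullet> b" for w w'
  proof -
    have s: "smooth_on U (\<lambda>y. frechet_derivative f (at y) w)" by (rule smooth_on_directional[OF assms(2)])
    have "((\<lambda>y. frechet_derivative f (at y) w \<bullet> b) has_derivative
      (\<lambda>v. frechet_derivative (\<lambda>y. frechet_derivative f (at y) w) (at x) v \<bullet> b)) (at x)"
      by (rule has_derivative_inner_left[OF smooth_on_has_derivative[OF s assms(1,3)]])
    then have "((\<lambda>y. frechet_derivative (\<lambda>y. f y \<bullet> b) (at y) w) has_derivative
      (\<lambda>v. frechet_derivative (\<lambda>y. frechet_derivative f (at y) w) (at x) v \<bullet> b)) (at x)"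
      by (rule has_derivative_transform_within_open[OF _ assms(1,3)]) (simp add: *[OF assms(2)])
    then show ?thesis by (metis frechet_derivative_at)
  qed
  show "frechet_derivative (\<lambda>y. frechet_derivative f (at y) u) (at x) v \<bullet> b =
    frechet_derivative (\<lambda>y. frechet_derivative f (at y) v) (at x) u \<bullet> b"
    using second_derivative_commute_real[OF assms(1) smooth_on_linear_comp[OF assms(1) lin assms(2)] assms(3), of u v]
    unfolding ** .
qed

section \<open>The determinant form on two by two matrices\<close>

text \<open>The polarisation of \<open>- det\<close>. With this form, \<open>SL2\<close> is the quadric \<open>bf A A = - 1\<close> in the flat complex
  space of all matrices, its tangent space at \<open>A\<close> is the orthogonal complement of \<open>A\<close>, and its metric
  is induced from \<open>bf\<close>. Everything below is phrased in this flat picture.\<close>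

definition bf :: "cmat \<Rightarrow> cmat \<Rightarrow> complex" where
  "bf X Y = - (X$1$1 * Y$2$2 + X$2$2 * Y$1$1 - X$1$2 * Y$2$1 - X$2$1 * Y$1$2) / 2"

definition adjugate :: "cmat \<Rightarrow> cmat" where
  "adjugate X = (\<chi> i j. if i = 1 then (if j = 1 then X$2$2 else - X$1$2)
                         else (if j = 1 then - X$2$1 else X$1$1))"

lemmas mat2 = vec_eq_iff forall_2 matrix_matrix_mult_def sum_2 adjugate_def trace_def cscale_def mat_def

lemma bf_commute: "bf X Y = bf Y X"
  by (simp add: bf_def algebra_simps)

lemma bf_add: "bf (X + Y) Z = bf X Z + bf Y Z" "bf Z (X + Y) = bf Z X + bf Z Y"
  by (simp_all add: bf_def field_simps)

lemma bf_diff: "bf (X - Y) Z = bf X Z - bf Y Z" "bf Z (X - Y) = bf Z X - bf Z Y"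
  by (simp_all add: bf_def field_simps)

lemma bf_minus: "bf (- X) Z = - bf X Z" "bf Z (- X) = - bf Z X"
  by (simp_all add: bf_def field_simps)

lemma bf_zero [simp]: "bf 0 Z = 0" "bf Z 0 = 0"
  by (simp_all add: bf_def)

lemma bf_cscale: "bf (cscale c X) Z = c * bf X Z" "bf Z (cscale c X) = c * bf Z X"
  by (simp_all add: bf_def cscale_def field_simps)

lemma bf_scaleR: "bf (r *\<^sub>R X) Z = r * bf X Z" "bf Z (r *\<^sub>R X) = r * bf Z X"
  by (simp_all add: bf_def scaleR_conv_of_real[where 'a=complex] field_simps)

lemmas bf_simps = bf_add bf_diff bf_minus bf_cscale bf_scaleR

lemma bf_sum: "bf (\<Sum>i\<in>I. f i) Z = (\<Sum>i\<in>I. bf (f i) Z)"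
  by (induction I rule: infinite_finite_induct) (auto simp: bf_simps)

lemma cscale_simps:
  "cscale a (X + Y) = cscale a X + cscale a Y"
  "cscale a (X - Y) = cscale a X - cscale a Y"
  "cscale (a + b) X = cscale a X + cscale b X"
  "cscale a (cscale b X) = cscale (a * b) X"
  "cscale (of_real r) X = r *\<^sub>R X"
  "cscale 1 X = X" "cscale 0 X = 0" "cscale a 0 = 0"
  "cscale (-1) X = - X"
  "cscale a (r *\<^sub>R X) = r *\<^sub>R cscale a X"
  by (simp_all add: cscale_def vec_eq_iff algebra_simps scaleR_conv_of_real[where 'a=complex])

lemma bounded_bilinear_bf: "bounded_bilinear bf"
  unfolding bilinear_conv_bounded_bilinear[symmetric] bilinear_def
  by (auto intro!: linearI simp: bf_simps) (simp_all add: bf_scaleR scaleR_conv_of_real[where 'a=complex])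

lemma bounded_bilinear_cscale: "bounded_bilinear cscale"
  unfolding bilinear_conv_bounded_bilinear[symmetric] bilinear_def
  by (auto intro!: linearI simp: cscale_def vec_eq_iff algebra_simps)

lemma bounded_bilinear_matrix_mult: "bounded_bilinear ((**) :: cmat \<Rightarrow> cmat \<Rightarrow> cmat)"
  unfolding bilinear_conv_bounded_bilinear[symmetric] bilinear_def
  by (auto intro!: linearI simp: mat2 algebra_simps)

lemma linear_adjugate: "linear adjugate"
  by (auto intro!: linearI simp: mat2)

lemma linear_cscale: "linear (cscale c)"
  by (auto intro!: linearI simp: cscale_simps)

lemma bf_nondegenerate:
  assumes "\<And>Y. bf X Y = 0" shows "X = 0"
proof -
  have "bf X (\<chi> i j. if i = a \<and> j = b then 1 else 0) = 0" for a b using assms .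
  from this[of 1 1] this[of 1 2] this[of 2 1] this[of 2 2]
  show ?thesis by (simp add: bf_def vec_eq_iff forall_2)
qed

lemma SL2_iff: "A \<in> SL2 \<longleftrightarrow> bf A A = - 1"
proof -
  have "bf A A = - det A" by (simp add: bf_def det_2 field_simps)
  then show ?thesis by (auto simp: SL2_def)
qed

lemma adjugate_mult: "A \<in> SL2 \<Longrightarrow> A ** adjugate A = mat 1" "A \<in> SL2 \<Longrightarrow> adjugate A ** A = mat 1"
  by (auto simp: SL2_def det_2 mat2 algebra_simps)

lemma matrix_inv_SL2: "A \<in> SL2 \<Longrightarrow> matrix_inv A = adjugate A"
  unfolding matrix_inv_def
  by (rule some_equality) (metis adjugate_mult matrix_mul_assoc matrix_mul_lid matrix_mul_rid)+

lemma mat_cancel: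
  assumes "A \<in> SL2" shows "A ** (adjugate A ** X) = X" "adjugate A ** (A ** X) = X"
  using adjugate_mult[OF assms] by (simp_all add: matrix_mul_assoc)

lemma trace_adjugate_mult: "trace (adjugate A ** X) = - 2 * bf A X"
  by (simp add: mat2 bf_def field_simps)

lemma tangent_SL2_iff: 
  assumes "A \<in> SL2" shows "X \<in> tangent_SL2 A \<longleftrightarrow> bf A X = 0"
proof
  assume "X \<in> tangent_SL2 A"
  then obtain V where "X = A ** V" "trace V = 0" unfolding tangent_SL2_def by auto
  then have "trace (adjugate A ** X) = 0" using mat_cancel(2)[OF assms, of V] by simp
  then show "bf A X = 0" by (simp add: trace_adjugate_mult)
next
  assume "bf A X = 0"
  then have "trace (adjugate A ** X) = 0" by (simp add: trace_adjugate_mult)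
  then show "X \<in> tangent_SL2 A" using mat_cancel[OF assms, of X] unfolding tangent_SL2_def by force
qed

text \<open>By the polynomial identity in the proof, the two forms differ by a multiple of
  \<open>bf A X * bf A Y\<close>, which vanishes on tangent vectors.\<close>

lemma hol_metric_eq:
  assumes "A \<in> SL2" "bf A X = 0" "bf A Y = 0" shows "hol_metric A X Y = bf X Y"
proof -
  have "trace ((adjugate A ** X) ** (adjugate A ** Y)) = 4 * bf A X * bf A Y - 2 * bf A A * bf X Y"
    by (simp add: mat2 bf_def field_simps)
  then show ?thesis using assms by (simp add: hol_metric_def matrix_inv_SL2 SL2_iff)
qed

text \<open>Biorthogonality says that two complex four by four matrices are inverse to each other on one side,
  hence on both; the other side is the expansion.\<close>

lemma biorthogonal_expansion:
  fixes w w' :: "4 \<Rightarrow> cmat"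
  assumes "\<And>k l. bf (w k) (w' l) = (if k = l then 1 else 0)"
  shows "X = (\<Sum>k\<in>UNIV. cscale (bf X (w' k)) (w k))"
proof -
  define cv :: "cmat \<Rightarrow> complex^4" where
    "cv X = (\<chi> m. if m = 1 then X$1$1 else if m = 2 then X$1$2 else if m = 3 then X$2$1 else X$2$2)" for X
  define dv :: "cmat \<Rightarrow> complex^4" where
    "dv Y = (\<chi> m. if m = 1 then - Y$2$2/2 else if m = 2 then Y$2$1/2 else if m = 3 then Y$1$2/2 else - Y$1$1/2)" for Y
  have bf: "bf X Y = (\<Sum>m\<in>UNIV. cv X $ m * dv Y $ m)" for X Y
    by (simp add: bf_def cv_def dv_def sum_4 field_simps)
  define M where "M = (\<chi> k m. cv (w k) $ m)"
  define N where "N = (\<chi> m l. dv (w' l) $ m)"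
  have "M ** N = mat 1"
    using assms by (simp add: M_def N_def matrix_matrix_mult_def mat_def vec_eq_iff bf[symmetric])
  then have "N ** M = mat 1" using matrix_left_right_inverse by blast
  then have NM: "(\<Sum>l\<in>UNIV. dv (w' l) $ i * cv (w l) $ j) = (if i = j then 1 else 0)" for i j
    by (simp add: M_def N_def matrix_matrix_mult_def mat_def vec_eq_iff)
  have "cv (\<Sum>k\<in>UNIV. cscale (bf X (w' k)) (w k)) $ j = (\<Sum>k\<in>UNIV. bf X (w' k) * cv (w k) $ j)" for j
    by (simp add: cv_def cscale_def)
  also have "\<dots> j = cv X $ j" for j
  proof -
    have "(\<Sum>k\<in>UNIV. bf X (w' k) * cv (w k) $ j) = (\<Sum>k\<in>UNIV. \<Sum>i\<in>UNIV. cv X $ i * (dv (w' k) $ i * cv (w k) $ j))"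
      by (simp add: bf sum_distrib_right mult.assoc)
    also have "\<dots> = (\<Sum>i\<in>UNIV. cv X $ i * (\<Sum>k\<in>UNIV. dv (w' k) $ i * cv (w k) $ j))"
      by (subst sum.swap) (simp add: sum_distrib_left)
    also have "\<dots> = cv X $ j" by (simp add: NM if_distrib cong: if_cong)
    finally show ?thesis .
  qed
  finally have "cv (\<Sum>k\<in>UNIV. cscale (bf X (w' k)) (w k)) = cv X" by (simp add: vec_eq_iff)
  moreover have "cv X = cv Y \<Longrightarrow> X = Y" for X Y
    by (auto simp: cv_def vec_eq_iff forall_2 forall_4 split: if_splits)
  ultimately show ?thesis by metis
qed

text \<open>The frame consisting of the position vector, a unit normal and two tangent vectors is in general not
  orthonormal, but it becomes biorthogonal to a second frame after inverting the Gram matrix of the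
  tangent vectors. The coefficients are quotients of pairings, so they are real when all pairings are
  real. This is how reality of forms is converted into reality of operators.\<close>

lemma frame_expansion:
  fixes A N X\<^sub>1 X\<^sub>2 X :: cmat
  assumes AA: "bf A A = -1" and NN: "bf N N = 1" and AN: "bf A N = 0"
    and A1: "bf A X\<^sub>1 = 0" and A2: "bf A X\<^sub>2 = 0" and N1: "bf N X\<^sub>1 = 0" and N2: "bf N X\<^sub>2 = 0"
    and \<Delta>: "\<Delta> = bf X\<^sub>1 X\<^sub>1 * bf X\<^sub>2 X\<^sub>2 - bf X\<^sub>1 X\<^sub>2 * bf X\<^sub>1 X\<^sub>2" "\<Delta> \<noteq> 0"
  shows "X = cscale (- bf X A) A + cscale (bf X N) N
    + cscale ((bf X\<^sub>2 X\<^sub>2 * bf X X\<^sub>1 - bf X\<^sub>1 X\<^sub>2 * bf X X\<^sub>2) / \<Delta>) X\<^sub>1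
    + cscale ((bf X\<^sub>1 X\<^sub>1 * bf X X\<^sub>2 - bf X\<^sub>1 X\<^sub>2 * bf X X\<^sub>1) / \<Delta>) X\<^sub>2"
proof -
  define w where "w = (\<lambda>k::4. if k = 1 then A else if k = 2 then N else if k = 3 then X\<^sub>1 else X\<^sub>2)"
  define w' where "w' = (\<lambda>k::4. if k = 1 then - A else if k = 2 then N
    else if k = 3 then cscale (bf X\<^sub>2 X\<^sub>2 / \<Delta>) X\<^sub>1 - cscale (bf X\<^sub>1 X\<^sub>2 / \<Delta>) X\<^sub>2
    else cscale (bf X\<^sub>1 X\<^sub>1 / \<Delta>) X\<^sub>2 - cscale (bf X\<^sub>1 X\<^sub>2 / \<Delta>) X\<^sub>1)"
  have c: "bf N A = 0" "bf X\<^sub>1 A = 0" "bf X\<^sub>2 A = 0" "bf X\<^sub>1 N = 0" "bf X\<^sub>2 N = 0" "bf X\<^sub>2 X\<^sub>1 = bf X\<^sub>1 X\<^sub>2"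
    using assms by (simp_all add: bf_commute)
  have "\<forall>k l. bf (w k) (w' l) = (if k = l then 1 else 0)"
    using assms c by (simp add: forall_4 w_def w'_def bf_simps field_simps)
  then have "X = (\<Sum>k\<in>UNIV. cscale (bf X (w' k)) (w k))"
    by (intro biorthogonal_expansion) auto
  then show ?thesis
    by (simp add: sum_4 w_def w'_def bf_simps diff_divide_distrib)
qed

section \<open>Derivatives along the quadrics\<close>

text \<open>A derivative within a set is determined only on the velocities of curves in that set; this lemma and
  the next one make the derivatives within \<open>SL2\<close> and within the real quadrics computable on tangent
  vectors.\<close>

lemma has_vector_derivative_along_curve:
  assumes \<gamma>: "(\<gamma> has_vector_derivative v) (at (0::real))" and "\<gamma> 0 = x"
    and ev: "eventually (\<lambda>t. \<gamma> t \<in> N) (at 0)" and "x \<in> N"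
    and f: "(f has_derivative f') (at x within N)"
  shows "((\<lambda>t. f (\<gamma> t)) has_vector_derivative f' v) (at 0)"
proof -
  obtain T where T: "open T" "0 \<in> T" "\<And>t. t \<in> T \<Longrightarrow> \<gamma> t \<in> N"
    using ev \<open>\<gamma> 0 = x\<close> \<open>x \<in> N\<close> unfolding eventually_at_topological by (metis UNIV_I)
  have "(\<gamma> has_derivative (\<lambda>t. t *\<^sub>R v)) (at 0 within T)"
    using \<gamma> unfolding has_vector_derivative_def by (rule has_derivative_at_withinI)
  moreover have "(f has_derivative f') (at (\<gamma> 0) within \<gamma> ` T)"
    using f T(3) unfolding \<open>\<gamma> 0 = x\<close> by (auto intro: has_derivative_subset)
  ultimately have "((\<lambda>t. f (\<gamma> t)) has_derivative (\<lambda>t. f' (t *\<^sub>R v))) (at 0 within T)"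
    by (rule has_derivative_in_compose)
  moreover have "f' (t *\<^sub>R v) = t *\<^sub>R f' v" for t
    using linear_cmul[OF has_derivative_linear[OF f]] .
  ultimately show ?thesis
    unfolding has_vector_derivative_def by (simp add: at_within_open[OF T(2,1)])
qed

lemma frechet_derivative_within_tangent:
  assumes \<gamma>: "(\<gamma> has_vector_derivative v) (at (0::real))" "\<gamma> 0 = x"
    and ev: "eventually (\<lambda>t. \<gamma> t \<in> N) (at 0)" and "x \<in> N"
    and f: "(f has_derivative f') (at x within N)"
  shows "frechet_derivative f (at x within N) v = f' v"
proof -
  have "(f has_derivative frechet_derivative f (at x within N)) (at x within N)"
    using f frechet_derivative_works differentiableI by blast
  then show ?thesis
    using has_vector_derivative_along_curve[OF \<gamma> ev \<open>x \<in> N\<close> f]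
      has_vector_derivative_along_curve[OF \<gamma> ev \<open>x \<in> N\<close>] vector_derivative_unique_at by metis
qed

text \<open>The plane spanned by \<open>A\<close> and \<open>X\<close> meets the quadric in a conic, and
  \<open>((1 - \<kappa> t\<^sup>2) A + t X) / (1 + \<kappa> t\<^sup>2)\<close> is its rational parametrisation from \<open>A\<close> with velocity \<open>X\<close>
  when \<open>4 \<kappa> = - bf X X\<close>. It avoids complex square roots.\<close>

lemma SL2_curve:
  assumes A: "A \<in> SL2" "bf A X = 0"
  obtains \<gamma> where "(\<gamma> has_vector_derivative X) (at (0::real))" "\<gamma> 0 = A" "eventually (\<lambda>t. \<gamma> t \<in> SL2) (at 0)"
proof
  define \<kappa> where "\<kappa> = - bf X X / 4"
  let ?a = "\<lambda>t::real. (1 - \<kappa> * (of_real t)\<^sup>2) / (1 + \<kappa> * (of_real t)\<^sup>2)"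
  let ?b = "\<lambda>t::real. of_real t / (1 + \<kappa> * (of_real t)\<^sup>2)"
  let ?\<gamma> = "\<lambda>t. cscale (?a t) A + cscale (?b t) X"
  have a: "(?a has_vector_derivative 0) (at 0)"
    by (rule has_vector_derivative_real_field[where f="\<lambda>z. (1 - \<kappa> * z\<^sup>2) / (1 + \<kappa> * z\<^sup>2)"])
      (auto intro!: derivative_eq_intros)
  have b: "(?b has_vector_derivative 1) (at 0)"
    by (rule has_vector_derivative_real_field[where f="\<lambda>z. z / (1 + \<kappa> * z\<^sup>2)"])
      (auto intro!: derivative_eq_intros)
  have cs: "((\<lambda>t. cscale (f t) Y) has_vector_derivative cscale f' Y) (at 0)"
    if "(f has_vector_derivative f') (at 0)" for f :: "real \<Rightarrow> complex" and f' Y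
    using bounded_linear.has_vector_derivative[OF bounded_bilinear.bounded_linear_left[OF bounded_bilinear_cscale] that] .
  show "(?\<gamma> has_vector_derivative X) (at 0)"
    using has_vector_derivative_add[OF cs[OF a] cs[OF b]] by (simp add: cscale_simps)
  show "?\<gamma> 0 = A" by (simp add: cscale_simps)
  have "((\<lambda>t. 1 + \<kappa> * (of_real t)\<^sup>2) \<longlongrightarrow> 1 + \<kappa> * (of_real 0)\<^sup>2) (at (0::real))"
    by (intro tendsto_intros)
  then have "\<forall>\<^sub>F t in at (0::real). 1 + \<kappa> * (of_real t)\<^sup>2 \<noteq> 0"
    by (rule tendsto_imp_eventually_ne) simp
  then show "\<forall>\<^sub>F t in at 0. ?\<gamma> t \<in> SL2"
  proof eventually_elim
    case (elim t)
    have "bf (?\<gamma> t) (?\<gamma> t) = - (?a t)\<^sup>2 + (?b t)\<^sup>2 * bf X X"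
      using A by (simp add: bf_simps SL2_iff bf_commute[of X A] power2_eq_square)
    also have "\<dots> = (- (1 - \<kappa> * (of_real t)\<^sup>2)\<^sup>2 + (of_real t)\<^sup>2 * (- 4 * \<kappa>)) / (1 + \<kappa> * (of_real t)\<^sup>2)\<^sup>2"
      by (simp add: \<kappa>_def power_divide diff_divide_distrib)
    also have "- (1 - \<kappa> * (of_real t)\<^sup>2)\<^sup>2 + (of_real t)\<^sup>2 * (- 4 * \<kappa>) = - ((1 + \<kappa> * (of_real t)\<^sup>2)\<^sup>2)"
      by (simp add: power2_eq_square algebra_simps)
    finally show ?case using elim by (simp add: SL2_iff)
  qed
qed

lemma frechet_derivative_SL2:
  assumes "A \<in> SL2" "bf A X = 0" "(F has_derivative F') (at A)" "\<And>B. B \<in> SL2 \<Longrightarrow> f B = F B"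
  shows "frechet_derivative f (at A within SL2) X = F' X"
proof -
  have "(f has_derivative F') (at A within SL2)"
    using has_derivative_at_withinI[OF assms(3)] assms(1,4)
    by (rule has_derivative_transform[rotated 2])
  then show ?thesis
    using SL2_curve[OF assms(1,2)] frechet_derivative_within_tangent[OF _ _ _ assms(1)] by blast
qed

section \<open>The Levi-Civita connection\<close>

lemma levi_civita_SL2D:
  assumes "levi_civita_SL2 D" "vector_field_SL2 X" "vector_field_SL2 Y"
  shows "vector_field_SL2 (D X Y)"
    and "A \<in> SL2 \<Longrightarrow> D X Y A - D Y X A = lie_bracket X Y A"
    and "vector_field_SL2 Z \<Longrightarrow> A \<in> SL2 \<Longrightarrow> dir_deriv X (\<lambda>B. hol_metric B (Y B) (Z B)) A =
      hol_metric A (D X Y A) (Z A) + hol_metric A (Y A) (D X Z A)"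
  using assms(2,3) assms(1)[unfolded levi_civita_SL2_def affine_connection_SL2_def] by simp_all

lemma trace_mult_commute: "trace (V ** W) = trace (W ** V)" for V W :: cmat
  by (simp add: mat2 algebra_simps)

lemma trace_diff_cmat: "trace (V - W) = trace V - trace W" for V W :: cmat
  by (simp add: mat2)

lemma smooth_on_linear_imp_subset:
  fixes h :: "'a::euclidean_space \<Rightarrow> 'b::real_normed_vector"
  shows "linear h \<Longrightarrow> smooth_on_subset N h"
  unfolding smooth_on_subset_def using smooth_on_linear by blast

lemma linear_left_field: "linear (left_field V)"
  unfolding left_field_def by (auto intro!: linearI simp: mat2 algebra_simps)

lemma vector_field_left_field: "trace V = 0 \<Longrightarrow> vector_field_SL2 (left_field V)"
  unfolding vector_field_SL2_def tangent_SL2_def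
  using smooth_on_linear_imp_subset[OF linear_left_field] by (auto simp: left_field_def)

lemma matrix_diff_ldistrib: "A ** (V - W) = A ** V - A ** W" for A :: cmat
  by (simp add: mat2 algebra_simps)

text \<open>The Koszul formula for left invariant fields. Their inner products are constant, so that only brackets
  remain, and invariance of the trace form under \<open>ad\<close> collapses the three bracket terms into one.\<close>

lemma levi_civita_left_field:
  assumes D: "levi_civita_SL2 D" and V: "trace V = 0" and W: "trace W = 0" and A: "A \<in> SL2"
  shows "D (left_field V) (left_field W) A = (1/2) *\<^sub>R (A ** (V ** W - W ** V))"
proof -
  define T where "T U = (trace U = 0)" for U :: cmat
  have vf: "vector_field_SL2 (left_field U)" if "T U" for U
    using that vector_field_left_field T_def by blast
  have tang: "bf A (A ** U) = 0" if "T U" for U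
    using that tangent_SL2_iff[OF A] unfolding tangent_SL2_def T_def by blast
  have bfA: "bf (B ** P) (B ** Q) = - trace (P ** adjugate Q) / 2" if "B \<in> SL2" for B P Q
  proof -
    have "bf (B ** P) (B ** Q) = bf B B * (trace (P ** adjugate Q) / 2)"
      by (simp add: mat2 bf_def field_simps)
    then show ?thesis using that[unfolded SL2_iff] by (simp only:) simp
  qed
  have bfT: "bf (B ** P) (B ** Q) = trace (P ** Q) / 2" if "B \<in> SL2" "T Q" for B P Q
  proof -
    have "Q $ 2 $ 2 = - Q $ 1 $ 1"
      using that(2) unfolding T_def trace_def sum_2 by (simp add: add_eq_0_iff)
    then have "adjugate Q = - Q" by (simp add: mat2)
    moreover have "trace (P ** (- Q)) = - trace (P ** Q)" by (simp add: mat2)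
    ultimately show ?thesis using bfA[OF that(1), of P Q] by simp
  qed
  have DT: "bf A (D (left_field P) (left_field Q) A) = 0" if "T P" "T Q" for P Q
  proof -
    have "vector_field_SL2 (D (left_field P) (left_field Q))"
      by (intro levi_civita_SL2D(1)[OF D] vf that)
    then show ?thesis using A tangent_SL2_iff unfolding vector_field_SL2_def by blast
  qed
  have compat: "bf (D (left_field P) (left_field Q) A) (A ** R) + bf (A ** Q) (D (left_field P) (left_field R) A) = 0"
    if "T P" "T Q" "T R" for P Q R
  proof -
    have "dir_deriv (left_field P) (\<lambda>B. hol_metric B (left_field Q B) (left_field R B)) A = 0"
      unfolding dir_deriv_def
    proof (rule frechet_derivative_SL2[OF A])
      show "bf A (left_field P A) = 0" using tang that by (simp add: left_field_def)
      show "((\<lambda>_. trace (Q ** R) / 2) has_derivative (\<lambda>_. 0)) (at A)" by simp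
      show "hol_metric B (left_field Q B) (left_field R B) = trace (Q ** R) / 2" if "B \<in> SL2" for B
        by (simp add: hol_metric_def left_field_def matrix_inv_SL2 that mat_cancel)
    qed
    moreover have "dir_deriv (left_field P) (\<lambda>B. hol_metric B (left_field Q B) (left_field R B)) A =
        hol_metric A (D (left_field P) (left_field Q) A) (left_field R A) +
        hol_metric A (left_field Q A) (D (left_field P) (left_field R) A)"
      by (intro levi_civita_SL2D(3)[OF D] vf that A)
    ultimately show ?thesis
      using hol_metric_eq[OF A] DT tang that by (simp add: left_field_def)
  qed
  have deriv: "dir_deriv (left_field P) (left_field Q) A = A ** (P ** Q)" if "T P" for P Q
    unfolding dir_deriv_def
  proof (rule trans)
    show "frechet_derivative (left_field Q) (at A within SL2) (left_field P A) = left_field Q (left_field P A)"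
    proof (rule frechet_derivative_SL2[OF A])
      show "bf A (left_field P A) = 0" using tang that by (simp add: left_field_def)
      show "(left_field Q has_derivative left_field Q) (at A)"
        by (intro linear_imp_has_derivative linear_left_field)
    qed simp
  qed (simp add: left_field_def matrix_mul_assoc)
  have torsion: "D (left_field P) (left_field Q) A - D (left_field Q) (left_field P) A = A ** (P ** Q - Q ** P)"
    if "T P" "T Q" for P Q
  proof -
    have "D (left_field P) (left_field Q) A - D (left_field Q) (left_field P) A =
        lie_bracket (left_field P) (left_field Q) A"
      by (intro levi_civita_SL2D(2)[OF D] vf that A)
    then show ?thesis
      using deriv that by (simp add: lie_bracket_def matrix_diff_ldistrib)
  qed
  have TB: "T (P ** Q - Q ** P)" for P Q
    by (simp add: T_def trace_diff_cmat trace_mult_commute[of P Q])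
  let ?Y = "D (left_field V) (left_field W) A - (1/2) *\<^sub>R (A ** (V ** W - W ** V))"
  note TVW = V[folded T_def] W[folded T_def]
  have half: "bf ?Y (A ** U) = 0" if U: "T U" for U
  proof -
    have tor: "bf (D (left_field P) (left_field Q) A) (A ** R) - bf (D (left_field Q) (left_field P) A) (A ** R)
        = trace ((P ** Q - Q ** P) ** R) / 2" if "T P" "T Q" "T R" for P Q R
      using torsion[OF that(1,2)] bfT[OF A that(3)] by (metis bf_diff(1))
    have com: "bf (D (left_field P) (left_field Q) A) (A ** R) = - bf (D (left_field P) (left_field R) A) (A ** Q)"
      if "T P" "T Q" "T R" for P Q R
      using compat[OF that] by (simp add: bf_commute eq_neg_iff_add_eq_0)
    have inv: "trace ((V ** U - U ** V) ** W) = - trace ((V ** W - W ** V) ** U)"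
      "trace ((W ** U - U ** W) ** V) = trace ((V ** W - W ** V) ** U)"
      by (simp_all add: mat2 algebra_simps)
    have koszul: "a = t / 4" if "a - b = t / 2" "c - d = t' / 2" "e - f = t'' / 2" "a = - c" "b = - e" "d = - f"
      "t' = - t" "t'' = t" for a b c d e f t t' t'' :: complex
    proof -
      have "2 * (a - b) = t" "2 * (c - d) = - t" "2 * (e - f) = t"
        unfolding that(1-3) that(7,8) by simp_all
      moreover have "4 * a = 2 * (a - b) - 2 * (c - d) - 2 * (e - f)"
        unfolding that(4-6) by (simp add: algebra_simps)
      ultimately have "4 * a = t" by simp
      then show ?thesis by (simp add: field_simps)
    qed
    have "bf (D (left_field V) (left_field W) A) (A ** U) = trace ((V ** W - W ** V) ** U) / 4"
      by (rule koszul) (fact tor[OF TVW U] tor[OF TVW(1) U TVW(2)] tor[OF TVW(2) U TVW(1)]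
        com[OF TVW U] com[OF TVW(2,1) U] com[OF U TVW] inv)+
    then show ?thesis by (simp add: bf_simps bfT[OF A U])
  qed
  have YA: "bf ?Y A = 0"
    using DT[OF TVW] tang[OF TB] by (simp add: bf_simps bf_commute[of _ A])
  have "bf ?Y Z = 0" for Z
  proof -
    let ?P = "adjugate A ** Z"
    \<comment> \<open>The traceless part of the inverse image: every matrix is tangential plus radial.\<close>
    let ?U = "?P - cscale (trace ?P / 2) (mat 1)"
    have "T ?U" unfolding T_def by (simp add: mat2)
    moreover have "Z = A ** ?U + cscale (trace ?P / 2) A"
    proof -
      have "A ** cscale c (mat 1) = cscale c A" for c by (simp add: mat2 field_simps)
      then show ?thesis by (simp add: matrix_diff_ldistrib mat_cancel[OF A])
    qed
    ultimately show ?thesis by (metis (no_types) half YA bf_add(2) bf_cscale(2) add_0 mult_zero_right)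
  qed
  then have "?Y = 0" by (rule bf_nondegenerate)
  then show ?thesis by simp
qed

section \<open>Charts\<close>

lemma real2_expansion: "u = u $ 1 *\<^sub>R axis 1 1 + u $ 2 *\<^sub>R axis 2 (1::real)" for u :: "real^2"
  by (simp add: vec_eq_iff forall_2 axis_def)

lemma linear_real2: 
  fixes L :: "real^2 \<Rightarrow> 'b::real_vector"
  assumes "linear L" shows "L u = u $ 1 *\<^sub>R L (axis 1 1) + u $ 2 *\<^sub>R L (axis 2 1)"
  using assms by (subst real2_expansion[of u]) (simp add: linear_add linear_cmul)

lemma cext_eq:
  assumes "linear L"
  shows "cext L z = cscale (z $ 1) (L (axis 1 1)) + cscale (z $ 2) (L (axis 2 1))"
proof -
  let ?X = "L (axis 1 1)" and ?Y = "L (axis 2 1)"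
  have split: "cscale w X = Re w *\<^sub>R X + cscale \<i> (Im w *\<^sub>R X)" for w X
    by (simp add: cscale_def vec_eq_iff complex_eq_iff)
  have "cext L z = (Re (z $ 1) *\<^sub>R ?X + Re (z $ 2) *\<^sub>R ?Y)
      + cscale \<i> (Im (z $ 1) *\<^sub>R ?X + Im (z $ 2) *\<^sub>R ?Y)"
    by (simp add: cext_def JJ_def linear_real2[OF assms, of "\<chi> i. Re (z $ i)"]
      linear_real2[OF assms, of "\<chi> i. Im (z $ i)"])
  also have "\<dots> = cscale (z $ 1) ?X + cscale (z $ 2) ?Y"
    unfolding split[of "z $ 1"] split[of "z $ 2"] by (simp add: cscale_simps(1))
  finally show ?thesis .
qed

lemma cext_cplx: "linear L \<Longrightarrow> cext L (cplx u) = L u"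
  by (simp add: cext_eq cplx_def cscale_simps linear_real2[of L u])

locale surface =
  fixes \<A> :: "('a::{t2_space, second_countable_topology}) chart set"
  assumes atlas: "surface_atlas \<A>"
begin

lemma atlasD:
  "(\<Union>c\<in>\<A>. fst c) = UNIV"
  "c \<in> \<A> \<Longrightarrow> open (fst c)" "c \<in> \<A> \<Longrightarrow> open (snd c ` fst c)"
  "c \<in> \<A> \<Longrightarrow> \<exists>\<psi>. homeomorphism (fst c) (snd c ` fst c) (snd c) \<psi>"
  "c \<in> \<A> \<Longrightarrow> c' \<in> \<A> \<Longrightarrow> smooth_on (snd c ` (fst c \<inter> fst c')) (coord c (snd c'))"
  using atlas[unfolded surface_atlas_def] by simp_all

lemma chart_ex: obtains c where "c \<in> \<A>" "p \<in> fst c"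
  using atlasD(1) by blast

lemma chart_homeomorphism:
  assumes "c \<in> \<A>" shows "homeomorphism (fst c) (snd c ` fst c) (snd c) (inv_into (fst c) (snd c))"
proof -
  obtain \<psi> where h: "homeomorphism (fst c) (snd c ` fst c) (snd c) \<psi>"
    using atlasD(4)[OF assms] ..
  have inv: "\<psi> (snd c q) = q" if "q \<in> fst c" for q
    using h that unfolding homeomorphism_def by simp
  have inj: "inj_on (snd c) (fst c)"
    using inv by (rule inj_on_inverseI)
  show ?thesis
  proof (rule homeomorphism_cong[OF h refl refl refl])
    fix y assume "y \<in> snd c ` fst c"
    then obtain q where "q \<in> fst c" "y = snd c q" by (rule imageE)
    then show "inv_into (fst c) (snd c) y = \<psi> y" by (simp add: inv inv_into_f_f[OF inj])
  qed
qed

lemma chart_open: "c \<in> \<A> \<Longrightarrow> open (fst c)" "c \<in> \<A> \<Longrightarrow> open (snd c ` fst c)"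
  using atlasD by auto

lemma chart_inv:
  assumes "c \<in> \<A>" "p \<in> fst c" shows "inv_into (fst c) (snd c) (snd c p) = p"
  using chart_homeomorphism[OF assms(1)] assms(2) by (simp add: homeomorphism_def)

lemma coord_apply: "c \<in> \<A> \<Longrightarrow> p \<in> fst c \<Longrightarrow> coord c f (snd c p) = f p"
  by (simp add: coord_def chart_inv)

lemma chart_continuous: "c \<in> \<A> \<Longrightarrow> continuous_on (fst c) (snd c)"
  using chart_homeomorphism by (auto simp: homeomorphism_def)

lemma chart_image_open:
  assumes "c \<in> \<A>" "open V" shows "open (snd c ` (fst c \<inter> V))"
proof -
  have "openin (top_of_set (fst c)) (fst c \<inter> V)" using assms(2) by (simp add: openin_open_Int)
  then have "openin (top_of_set (snd c ` fst c)) (snd c ` (fst c \<inter> V))"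
    using homeomorphism_imp_open_map[OF chart_homeomorphism[OF assms(1)]] by blast
  then show ?thesis using chart_open(2)[OF assms(1)] openin_open_eq by blast
qed

lemma smooth_in_chart:
  "smooth_map_on \<A> V f \<Longrightarrow> c \<in> \<A> \<Longrightarrow> smooth_on (snd c ` (fst c \<inter> V)) (coord c f)"
  unfolding smooth_map_on_def by blast

lemma dmap_has_derivative:
  assumes "smooth_map_on \<A> V f" "open V" "c \<in> \<A>" "p \<in> fst c" "p \<in> V"
  shows "(coord c f has_derivative dmap c f p) (at (snd c p))"
  using smooth_on_has_derivative[OF smooth_in_chart[OF assms(1,3)] chart_image_open[OF assms(3,2)]]
    assms unfolding dmap_def by auto

lemma dmap_linear:
  "smooth_map_on \<A> V f \<Longrightarrow> open V \<Longrightarrow> c \<in> \<A> \<Longrightarrow> p \<in> fst c \<Longrightarrow> p \<in> V \<Longrightarrow> linear (dmap c f p)"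
  using dmap_has_derivative has_derivative_linear by blast

lemma smooth_map_continuous:
  assumes "smooth_map_on \<A> V f" "open V" shows "continuous_on V f"
proof -
  have "isCont f p" if "p \<in> V" for p
  proof -
    obtain c where c: "c \<in> \<A>" "p \<in> fst c" by (rule chart_ex)
    have "isCont (coord c f) (snd c p)"
      using dmap_has_derivative[OF assms c that] has_derivative_continuous by blast
    moreover have "isCont (snd c) p"
      using chart_continuous[OF c(1)] chart_open(1)[OF c(1)] c(2) continuous_on_eq_continuous_at by blast
    ultimately have "isCont (\<lambda>q. coord c f (snd c q)) p" by (rule isCont_o2[rotated])
    moreover have "\<forall>\<^sub>F q in nhds p. coord c f (snd c q) = f q"
      unfolding eventually_nhds
      by (intro exI[of _ "fst c"]) (simp add: chart_open(1)[OF c(1)] c(2) coord_apply[OF c(1)])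
    ultimately show ?thesis by (rule iffD1[OF isCont_cong, rotated])
  qed
  then show ?thesis by (simp add: continuous_at_imp_continuous_on)
qed

text \<open>Because of this chain rule, the range of the differential, and hence every condition on tangent
  vectors used below, may be checked in a single chart.\<close>

lemma dmap_chart_change:
  assumes f: "smooth_map_on \<A> V f" "open V" and c: "c \<in> \<A>" "p \<in> fst c" and c': "c' \<in> \<A>" "p \<in> fst c'"
    and "p \<in> V"
  shows "dmap c' f p u = dmap c f p (frechet_derivative (coord c' (snd c)) (at (snd c' p)) u)"
proof -
  let ?U = "snd c' ` (fst c' \<inter> fst c)"
  have U: "open ?U" "snd c' p \<in> ?U"
    using chart_image_open[OF c'(1) chart_open(1)[OF c(1)]] c c' by auto
  have "smooth_on ?U (coord c' (snd c))"
    by (rule atlasD(5)[OF c'(1) c(1)])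
  from smooth_on_has_derivative[OF this U]
  have "(coord c' (snd c) has_derivative frechet_derivative (coord c' (snd c)) (at (snd c' p))) (at (snd c' p))" .
  moreover have "(coord c f has_derivative dmap c f p) (at (coord c' (snd c) (snd c' p)))"
    using dmap_has_derivative[OF f c \<open>p \<in> V\<close>] by (simp add: coord_apply[OF c'])
  ultimately have "((\<lambda>x. coord c f (coord c' (snd c) x)) has_derivative
      (\<lambda>u. dmap c f p (frechet_derivative (coord c' (snd c)) (at (snd c' p)) u))) (at (snd c' p))"
    by (rule has_derivative_compose)
  then have "(coord c' f has_derivative
      (\<lambda>u. dmap c f p (frechet_derivative (coord c' (snd c)) (at (snd c' p)) u))) (at (snd c' p))"
  proof (rule has_derivative_transform_within_open[OF _ U])
    fix x assume "x \<in> ?U"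
    then obtain q where "q \<in> fst c'" "q \<in> fst c" "x = snd c' q" by auto
    then show "coord c f (coord c' (snd c) x) = coord c' f x"
      by (simp add: coord_apply c(1) c'(1))
  qed
  then show ?thesis unfolding dmap_def[of c'] by (metis frechet_derivative_at)
qed

text \<open>The transition maps are smooth, so smoothness in the chart \<open>c\<close> carries over to all other charts.\<close>

lemma smooth_map_on_chartI:
  assumes c: "c \<in> \<A>" and V: "open V" "V \<subseteq> fst c" and f: "smooth_on (snd c ` V) f"
  shows "smooth_map_on \<A> V (\<lambda>q. f (snd c q))"
  unfolding smooth_map_on_def
proof
  fix c' assume c': "c' \<in> \<A>"
  have "coord c' (\<lambda>q. f (snd c q)) = (\<lambda>x. f (coord c' (snd c) x))" by (simp add: coord_def o_def)
  moreover have "smooth_on (snd c' ` (fst c' \<inter> V)) (\<lambda>x. f (coord c' (snd c) x))"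
  proof (rule smooth_on_compose[OF _ _ _ _ f])
    show "open (snd c' ` (fst c' \<inter> V))" by (rule chart_image_open[OF c' V(1)])
    show "open (snd c ` V)" using chart_image_open[OF c V(1)] V(2) by (simp add: Int_absorb1)
    show "coord c' (snd c) ` snd c' ` (fst c' \<inter> V) \<subseteq> snd c ` V"
      using coord_apply[OF c'] by auto
    have "smooth_on (snd c' ` (fst c' \<inter> fst c)) (coord c' (snd c))"
      by (rule atlasD(5)[OF c' c])
    then show "smooth_on (snd c' ` (fst c' \<inter> V)) (coord c' (snd c))"
      by (rule smooth_on_subset) (use V(2) in auto)
  qed
  ultimately show "smooth_on (snd c' ` (fst c' \<inter> V)) (coord c' (\<lambda>q. f (snd c q)))" by simp
qed

end

section \<open>Admissible immersions and their normal fields\<close>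

locale admissible_surface = surface \<A>
  for \<A> :: "('a::{t2_space, second_countable_topology}) chart set" +
  fixes \<sigma> :: "'a \<Rightarrow> cmat"
  assumes admissible: "admissible_immersion \<A> \<sigma>"
begin

lemma \<sigma>_SL2: "\<sigma> p \<in> SL2" and \<sigma>_unit: "bf (\<sigma> p) (\<sigma> p) = -1"
  and \<sigma>_smooth: "smooth_map_on \<A> UNIV \<sigma>"
  using admissible SL2_iff unfolding admissible_immersion_def immersion_SL2_def by auto

lemma \<sigma>_continuous: "continuous_on UNIV \<sigma>"
  by (rule smooth_map_continuous[OF \<sigma>_smooth open_UNIV])

lemma coord_SL2: "coord c \<sigma> x \<in> SL2"
  by (simp add: coord_def \<sigma>_SL2)

lemma d\<sigma>_has_derivative:
  "c \<in> \<A> \<Longrightarrow> p \<in> fst c \<Longrightarrow> (coord c \<sigma> has_derivative dmap c \<sigma> p) (at (snd c p))"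
  using dmap_has_derivative[OF \<sigma>_smooth open_UNIV] by simp

lemma d\<sigma>_linear: "c \<in> \<A> \<Longrightarrow> p \<in> fst c \<Longrightarrow> linear (dmap c \<sigma> p)"
  using dmap_linear[OF \<sigma>_smooth open_UNIV] by simp

lemma d\<sigma>_tangent:
  assumes "c \<in> \<A>" "p \<in> fst c" shows "bf (\<sigma> p) (dmap c \<sigma> p u) = 0"
proof -
  have "((\<lambda>x. bf (coord c \<sigma> x) (coord c \<sigma> x)) has_derivative
    (\<lambda>u. bf (coord c \<sigma> (snd c p)) (dmap c \<sigma> p u) + bf (dmap c \<sigma> p u) (coord c \<sigma> (snd c p)))) (at (snd c p))"
    by (intro bounded_bilinear.FDERIV[OF bounded_bilinear_bf] d\<sigma>_has_derivative assms)
  moreover have "(\<lambda>x. bf (coord c \<sigma> x) (coord c \<sigma> x)) = (\<lambda>_. -1)"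
    using coord_SL2 by (auto simp: SL2_iff)
  ultimately have "((\<lambda>_. -1) has_derivative
    (\<lambda>u. bf (coord c \<sigma> (snd c p)) (dmap c \<sigma> p u) + bf (dmap c \<sigma> p u) (coord c \<sigma> (snd c p)))) (at (snd c p))"
    by simp
  then have "(\<lambda>u. bf (coord c \<sigma> (snd c p)) (dmap c \<sigma> p u) + bf (dmap c \<sigma> p u) (coord c \<sigma> (snd c p))) = (\<lambda>_. 0)"
    using has_derivative_unique has_derivative_const by blast
  then have "2 * bf (\<sigma> p) (dmap c \<sigma> p u) = 0"
    by (metis (mono_tags, lifting) coord_apply[OF assms] bf_commute mult_2)
  then show ?thesis by simp
qed

lemma cdmap_eq:
  assumes "c \<in> \<A>" "p \<in> fst c"
  shows "cdmap c \<sigma> p z = cscale (z $ 1) (dmap c \<sigma> p (axis 1 1)) + cscale (z $ 2) (dmap c \<sigma> p (axis 2 1))"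
  unfolding cdmap_def by (rule cext_eq[OF d\<sigma>_linear[OF assms]])

lemma cdmap_cplx: "c \<in> \<A> \<Longrightarrow> p \<in> fst c \<Longrightarrow> cdmap c \<sigma> p (cplx u) = dmap c \<sigma> p u"
  unfolding cdmap_def by (rule cext_cplx[OF d\<sigma>_linear])

lemma cdmap_tangent: "c \<in> \<A> \<Longrightarrow> p \<in> fst c \<Longrightarrow> bf (\<sigma> p) (cdmap c \<sigma> p z) = 0"
  by (simp add: cdmap_eq bf_simps d\<sigma>_tangent)

lemma pullback_metric_eq:
  "c \<in> \<A> \<Longrightarrow> p \<in> fst c \<Longrightarrow> pullback_metric c \<sigma> p z w = bf (cdmap c \<sigma> p z) (cdmap c \<sigma> p w)"
  unfolding pullback_metric_def by (simp add: hol_metric_eq[OF \<sigma>_SL2] cdmap_tangent)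

definition gram where "gram c p =
  bf (dmap c \<sigma> p (axis 1 1)) (dmap c \<sigma> p (axis 1 1)) * bf (dmap c \<sigma> p (axis 2 1)) (dmap c \<sigma> p (axis 2 1))
  - bf (dmap c \<sigma> p (axis 1 1)) (dmap c \<sigma> p (axis 2 1)) * bf (dmap c \<sigma> p (axis 1 1)) (dmap c \<sigma> p (axis 2 1))"

lemma nondegenerate:
  assumes "c \<in> \<A>" "p \<in> fst c" "z \<noteq> 0"
  obtains w where "bf (cdmap c \<sigma> p z) (cdmap c \<sigma> p w) \<noteq> 0"
  using admissible assms pullback_metric_eq[OF assms(1,2)] unfolding admissible_immersion_def by metis

lemma cdmap_inj:
  assumes "c \<in> \<A>" "p \<in> fst c" "cdmap c \<sigma> p z = cdmap c \<sigma> p w" shows "z = w"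
proof (rule ccontr)
  assume "z \<noteq> w"
  then have "z - w \<noteq> 0" by simp
  moreover have "cdmap c \<sigma> p (z - w) = 0"
  proof -
    have "cdmap c \<sigma> p (z - w) = cdmap c \<sigma> p z - cdmap c \<sigma> p w"
      by (simp add: cdmap_eq assms(1,2)) (simp add: cscale_def vec_eq_iff algebra_simps)
    then show ?thesis using assms(3) by simp
  qed
  ultimately show False using nondegenerate[OF assms(1,2)] by (metis bf_zero(1))
qed

text \<open>If the Gram determinant vanished, the vector \<open>(g\<^sub>1\<^sub>2, - g\<^sub>1\<^sub>1)\<close> would be in the kernel of the pull-back
  metric; if this vector is zero, then \<open>(1, 0)\<close> is in the kernel.\<close>

lemma gram_nonzero:
  assumes "c \<in> \<A>" "p \<in> fst c" shows "gram c p \<noteq> 0"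
proof
  assume 0: "gram c p = 0"
  let ?X = "dmap c \<sigma> p (axis 1 1)" and ?Y = "dmap c \<sigma> p (axis 2 1)"
  have ker: "z = 0" if "bf (cdmap c \<sigma> p z) ?X = 0" "bf (cdmap c \<sigma> p z) ?Y = 0" for z
  proof (rule ccontr)
    assume "z \<noteq> 0"
    then obtain w where "bf (cdmap c \<sigma> p z) (cdmap c \<sigma> p w) \<noteq> 0" using nondegenerate[OF assms] by blast
    then show False using that unfolding cdmap_eq[OF assms, of w] by (simp add: bf_simps)
  qed
  have G: "bf ?X ?X * bf ?Y ?Y = bf ?X ?Y * bf ?X ?Y" using 0 by (simp add: gram_def)
  have "vector [bf ?X ?Y, - bf ?X ?X] = (0::complex^2)"
    by (rule ker) (simp_all add: cdmap_eq[OF assms] bf_simps bf_commute[of ?Y ?X] G)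
  then have "bf ?X ?X = 0" "bf ?X ?Y = 0" by (simp_all add: vec_eq_iff forall_2)
  then have "vector [1, 0] = (0::complex^2)"
    by (intro ker) (simp_all add: cdmap_eq[OF assms] bf_simps cscale_simps)
  then show False by (simp add: vec_eq_iff forall_2)
qed

text \<open>Orthogonality to the position vector \<open>\<sigma> p\<close> expresses tangency to \<open>SL2\<close>.\<close>

definition unit_normal :: "'a \<Rightarrow> cmat \<Rightarrow> bool" where
  "unit_normal p n \<longleftrightarrow> bf n n = 1 \<and> bf (\<sigma> p) n = 0 \<and>
     (\<forall>c\<in>\<A>. p \<in> fst c \<longrightarrow> (\<forall>u. bf n (dmap c \<sigma> p u) = 0))"

lemma unit_normalI:
  assumes "c \<in> \<A>" "p \<in> fst c" "bf n n = 1" "bf (\<sigma> p) n = 0" "\<And>u. bf n (dmap c \<sigma> p u) = 0"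
  shows "unit_normal p n"
  unfolding unit_normal_def
proof (intro conjI ballI impI allI assms(3,4))
  fix c' u assume "c' \<in> \<A>" "p \<in> fst c'"
  from dmap_chart_change[OF \<sigma>_smooth open_UNIV assms(1,2) this UNIV_I]
  show "bf n (dmap c' \<sigma> p u) = 0" by (simp only: assms(5))
qed

lemma expansion:
  assumes c: "c \<in> \<A>" "p \<in> fst c" and n: "unit_normal p n"
  shows "X = cscale (- bf X (\<sigma> p)) (\<sigma> p) + cscale (bf X n) n
    + cscale ((bf (dmap c \<sigma> p (axis 2 1)) (dmap c \<sigma> p (axis 2 1)) * bf X (dmap c \<sigma> p (axis 1 1))
        - bf (dmap c \<sigma> p (axis 1 1)) (dmap c \<sigma> p (axis 2 1)) * bf X (dmap c \<sigma> p (axis 2 1))) / gram c p)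
        (dmap c \<sigma> p (axis 1 1))
    + cscale ((bf (dmap c \<sigma> p (axis 1 1)) (dmap c \<sigma> p (axis 1 1)) * bf X (dmap c \<sigma> p (axis 2 1))
        - bf (dmap c \<sigma> p (axis 1 1)) (dmap c \<sigma> p (axis 2 1)) * bf X (dmap c \<sigma> p (axis 1 1))) / gram c p)
        (dmap c \<sigma> p (axis 2 1))"
  using n unfolding unit_normal_def
  by (intro frame_expansion gram_nonzero c) (simp_all add: \<sigma>_unit d\<sigma>_tangent c gram_def)

lemma unit_normal_sign:
  assumes "unit_normal p n" "unit_normal p n'" shows "n' = n \<or> n' = - n"
proof -
  obtain c where c: "c \<in> \<A>" "p \<in> fst c" by (rule chart_ex)
  have "bf n' (\<sigma> p) = 0" "\<And>u. bf n' (dmap c \<sigma> p u) = 0" "bf n n = 1" "bf n' n' = 1"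
    using assms c unfolding unit_normal_def by (auto simp: bf_commute)
  then have eq: "n' = cscale (bf n' n) n"
    using expansion[OF c assms(1), of n'] by (simp add: cscale_simps)
  then have "bf n' n' = bf n' n * bf n' n * bf n n"
    by (metis (no_types) bf_cscale(2) bf_commute mult.assoc mult.commute)
  then have "bf n' n * bf n' n = 1" using \<open>bf n n = 1\<close> \<open>bf n' n' = 1\<close> by simp
  then have "bf n' n = 1 \<or> bf n' n = -1" by (simp add: square_eq_1_iff)
  then show ?thesis using eq cscale_simps(6,9) by metis
qed

text \<open>Orthogonality to the complexified tangent plane amounts to orthogonality to the real one, because
  \<open>bf\<close> is complex bilinear.\<close>

lemma normal_field_iff:
  "normal_field \<A> \<sigma> V \<nu> \<longleftrightarrow> open V \<and> smooth_map_on \<A> V \<nu> \<and> (\<forall>p\<in>V. unit_normal p (\<nu> p))"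
proof -
  have "(\<nu> p \<in> tangent_SL2 (\<sigma> p) \<and> hol_metric (\<sigma> p) (\<nu> p) (\<nu> p) = 1 \<and>
      (\<forall>c\<in>\<A>. p \<in> fst c \<longrightarrow> (\<forall>z. hol_metric (\<sigma> p) (\<nu> p) (cdmap c \<sigma> p z) = 0))) \<longleftrightarrow> unit_normal p (\<nu> p)" for p
  proof (cases "bf (\<sigma> p) (\<nu> p) = 0")
    case True
    have "(\<forall>z. hol_metric (\<sigma> p) (\<nu> p) (cdmap c \<sigma> p z) = 0) \<longleftrightarrow> (\<forall>u. bf (\<nu> p) (dmap c \<sigma> p u) = 0)"
      if c: "c \<in> \<A>" "p \<in> fst c" for c
    proof -
      have "(\<forall>z. bf (\<nu> p) (cdmap c \<sigma> p z) = 0) \<longleftrightarrow> (\<forall>u. bf (\<nu> p) (dmap c \<sigma> p u) = 0)"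
        unfolding cdmap_eq[OF c]
        by (metis (no_types, lifting) cdmap_cplx[OF c] cdmap_eq[OF c] bf_add(2) bf_cscale(2) add_0 mult_zero_right)
      then show ?thesis by (simp add: hol_metric_eq[OF \<sigma>_SL2] True cdmap_tangent[OF c])
    qed
    then show ?thesis
      using True by (simp add: unit_normal_def tangent_SL2_iff[OF \<sigma>_SL2] hol_metric_eq[OF \<sigma>_SL2])
  qed (auto simp: unit_normal_def tangent_SL2_iff[OF \<sigma>_SL2])
  then show ?thesis unfolding normal_field_def by blast
qed

lemma normal_fieldD:
  assumes "normal_field \<A> \<sigma> V \<nu>"
  shows "open V" "smooth_map_on \<A> V \<nu>" "p \<in> V \<Longrightarrow> unit_normal p (\<nu> p)"
  using assms[unfolded normal_field_iff] by blast+

lemma unit_normalD: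
  assumes "unit_normal p n"
  shows "bf n n = 1" "bf (\<sigma> p) n = 0" "c \<in> \<A> \<Longrightarrow> p \<in> fst c \<Longrightarrow> bf n (dmap c \<sigma> p u) = 0"
    "c \<in> \<A> \<Longrightarrow> p \<in> fst c \<Longrightarrow> bf (dmap c \<sigma> p u) n = 0"
  using assms[unfolded unit_normal_def] by (blast, blast, blast, metis bf_commute)

lemma normal_derivative:
  assumes nf: "normal_field \<A> \<sigma> V \<nu>" and c: "c \<in> \<A>" "p \<in> fst c" "p \<in> V"
  shows "bf (\<sigma> p) (dmap c \<nu> p u) = 0" and "bf (\<nu> p) (dmap c \<nu> p u) = 0"
    and "linear (dmap c \<nu> p)" and "(coord c \<nu> has_derivative dmap c \<nu> p) (at (snd c p))"
proof -
  let ?U = "snd c ` (fst c \<inter> V)"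
  have V: "open V" and sm: "smooth_map_on \<A> V \<nu>" and un: "\<And>q. q \<in> V \<Longrightarrow> unit_normal q (\<nu> q)"
    using nf unfolding normal_field_iff by auto
  have U: "open ?U" "snd c p \<in> ?U" using chart_image_open[OF c(1) V] c by auto
  show d: "(coord c \<nu> has_derivative dmap c \<nu> p) (at (snd c p))"
    by (rule dmap_has_derivative[OF sm V c])
  then show "linear (dmap c \<nu> p)" by (rule has_derivative_linear)
  have zero: "bf (\<xi> p) (dmap c \<nu> p u) + bf (dmap c \<xi> p u) (\<nu> p) = 0"
    if \<xi>: "(coord c \<xi> has_derivative dmap c \<xi> p) (at (snd c p))" and const: "\<And>q. q \<in> V \<Longrightarrow> bf (\<xi> q) (\<nu> q) = k"
    for \<xi> :: "'a \<Rightarrow> cmat" and k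
  proof -
    have "((\<lambda>x. bf (coord c \<xi> x) (coord c \<nu> x)) has_derivative
      (\<lambda>u. bf (coord c \<xi> (snd c p)) (dmap c \<nu> p u) + bf (dmap c \<xi> p u) (coord c \<nu> (snd c p)))) (at (snd c p))"
      by (rule bounded_bilinear.FDERIV[OF bounded_bilinear_bf \<xi> d])
    moreover have "((\<lambda>x. bf (coord c \<xi> x) (coord c \<nu> x)) has_derivative (\<lambda>_. 0)) (at (snd c p))"
      by (rule has_derivative_transform_within_open[OF has_derivative_const[of k] U])
        (use const in \<open>auto simp: coord_apply[OF c(1)]\<close>)
    ultimately have "(\<lambda>u. bf (coord c \<xi> (snd c p)) (dmap c \<nu> p u) + bf (dmap c \<xi> p u) (coord c \<nu> (snd c p))) = (\<lambda>_. 0)"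
      by (rule has_derivative_unique)
    then show ?thesis by (metis (mono_tags, lifting) coord_apply[OF c(1,2)])
  qed
  have "bf (\<nu> p) (dmap c \<nu> p u) + bf (dmap c \<nu> p u) (\<nu> p) = 0"
    by (rule zero[OF d, of 1]) (use un in \<open>auto simp: unit_normal_def\<close>)
  then have "2 * bf (\<nu> p) (dmap c \<nu> p u) = 0" by (simp add: bf_commute[of _ "\<nu> p"])
  then show "bf (\<nu> p) (dmap c \<nu> p u) = 0" by simp
  have "bf (\<sigma> p) (dmap c \<nu> p u) + bf (dmap c \<sigma> p u) (\<nu> p) = 0"
    by (rule zero[OF d\<sigma>_has_derivative[OF c(1,2)], of 0]) (use un in \<open>auto simp: unit_normal_def\<close>)
  then show "bf (\<sigma> p) (dmap c \<nu> p u) = 0"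
    using un[OF c(3)] c unfolding unit_normal_def by (simp add: bf_commute)
qed

text \<open>On a quadric in flat space, the Levi-Civita connection is the tangential part of the flat derivative.
  For a normal field the correction term is a multiple of the pairing of the normal with the velocity,
  which is zero. So the shape operator is the flat derivative of the normal field.\<close>

lemma pullback_connection_normal:
  assumes D: "levi_civita_SL2 D" and nf: "normal_field \<A> \<sigma> V \<nu>" and c: "c \<in> \<A>" "p \<in> fst c" "p \<in> V"
  shows "pullback_connection D c \<sigma> \<nu> p u = dmap c \<nu> p u"
proof -
  let ?A = "\<sigma> p" and ?X = "dmap c \<sigma> p u" and ?n = "\<nu> p"
  have un: "unit_normal p (\<nu> p)" by (rule normal_fieldD(3)[OF nf c(3)])
  have 0: "bf ?A ?X = 0" "bf ?A ?n = 0" "bf ?X ?n = 0"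
    by (rule d\<sigma>_tangent[OF c(1,2)] unit_normalD[OF un] c(1,2))+
  have der: "((\<lambda>x. adjugate (coord c \<sigma> x) ** coord c \<nu> x) has_derivative
     (\<lambda>u. adjugate (coord c \<sigma> (snd c p)) ** dmap c \<nu> p u + adjugate (dmap c \<sigma> p u) ** coord c \<nu> (snd c p))) (at (snd c p))"
    by (rule bounded_bilinear.FDERIV[OF bounded_bilinear_matrix_mult
          bounded_linear.has_derivative[OF linear_adjugate[unfolded linear_conv_bounded_linear]
            d\<sigma>_has_derivative[OF c(1,2)]] normal_derivative(4)[OF nf c]])
  have "coord c (\<lambda>q. matrix_inv (\<sigma> q) ** \<nu> q) = (\<lambda>x. adjugate (coord c \<sigma> x) ** coord c \<nu> x)"
    by (simp add: coord_def o_def matrix_inv_SL2[OF \<sigma>_SL2])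
  then have 1: "dmap c (\<lambda>q. matrix_inv (\<sigma> q) ** \<nu> q) p u =
      adjugate ?A ** dmap c \<nu> p u + adjugate ?X ** ?n"
    unfolding dmap_def[of c "\<lambda>q. matrix_inv (\<sigma> q) ** \<nu> q"]
    by (simp only: frechet_derivative_at[OF der, symmetric] coord_apply[OF c(1,2)])
  have 2: "D (left_field (adjugate ?A ** ?X)) (left_field (adjugate ?A ** ?n)) ?A =
      (1/2) *\<^sub>R (?A ** ((adjugate ?A ** ?X) ** (adjugate ?A ** ?n) - (adjugate ?A ** ?n) ** (adjugate ?A ** ?X)))"
    by (rule levi_civita_left_field[OF D _ _ \<sigma>_SL2]) (simp_all add: trace_adjugate_mult 0)
  have anti: "?A ** adjugate Y = - (Y ** adjugate ?A)" if "bf ?A Y = 0" for Y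
  proof -
    have "?A ** adjugate Y + Y ** adjugate ?A = cscale (- 2 * bf ?A Y) (mat 1)"
      by (simp add: mat2 bf_def field_simps)
    then show ?thesis using that by (simp add: cscale_simps add_eq_0_iff2)
  qed
  have sym: "?X ** (adjugate ?A ** ?n) + ?n ** (adjugate ?A ** ?X) = 0"
  proof -
    have "X ** (adjugate B ** Y) + Y ** (adjugate B ** X) =
        cscale (- 2 * bf B X) Y + cscale (- 2 * bf B Y) X + cscale (2 * bf X Y) B" for B X Y
      by (simp add: mat2 bf_def field_simps)
    from this[of ?X ?A ?n] show ?thesis by (simp add: 0 cscale_simps)
  qed
  have "pullback_connection D c \<sigma> \<nu> p u = ?A ** (adjugate ?A ** dmap c \<nu> p u + adjugate ?X ** ?n)
    + (1/2) *\<^sub>R (?A ** ((adjugate ?A ** ?X) ** (adjugate ?A ** ?n) - (adjugate ?A ** ?n) ** (adjugate ?A ** ?X)))"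
    unfolding pullback_connection_def 1 unfolding matrix_inv_SL2[OF \<sigma>_SL2] 2 ..
  also have "\<dots> = dmap c \<nu> p u + (?A ** adjugate ?X) ** ?n
    + (1/2) *\<^sub>R (?X ** (adjugate ?A ** ?n) - ?n ** (adjugate ?A ** ?X))"
    by (simp only: matrix_add_ldistrib matrix_diff_ldistrib mat_cancel[OF \<sigma>_SL2] matrix_mul_assoc[symmetric])
  also have "\<dots> = dmap c \<nu> p u - ?X ** (adjugate ?A ** ?n)
    + (1/2) *\<^sub>R (?X ** (adjugate ?A ** ?n) - ?n ** (adjugate ?A ** ?X))"
  proof -
    have "(- P) ** Q = - (P ** Q)" for P Q :: cmat by (simp add: mat2)
    then show ?thesis by (simp add: anti[OF 0(1)] matrix_mul_assoc)
  qed
  also have "\<dots> = dmap c \<nu> p u - (1/2) *\<^sub>R (?X ** (adjugate ?A ** ?n) + ?n ** (adjugate ?A ** ?X))"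
    by (simp add: vec_eq_iff scaleR_conv_of_real[where 'a=complex] field_simps)
  finally show ?thesis using sym by simp
qed

lemma cdmap_shape_operator:
  assumes D: "levi_civita_SL2 D" and nf: "normal_field \<A> \<sigma> V \<nu>" and c: "c \<in> \<A>" "p \<in> fst c" "p \<in> V"
  shows "cdmap c \<sigma> p (shape_operator D c \<sigma> \<nu> p (cplx u)) = dmap c \<nu> p u"
proof -
  let ?X = "dmap c \<nu> p u"
  have un: "unit_normal p (\<nu> p)" by (rule normal_fieldD(3)[OF nf c(3)])
  have "bf ?X (\<sigma> p) = 0" "bf ?X (\<nu> p) = 0"
    using normal_derivative(1,2)[OF nf c] by (simp_all add: bf_commute)
  then obtain a b where ab: "?X = cscale a (dmap c \<sigma> p (axis 1 1)) + cscale b (dmap c \<sigma> p (axis 2 1))"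
    using expansion[OF c(1,2) un, of ?X] by (simp add: cscale_simps)
  have "cdmap c \<sigma> p (vector [a, b]) = ?X"
    by (simp add: cdmap_eq[OF c(1,2)] ab)
  moreover have "shape_operator D c \<sigma> \<nu> p (cplx u) = (THE w. cdmap c \<sigma> p w = ?X)"
    unfolding shape_operator_def pullback_connection_normal[OF D nf c]
    by (simp add: cext_cplx normal_derivative(3)[OF nf c])
  ultimately show ?thesis using cdmap_inj[OF c(1,2)] by (metis (mono_tags, lifting) the_equality)
qed

lemma real_shape_operator_iff:
  assumes D: "levi_civita_SL2 D" and nf: "normal_field \<A> \<sigma> V \<nu>" and c: "c \<in> \<A>" "p \<in> fst c" "p \<in> V"
  shows "real_operator (\<lambda>z. k *s shape_operator D c \<sigma> \<nu> p z) \<longleftrightarrow>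
    (\<forall>u. cscale k (dmap c \<nu> p u) \<in> range (dmap c \<sigma> p))"
proof -
  have "k *s shape_operator D c \<sigma> \<nu> p (cplx u) \<in> range cplx \<longleftrightarrow> cscale k (dmap c \<nu> p u) \<in> range (dmap c \<sigma> p)" for u
  proof -
    let ?w = "k *s shape_operator D c \<sigma> \<nu> p (cplx u)"
    have "cdmap c \<sigma> p ?w = cscale k (cdmap c \<sigma> p (shape_operator D c \<sigma> \<nu> p (cplx u)))"
      by (simp add: cdmap_eq[OF c(1,2)] cscale_simps)
    then have w: "cdmap c \<sigma> p ?w = cscale k (dmap c \<nu> p u)"
      by (simp add: cdmap_shape_operator[OF D nf c])
    have "?w = cplx v \<longleftrightarrow> cscale k (dmap c \<nu> p u) = dmap c \<sigma> p v" for v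
      using w cdmap_cplx[OF c(1,2), of v] cdmap_inj[OF c(1,2), of ?w "cplx v"] by metis
    then show ?thesis by (auto simp: image_iff)
  qed
  then show ?thesis unfolding real_operator_def image_subset_iff by blast
qed

text \<open>The factors of interest are \<open>1\<close> and \<open>\<i>\<close>: the conditions that \<open>\<Psi>\<close> or that \<open>\<i> \<Psi>\<close> is real are treated
  together.\<close>

definition k_shape_real :: "complex \<Rightarrow> bool" where
  "k_shape_real k \<longleftrightarrow> (\<forall>V \<nu>. normal_field \<A> \<sigma> V \<nu> \<longrightarrow>
     (\<forall>c\<in>\<A>. \<forall>p\<in>fst c \<inter> V. \<forall>u. cscale k (dmap c \<nu> p u) \<in> range (dmap c \<sigma> p)))"

lemma shape_real_iff:
  assumes D: "levi_civita_SL2 D"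
  shows "shape_real D \<A> \<sigma> \<longleftrightarrow> k_shape_real 1" "i_shape_real D \<A> \<sigma> \<longleftrightarrow> k_shape_real \<i>"
  using real_shape_operator_iff[OF D, where k=1] real_shape_operator_iff[OF D, where k=\<i>]
  unfolding shape_real_def i_shape_real_def k_shape_real_def by (simp_all add: Ball_def)

end

section \<open>Unit normal fields exist locally\<close>

text \<open>With \<open>X = A V\<close> and \<open>Y = A W\<close> tangent to \<open>SL2\<close> at \<open>A\<close>, this is \<open>A [V, W]\<close>: the vector product of the
  complex quadratic space of dimension three, up to a constant factor.\<close>

definition cross :: "cmat \<Rightarrow> cmat \<Rightarrow> cmat \<Rightarrow> cmat" where
  "cross A X Y = X ** (adjugate A ** Y) - Y ** (adjugate A ** X)"

lemma bf_cross: "bf A (cross A X Y) = 0" "bf (cross A X Y) X = 0" "bf (cross A X Y) Y = 0"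
  by (simp_all add: cross_def mat2 bf_def field_simps)

lemma bf_cross_cross:
  assumes "bf A A = -1" "bf A X = 0" "bf A Y = 0"
  shows "bf (cross A X Y) (cross A X Y) = - 4 * (bf X X * bf Y Y - bf X Y * bf X Y)"
proof -
  let ?P = "X ** (adjugate A ** Y)"
  have "?P + Y ** (adjugate A ** X) =
      cscale (- 2 * bf A X) Y + cscale (- 2 * bf A Y) X + cscale (2 * bf X Y) A"
    by (simp add: mat2 bf_def field_simps)
  then have "Y ** (adjugate A ** X) = cscale (2 * bf X Y) A - ?P"
    using assms by (simp add: cscale_simps algebra_simps)
  then have c: "cross A X Y = cscale 2 ?P - cscale (2 * bf X Y) A"
    unfolding cross_def by (simp add: cscale_def vec_eq_iff)
  have mult: "bf (P ** Q) (P ** Q) = - bf P P * bf Q Q" for P Q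
    by (simp add: mat2 bf_def field_simps)
  have "bf (adjugate A) (adjugate A) = bf A A"
    by (simp add: mat2 bf_def)
  then have PP: "bf ?P ?P = - (bf X X * bf Y Y)"
    using assms(1) by (simp add: mult)
  have "bf ?P A = bf A A * bf X Y - 2 * bf A X * bf A Y"
    by (simp add: mat2 bf_def field_simps)
  then have PA: "bf ?P A = - bf X Y" using assms by simp
  show ?thesis
    unfolding c by (simp add: bf_simps PP PA bf_commute[of A ?P] assms(1) algebra_simps)
qed

lemma smooth_on_diff:
  fixes f g :: "'a::real_normed_vector \<Rightarrow> 'b::euclidean_space"
  assumes "open U" "smooth_on U f" "smooth_on U g" shows "smooth_on U (\<lambda>x. f x - g x)"
proof -
  have "linear (\<lambda>x::'b. - x)" by (auto intro!: linearI)
  then have "smooth_on U (\<lambda>x. f x + - g x)"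
    by (intro smooth_on_add smooth_on_linear_comp[where h="\<lambda>x::'b. - x"] assms)
  then show ?thesis by simp
qed

context admissible_surface
begin

text \<open>The vector product of the coordinate fields is normal, and its square norm is \<open>- 4\<close> times the Gram
  determinant, which is nonzero, and real by hypothesis. Hence a real square root suffices to normalise
  it: dividing gives square norm \<open>1\<close> or \<open>- 1\<close>, and in the second case it is multiplied by \<open>\<i>\<close>.\<close>

lemma local_normal_field:
  assumes c: "c \<in> \<A>" "p \<in> fst c"
    and real: "\<And>q u v. q \<in> fst c \<Longrightarrow> bf (dmap c \<sigma> q u) (dmap c \<sigma> q v) \<in> \<real>"
  obtains V \<nu> where "normal_field \<A> \<sigma> V \<nu>" "p \<in> V" "V \<subseteq> fst c"
proof -
  let ?U = "snd c ` fst c"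
  have U: "open ?U" by (rule chart_open(2)[OF c(1)])
  define s where "s = coord c \<sigma>"
  define n0 where "n0 x = cross (s x) (frechet_derivative s (at x) (axis 1 1)) (frechet_derivative s (at x) (axis 2 1))" for x
  have s: "smooth_on ?U s"
    using smooth_in_chart[OF \<sigma>_smooth c(1)] by (simp add: s_def)
  note mm = smooth_on_bilinear[OF U bounded_bilinear_matrix_mult]
  have n0: "smooth_on ?U n0"
    unfolding n0_def cross_def
    by (intro smooth_on_diff[OF U] mm smooth_on_linear_comp[OF U linear_adjugate s] smooth_on_directional s)
  define Q where "Q x = Re (bf (n0 x) (n0 x))" for x
  have "linear Re" by (simp add: bounded_linear.linear bounded_linear_Re)
  then have Q: "smooth_on ?U Q" unfolding Q_def
    by (rule smooth_on_linear_comp[OF U _ smooth_on_bilinear[OF U bounded_bilinear_bf n0 n0]])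
  have n0_at: "n0 (snd c q) = cross (\<sigma> q) (dmap c \<sigma> q (axis 1 1)) (dmap c \<sigma> q (axis 2 1))" if "q \<in> fst c" for q
    using that by (simp add: n0_def s_def dmap_def coord_apply[OF c(1)])
  have bf_n0: "bf (n0 (snd c q)) (n0 (snd c q)) = of_real (Q (snd c q))" "Q (snd c q) \<noteq> 0" if "q \<in> fst c" for q
  proof -
    have "bf (n0 (snd c q)) (n0 (snd c q)) = - 4 * gram c q"
      unfolding n0_at[OF that] gram_def
      by (rule bf_cross_cross) (simp_all add: \<sigma>_unit d\<sigma>_tangent[OF c(1) that])
    moreover have "- 4 * gram c q \<in> \<real>" "- 4 * gram c q \<noteq> 0"
      using gram_nonzero[OF c(1) that] real[OF that] unfolding gram_def by simp_all
    ultimately show "bf (n0 (snd c q)) (n0 (snd c q)) = of_real (Q (snd c q))" "Q (snd c q) \<noteq> 0"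
      unfolding Q_def by (metis of_real_Re, metis of_real_0 of_real_Re)
  qed
  define \<epsilon> where "\<epsilon> = sgn (Q (snd c p))"
  define k where "k = (if \<epsilon> = 1 then 1 else \<i>)"
  have eps: "\<epsilon> = 1 \<or> \<epsilon> = -1" using bf_n0(2)[OF c(2)] unfolding \<epsilon>_def by (auto simp: sgn_real_def)
  then have kk: "k * k = of_real \<epsilon>" by (auto simp: k_def)
  define W where "W = {x \<in> ?U. \<epsilon> * Q x \<in> {0<..}}"
  have "continuous_on ?U (\<lambda>x. \<epsilon> * Q x)"
    by (intro continuous_intros smooth_on_continuous Q)
  then have W: "open W" "W \<subseteq> ?U"
    unfolding W_def using continuous_open_preimage[OF _ U open_greaterThan, of "\<lambda>x. \<epsilon> * Q x" 0]
    by (simp_all add: vimage_def Int_def)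
  define V where "V = fst c \<inter> snd c -` W"
  have V: "open V" "V \<subseteq> fst c"
    unfolding V_def
    by (rule continuous_open_preimage[OF chart_continuous[OF c(1)] chart_open(1)[OF c(1)] W(1)]) simp
  have imV: "snd c ` V = W" using W(2) by (auto simp: V_def)
  define \<nu> where "\<nu> x = cscale k (inverse (sqrt (\<epsilon> * Q x)) *\<^sub>R n0 x)" for x
  have eQ: "smooth_on W (\<lambda>x. \<epsilon> *\<^sub>R Q x)"
    by (rule smooth_on_bilinear[OF W(1) bounded_bilinear_scaleR smooth_on_const smooth_on_subset[OF Q W(2)]])
  have sm: "smooth_on W \<nu>"
    unfolding \<nu>_def
    by (intro smooth_on_linear_comp[OF W(1) linear_cscale] smooth_on_bilinear[OF W(1) bounded_bilinear_scaleR]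
        smooth_on_subset[OF n0 W(2)] smooth_on_inverse_sqrt W(1) eQ[unfolded real_scaleR_def])
      (simp add: W_def)
  have "normal_field \<A> \<sigma> V (\<lambda>q. \<nu> (snd c q))"
    unfolding normal_field_iff
  proof (intro conjI ballI V)
    show "smooth_map_on \<A> V (\<lambda>q. \<nu> (snd c q))"
      by (rule smooth_map_on_chartI[OF c(1) V]) (simp add: imV sm)
  next
    fix q assume "q \<in> V"
    then have q: "q \<in> fst c" "\<epsilon> * Q (snd c q) > 0" by (auto simp: V_def W_def)
    let ?r = "inverse (sqrt (\<epsilon> * Q (snd c q)))" and ?n = "cross (\<sigma> q) (dmap c \<sigma> q (axis 1 1)) (dmap c \<sigma> q (axis 2 1))"
    have "bf (\<nu> (snd c q)) (\<nu> (snd c q)) = (k * k) * of_real (?r * ?r * Q (snd c q))"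
      by (simp add: \<nu>_def bf_simps bf_n0(1)[OF q(1)])
    also have "\<dots> = of_real (?r * ?r * (\<epsilon> * Q (snd c q)))" by (simp add: kk)
    also have "?r * ?r = inverse (\<epsilon> * Q (snd c q))"
      using q(2) by (simp only: inverse_mult_distrib[symmetric] real_sqrt_mult_self abs_of_pos)
    also have "inverse (\<epsilon> * Q (snd c q)) * (\<epsilon> * Q (snd c q)) = 1"
      using less_imp_neq[OF q(2)] by (intro left_inverse) simp
    finally have "bf (\<nu> (snd c q)) (\<nu> (snd c q)) = 1" by simp
    then show "unit_normal q (\<nu> (snd c q))"
    proof (rule unit_normalI[OF c(1) q(1)])
      show "bf (\<sigma> q) (\<nu> (snd c q)) = 0"
        by (simp add: \<nu>_def bf_simps n0_at[OF q(1)] bf_cross)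
      show "bf (\<nu> (snd c q)) (dmap c \<sigma> q u) = 0" for u
        unfolding linear_real2[OF d\<sigma>_linear[OF c(1) q(1)], of u]
        by (simp add: \<nu>_def bf_simps n0_at[OF q(1)] bf_cross)
    qed
  qed
  moreover have "p \<in> V"
    using c(2) bf_n0(2)[OF c(2)] by (simp add: V_def W_def \<epsilon>_def abs_sgn[symmetric] mult.commute)
  ultimately show ?thesis using that V(2) by blast
qed

end

section \<open>The forms on real four-space\<close>

text \<open>The Gram matrix of \<open>pform a\<close> in the standard basis is diagonal with these entries. The index \<open>4 = 0\<close> of
  the type is the fourth coordinate.\<close>

definition psign :: "nat \<Rightarrow> 4 \<Rightarrow> real" where
  "psign a k = (if (if k = 1 then 1 else if k = 2 then 2 else if k = 3 then 3 else 4) \<le> a then 1 else -1)"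

lemma psign_cases: "psign a k = 1 \<or> psign a k = -1" by (simp add: psign_def)

lemma psign_square [simp]: "psign a k * psign a k = 1" by (simp add: psign_def)

lemma pform_eq: "pform a x y = (\<Sum>k\<in>UNIV. psign a k * x $ k * y $ k)"
proof -
  have "{1..4::nat} = {1, 2, 3, 4}" by auto
  then show ?thesis by (simp add: pform_def sum_4 psign_def)
qed

lemma pform_commute: "pform a x y = pform a y x"
  by (simp add: pform_eq mult.assoc mult.left_commute mult.commute)

lemma pform_simps:
  "pform a (x + y) z = pform a x z + pform a y z" "pform a z (x + y) = pform a z x + pform a z y"
  "pform a (x - y) z = pform a x z - pform a y z" "pform a z (x - y) = pform a z x - pform a z y"
  "pform a (r *\<^sub>R x) z = r * pform a x z" "pform a z (r *\<^sub>R x) = r * pform a z x"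
  "pform a (- x) z = - pform a x z" "pform a z (- x) = - pform a z x"
  by (simp_all add: pform_eq sum_4 algebra_simps)

lemma bounded_bilinear_pform: "bounded_bilinear (pform a)"
  unfolding bilinear_conv_bounded_bilinear[symmetric] bilinear_def
  by (auto intro!: linearI simp: pform_simps)

lemma pform_axis: "pform a x (axis k 1) = psign a k * x $ k"
  by (simp add: pform_eq axis_def if_distrib cong: if_cong)

text \<open>The image of such a map is a real form of the space of matrices on which \<open>bf\<close> is real of signature
  \<open>(a, 4 - a)\<close>.\<close>

definition isometric_linear :: "nat \<Rightarrow> (real^4 \<Rightarrow> cmat) \<Rightarrow> bool" where
  "isometric_linear a L \<longleftrightarrow> linear L \<and> (\<forall>u v. bf (L u) (L v) = of_real (pform a u v))"

lemma isometric_linearD: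
  "isometric_linear a L \<Longrightarrow> linear L" "isometric_linear a L \<Longrightarrow> bf (L u) (L v) = of_real (pform a u v)"
  unfolding isometric_linear_def by auto

lemma linear_real4:
  fixes L :: "real^4 \<Rightarrow> 'b::real_vector"
  assumes "linear L" shows "L v = (\<Sum>k\<in>UNIV. v $ k *\<^sub>R L (axis k 1))"
proof -
  have "(\<Sum>k\<in>UNIV. v $ k *\<^sub>R axis k 1) = v"
    by (simp add: vec_eq_iff axis_def if_distrib cong: if_cong)
  from arg_cong[OF this, of L] show ?thesis using assms by (simp add: linear_sum linear_cmul)
qed

lemma isometric_expansion:
  assumes L: "isometric_linear a L"
  shows "X = (\<Sum>k\<in>UNIV. cscale (of_real (psign a k) * bf X (L (axis k 1))) (L (axis k 1)))"
proof -
  have "bf (L (axis k 1)) (cscale (of_real (psign a l)) (L (axis l 1))) = (if k = l then 1 else 0)" for k l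
    by (simp add: bf_simps isometric_linearD(2)[OF L] pform_axis) (simp add: axis_def flip: of_real_mult)
  from biorthogonal_expansion[of "\<lambda>k. L (axis k 1)" "\<lambda>k. cscale (of_real (psign a k)) (L (axis k 1))", OF this, of X]
  show ?thesis by (simp add: bf_simps)
qed

lemma isometric_nondegenerate:
  assumes "isometric_linear a L" "\<And>v. bf X (L v) = 0" shows "X = 0"
  using isometric_expansion[OF assms(1), of X] by (simp add: assms(2) cscale_simps)

text \<open>The image of \<open>L\<close> is a real form: its complexification is everything.\<close>

lemma isometric_split:
  assumes L: "isometric_linear a L"
  obtains y z where "X = L y + cscale \<i> (L z)"
proof
  have lin: "linear L" by (rule isometric_linearD(1)[OF L])
  let ?y = "\<chi> k. psign a k * Re (bf X (L (axis k 1)))" and ?z = "\<chi> k. psign a k * Im (bf X (L (axis k 1)))"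
  have "cscale (of_real s * w) Y = (s * Re w) *\<^sub>R Y + cscale \<i> ((s * Im w) *\<^sub>R Y)" for s w Y
    by (simp add: cscale_def vec_eq_iff complex_eq_iff algebra_simps)
  then have "X = (\<Sum>k\<in>UNIV. (psign a k * Re (bf X (L (axis k 1)))) *\<^sub>R L (axis k 1)
      + cscale \<i> ((psign a k * Im (bf X (L (axis k 1)))) *\<^sub>R L (axis k 1)))"
    by (subst isometric_expansion[OF L, of X]) simp
  then show "X = L ?y + cscale \<i> (L ?z)"
    using linear_real4[OF lin, of ?y] linear_real4[OF lin, of ?z]
    by (simp add: sum.distrib linear_sum[OF linear_cscale])
qed

lemma isometric_inj:
  assumes L: "isometric_linear a L" shows "inj L"
  unfolding linear_injective_0[OF isometric_linearD(1)[OF L]]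
proof (intro allI impI)
  fix v assume "L v = 0"
  then have "pform a v (axis k 1) = 0" for k
    using isometric_linearD(2)[OF L, of v "axis k 1"] by simp
  then show "v = 0" by (simp add: pform_axis vec_eq_iff) (metis psign_cases zero_neq_one neg_equal_0_iff_equal)
qed

section \<open>Flat isometries are affine\<close>

text \<open>The classical argument that an isometry of flat spaces has no second derivative. The trilinear form
  \<open>bf (D\<^sup>2F(u, w)) (DF v)\<close> is symmetric in \<open>u, w\<close>, and antisymmetric in \<open>u, v\<close> because the pull-back of
  \<open>bf\<close> is constant; such a form is zero. Since the complex span of the \<open>DF v\<close> is everything, the second
  derivative vanishes.\<close>

lemma flat_isometry_second_derivative:
  fixes F :: "real^4 \<Rightarrow> cmat"
  assumes W: "open W" and F: "smooth_on W F"
    and iso: "\<And>y. y \<in> W \<Longrightarrow> isometric_linear a (frechet_derivative F (at y))"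
    and y: "y \<in> W"
  shows "frechet_derivative (\<lambda>y. frechet_derivative F (at y) u) (at y) w = 0"
proof -
  define DF where "DF u y = frechet_derivative F (at y) u" for u y
  define H where "H u w = frechet_derivative (DF u) (at y) w" for u w
  have dDF: "(DF u has_derivative H u) (at y)" for u
    unfolding H_def using smooth_on_has_derivative[OF smooth_on_directional[OF F] W y, of u]
    unfolding DF_def by simp
  have sym: "H u w = H w u" for u w
    unfolding H_def DF_def by (rule second_derivative_commute[OF W F y])
  have skew: "bf (DF u y) (H v w) + bf (H u w) (DF v y) = 0" for u v w
  proof -
    have "((\<lambda>y. bf (DF u y) (DF v y)) has_derivative (\<lambda>w. bf (DF u y) (H v w) + bf (H u w) (DF v y))) (at y)"
      by (rule bounded_bilinear.FDERIV[OF bounded_bilinear_bf dDF dDF])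
    moreover have "((\<lambda>y. bf (DF u y) (DF v y)) has_derivative (\<lambda>_. 0)) (at y)"
      by (rule has_derivative_transform_within_open[OF has_derivative_const[of "of_real (pform a u v)"] W y])
        (simp add: DF_def isometric_linearD(2)[OF iso])
    ultimately have "(\<lambda>w. bf (DF u y) (H v w) + bf (H u w) (DF v y)) = (\<lambda>_. 0)"
      by (rule has_derivative_unique)
    then show ?thesis by meson
  qed
  have T: "bf (H u w) (DF v y) = - bf (H v w) (DF u y)" for u v w
    using skew[of u v w] by (simp add: bf_commute add_eq_0_iff)
  have "bf (H u w) (DF v y) = 0" for v
  proof -
    have "bf (H u w) (DF v y) = - bf (H w v) (DF u y)" using T[of u w v] sym by metis
    also have "\<dots> = bf (H u v) (DF w y)" using T[of w v u] by simp
    also have "\<dots> = bf (H v u) (DF w y)" using sym by metis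
    also have "\<dots> = - bf (H w u) (DF v y)" using T by metis
    also have "\<dots> = - bf (H u w) (DF v y)" using sym by metis
    finally show ?thesis by simp
  qed
  then have "H u w = 0"
    unfolding DF_def by (intro isometric_nondegenerate[OF iso[OF y]])
  then show ?thesis unfolding H_def DF_def .
qed

section \<open>Isometric maps of the quadrics\<close>

text \<open>The rational parametrisation of a conic, as for \<open>SL2\<close>.\<close>

lemma pquadric_curve:
  assumes x: "x \<in> pquadric a" "pform a x v = 0"
  obtains \<gamma> where "(\<gamma> has_vector_derivative v) (at (0::real))" "\<gamma> 0 = x" "eventually (\<lambda>t. \<gamma> t \<in> pquadric a) (at 0)"
proof
  \<comment> \<open>Chosen so that the numerator below becomes a perfect square.\<close>
  define \<kappa> where "\<kappa> = - pform a v v / 4"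
  let ?a = "\<lambda>t. (1 - \<kappa> * t\<^sup>2) / (1 + \<kappa> * t\<^sup>2)" and ?b = "\<lambda>t. t / (1 + \<kappa> * t\<^sup>2)"
  let ?\<gamma> = "\<lambda>t. ?a t *\<^sub>R x + ?b t *\<^sub>R v"
  have a: "(?a has_real_derivative 0) (at 0)" and b: "(?b has_real_derivative 1) (at 0)"
    by (auto intro!: derivative_eq_intros)
  show "(?\<gamma> has_vector_derivative v) (at 0)"
    using has_vector_derivative_add[OF has_vector_derivative_scaleR[OF a has_vector_derivative_const[of x]]
        has_vector_derivative_scaleR[OF b has_vector_derivative_const[of v]]] by simp
  show "?\<gamma> 0 = x" by simp
  have "((\<lambda>t. 1 + \<kappa> * t\<^sup>2) \<longlongrightarrow> 1 + \<kappa> * 0\<^sup>2) (at (0::real))"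
    by (intro tendsto_intros)
  then have "\<forall>\<^sub>F t in at (0::real). 1 + \<kappa> * t\<^sup>2 \<noteq> 0"
    by (rule tendsto_imp_eventually_ne) simp
  then show "\<forall>\<^sub>F t in at 0. ?\<gamma> t \<in> pquadric a"
  proof eventually_elim
    case (elim t)
    have "pform a (?\<gamma> t) (?\<gamma> t) = - (?a t)\<^sup>2 + (?b t)\<^sup>2 * pform a v v"
      using x by (simp add: pform_simps pquadric_def pform_commute[of a v x] power2_eq_square)
    also have "\<dots> = (- (1 - \<kappa> * t\<^sup>2)\<^sup>2 + t\<^sup>2 * (- 4 * \<kappa>)) / (1 + \<kappa> * t\<^sup>2)\<^sup>2"
      by (simp add: \<kappa>_def power_divide diff_divide_distrib)
    also have "- (1 - \<kappa> * t\<^sup>2)\<^sup>2 + t\<^sup>2 * (- 4 * \<kappa>) = - ((1 + \<kappa> * t\<^sup>2)\<^sup>2)"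
      by (simp add: power2_eq_square algebra_simps)
    finally show ?case using elim by (simp add: pquadric_def)
  qed
qed

lemma frechet_derivative_pquadric:
  assumes N: "N = pquadric a \<inter> O'" "open O'" and x: "x \<in> N" "pform a x v = 0"
    and G: "(G has_derivative G') (at x)" and U: "open U" "x \<in> U" "\<And>y. y \<in> U \<inter> N \<Longrightarrow> G y = f y"
  shows "frechet_derivative f (at x within N) v = G' v"
proof -
  have "x \<in> pquadric a" using N x by simp
  from pquadric_curve[OF this x(2)] obtain \<gamma> where \<gamma>: "(\<gamma> has_vector_derivative v) (at (0::real))" "\<gamma> 0 = x"
      "eventually (\<lambda>t. \<gamma> t \<in> pquadric a) (at 0)" by blast
  have "isCont \<gamma> 0" using \<gamma>(1) has_vector_derivative_continuous by blast
  then have "\<forall>\<^sub>F t in at 0. \<gamma> t \<in> O'"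
    using N x \<gamma>(2) unfolding isCont_def by (intro topological_tendstoD) auto
  with \<gamma>(3) have ev: "\<forall>\<^sub>F t in at 0. \<gamma> t \<in> N"
    by eventually_elim (simp add: N)
  have "(f has_derivative G') (at x within N)"
  proof (rule has_derivative_transform_eventually[OF has_derivative_at_withinI[OF G]])
    show "\<forall>\<^sub>F y in at x within N. G y = f y"
      unfolding eventually_at_topological using U by (intro exI[of _ U]) auto
    show "G x = f x" "x \<in> N" using U x by auto
  qed
  then show ?thesis by (rule frechet_derivative_within_tangent[OF \<gamma>(1,2) ev x(1)])
qed

text \<open>The derivative at \<open>x\<close> of the extension \<open>r x \<mapsto> r f x\<close> (\<open>r > 0\<close>, \<open>x \<in> N\<close>) of \<open>f\<close> to the cone over \<open>N\<close>. The
  vector \<open>v\<close> is decomposed into its tangential part \<open>v + pform a x v *\<^sub>R x\<close> and its radial part.\<close>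

definition cone_map :: "nat \<Rightarrow> (real^4) set \<Rightarrow> (real^4 \<Rightarrow> cmat) \<Rightarrow> real^4 \<Rightarrow> real^4 \<Rightarrow> cmat" where
  "cone_map a N f x v = frechet_derivative f (at x within N) (v + pform a x v *\<^sub>R x) - pform a x v *\<^sub>R f x"

locale isometric_embedding =
  fixes a :: nat and N O' :: "(real^4) set" and f :: "real^4 \<Rightarrow> cmat"
  assumes embedding: "isometric_embedding_SL2 a N f" and N: "N = pquadric a \<inter> O'" "open O'"
begin

lemma f_SL2: "x \<in> N \<Longrightarrow> f x \<in> SL2"
  using embedding unfolding isometric_embedding_SL2_def by auto

lemma N_pform: "x \<in> N \<Longrightarrow> pform a x x = -1"
  using N by (simp add: pquadric_def)

lemma local_extension:
  assumes "x \<in> N"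
  obtains U G where "open U" "x \<in> U" "smooth_on U G" "\<And>y. y \<in> U \<inter> N \<Longrightarrow> G y = f y"
  using embedding assms unfolding isometric_embedding_SL2_def smooth_on_subset_def by metis

text \<open>The cone over \<open>N\<close> is open in real four-space, so that the extension \<open>r x \<mapsto> r f x\<close> is a smooth map in the
  ordinary sense. Near \<open>x\<close> it is given by a formula in terms of a smooth local extension of \<open>f\<close>. Its
  derivative is constant along rays, hence it is expressed by the derivative at the point of \<open>N\<close> on the
  ray.\<close>

lemma cone_extension:
  assumes x: "x \<in> N"
  obtains W F where "open W" "x \<in> W" "smooth_on W F"
    "\<And>y. y \<in> W \<Longrightarrow> inverse (sqrt (- pform a y y)) *\<^sub>R y \<in> N \<and>
       (F has_derivative cone_map a N f (inverse (sqrt (- pform a y y)) *\<^sub>R y)) (at y)"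
proof -
  obtain U G where U: "open U" "x \<in> U" "smooth_on U G" and G: "\<And>y. y \<in> U \<inter> N \<Longrightarrow> G y = f y"
    using local_extension[OF x] by blast
  define q where "q y = - pform a y y" for y
  define \<rho> where "\<rho> y = inverse (sqrt (q y))" for y
  define h where "h y = \<rho> y *\<^sub>R y" for y
  have sid: "smooth_on S (\<lambda>y. y)" for S :: "(real^4) set"
    by (rule smooth_on_linear) (auto intro!: linearI)
  have spf: "smooth_on S (\<lambda>y. pform a y y)" if "open S" for S
    using that by (intro smooth_on_bilinear[OF _ bounded_bilinear_pform] sid)
  have lneg: "linear (\<lambda>x::real. - x)" by (auto intro!: linearI)
  have sq: "smooth_on S q" if "open S" for S
    unfolding q_def using smooth_on_linear_comp[OF that lneg spf[OF that]] by simp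
  define P where "P = {y. q y > 0}"
  have P: "open P"
    unfolding P_def using smooth_on_continuous[OF sq[OF open_UNIV]]
    by (intro open_Collect_less continuous_intros) auto
  have s\<rho>: "smooth_on P \<rho>"
    unfolding \<rho>_def by (intro smooth_on_inverse_sqrt P sq) (simp add: P_def)
  have sh: "smooth_on P h"
    unfolding h_def by (intro smooth_on_bilinear[OF P bounded_bilinear_scaleR] s\<rho> sid)
  define W where "W = P \<inter> h -` (U \<inter> O')"
  have W: "open W" "W \<subseteq> P"
    unfolding W_def
    by (rule continuous_open_preimage[OF smooth_on_continuous[OF sh] P open_Int[OF U(1) N(2)]]) simp
  have hN: "h y \<in> N" if "y \<in> W" for y
  proof -
    have "q y > 0" using that W(2) by (auto simp: P_def)
    have "pform a (h y) (h y) = - (\<rho> y * \<rho> y * q y)" by (simp add: h_def pform_simps q_def)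
    also have "\<rho> y * \<rho> y = inverse (q y)"
      using \<open>q y > 0\<close> unfolding \<rho>_def by (simp only: inverse_mult_distrib[symmetric] real_sqrt_mult_self abs_of_pos)
    also have "- (inverse (q y) * q y) = -1" using \<open>q y > 0\<close> by simp
    finally show ?thesis using that by (simp add: N W_def pquadric_def)
  qed
  have hx: "h x = x" "x \<in> P" using N_pform[OF x] by (simp_all add: h_def \<rho>_def q_def P_def)
  then have "x \<in> W" using x U(2) N by (simp add: W_def)
  define F where "F y = (q y * \<rho> y) *\<^sub>R G (h y)" for y
  have "smooth_on W F"
    unfolding F_def
  proof (intro smooth_on_bilinear[OF W(1) bounded_bilinear_scaleR] smooth_on_bilinear[OF W(1) bounded_bilinear_mult])
    show "smooth_on W q" by (rule sq[OF W(1)])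
    show "smooth_on W \<rho>" by (rule smooth_on_subset[OF s\<rho> W(2)])
    show "smooth_on W (\<lambda>y. G (h y))"
      by (rule smooth_on_compose[OF W(1) U(1) _ smooth_on_subset[OF sh W(2)] U(3)]) (auto simp: W_def)
  qed
  moreover have "(F has_derivative cone_map a N f (h y)) (at y)" if y: "y \<in> W" for y
  proof -
    have qy: "q y > 0" using y W(2) by (auto simp: P_def)
    define z where "z = h y"
    define r where "r = sqrt (q y)"
    have r: "r > 0" using qy by (simp add: r_def)
    have yz: "y = r *\<^sub>R z" using r by (simp add: z_def h_def \<rho>_def r_def)
    have py: "pform a y v = r * pform a z v" for v
      by (subst yz) (simp add: pform_simps)
    have yr: "(t * inverse r) *\<^sub>R y = t *\<^sub>R z" for t
      using r by (subst yz) simp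
    have z: "z \<in> N" unfolding z_def by (rule hN[OF y])
    have zU: "z \<in> U" using y by (simp add: z_def W_def)
    have dq: "(q has_derivative (\<lambda>v. - (2 * pform a y v))) (at y)"
      unfolding q_def
      using has_derivative_minus[OF bounded_bilinear.FDERIV[OF bounded_bilinear_pform has_derivative_ident has_derivative_ident]]
      by (rule has_derivative_eq_rhs) (simp add: pform_commute fun_eq_iff)
    have dr: "((\<lambda>y. sqrt (q y)) has_derivative (\<lambda>v. - pform a z v)) (at y)"
      using has_derivative_real_sqrt[OF qy dq]
      by (rule has_derivative_eq_rhs) (use r in \<open>simp add: fun_eq_iff r_def[symmetric] py\<close>)
    have d\<rho>: "(\<rho> has_derivative (\<lambda>v. inverse r * pform a z v * inverse r)) (at y)"
      unfolding \<rho>_def using Deriv.has_derivative_inverse[OF _ dr] qy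
      by (auto simp: r_def elim!: has_derivative_eq_rhs)
    have dh: "(h has_derivative (\<lambda>v. inverse r *\<^sub>R (v + pform a z v *\<^sub>R z))) (at y)"
      unfolding h_def using has_derivative_scaleR[OF d\<rho> has_derivative_ident]
      by (rule has_derivative_eq_rhs)
        (simp add: fun_eq_iff \<rho>_def r_def[symmetric] scaleR_add_right yr)
    define G' where "G' = frechet_derivative G (at z)"
    have dG: "(G has_derivative G') (at z)"
      unfolding G'_def by (rule smooth_on_has_derivative[OF U(3,1) zU])
    have "((\<lambda>y. sqrt (q y) *\<^sub>R G (h y)) has_derivative
        (\<lambda>v. r *\<^sub>R G' (inverse r *\<^sub>R (v + pform a z v *\<^sub>R z)) + (- pform a z v) *\<^sub>R G z)) (at y)"
      using has_derivative_scaleR[OF dr has_derivative_compose[OF dh dG[unfolded z_def]]]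
      by (simp add: r_def z_def)
    moreover have "r *\<^sub>R G' (inverse r *\<^sub>R (v + pform a z v *\<^sub>R z)) + (- pform a z v) *\<^sub>R G z = cone_map a N f z v" for v
    proof -
      have "pform a z (v + pform a z v *\<^sub>R z) = 0" by (simp add: pform_simps N_pform[OF z])
      from frechet_derivative_pquadric[OF N z this dG U(1) zU G]
      have "frechet_derivative f (at z within N) (v + pform a z v *\<^sub>R z) = G' (v + pform a z v *\<^sub>R z)" .
      then show ?thesis
        using r G[of z] z zU by (simp add: cone_map_def linear_cmul[OF has_derivative_linear[OF dG]])
    qed
    ultimately have "((\<lambda>y. sqrt (q y) *\<^sub>R G (h y)) has_derivative cone_map a N f z) (at y)"
      by simp
    then show ?thesis unfolding z_def
    proof (rule has_derivative_transform_within_open[OF _ W(1) y])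
      fix y assume "y \<in> W"
      then have "q y > 0" using W(2) by (auto simp: P_def)
      then show "sqrt (q y) *\<^sub>R G (h y) = F y"
        by (simp add: F_def \<rho>_def divide_inverse[symmetric] real_div_sqrt)
    qed
  qed
  ultimately show ?thesis
    using that[OF W(1) \<open>x \<in> W\<close>] hN unfolding h_def \<rho>_def q_def by blast
qed

text \<open>The forms agree on position vectors and, by hypothesis, on tangent vectors, and the map respects the
  orthogonal splitting into both: \<open>f x\<close> is orthogonal to the derivatives of \<open>f\<close>, because
  \<open>bf (f x) (f x)\<close> is constant.\<close>

lemma cone_map_isometric:
  assumes x: "x \<in> N" shows "isometric_linear a (cone_map a N f x)" and "cone_map a N f x x = f x"
proof -
  have hx: "inverse (sqrt (- pform a x x)) *\<^sub>R x = x" by (simp add: N_pform[OF x])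
  obtain F where "(F has_derivative cone_map a N f x) (at x)"
    using cone_extension[OF x] hx by metis
  then have lin: "linear (cone_map a N f x)" by (rule has_derivative_linear)
  let ?T = "frechet_derivative f (at x within N)"
  obtain U G where U: "open U" "x \<in> U" "smooth_on U G" and G: "\<And>y. y \<in> U \<inter> N \<Longrightarrow> G y = f y"
    using local_extension[OF x] by blast
  define G' where "G' = frechet_derivative G (at x)"
  have dG: "(G has_derivative G') (at x)"
    unfolding G'_def by (rule smooth_on_has_derivative[OF U(3,1,2)])
  have T: "?T v = G' v" "bf (f x) (?T v) = 0" if v: "pform a x v = 0" for v
  proof -
    show T: "?T v = G' v"
      by (rule frechet_derivative_pquadric[OF N x v dG U(1,2) G])
    have "frechet_derivative (\<lambda>y. bf (f y) (f y)) (at x within N) v = bf (G x) (G' v) + bf (G' v) (G x)"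
      using frechet_derivative_pquadric[OF N x v bounded_bilinear.FDERIV[OF bounded_bilinear_bf dG dG] U(1,2)] G by simp
    moreover have "frechet_derivative (\<lambda>y. bf (f y) (f y)) (at x within N) v = 0"
      by (rule frechet_derivative_pquadric[OF N x v has_derivative_const[of "-1"] U(1,2)])
        (simp add: f_SL2[unfolded SL2_iff])
    ultimately have "2 * bf (G x) (G' v) = 0" by (simp add: bf_commute)
    then show "bf (f x) (?T v) = 0" using T G[of x] x U(2) by simp
  qed
  have "bf (cone_map a N f x u) (cone_map a N f x v) = of_real (pform a u v)" for u v
  proof -
    let ?u = "u + pform a x u *\<^sub>R x" and ?v = "v + pform a x v *\<^sub>R x"
    have 0: "pform a x ?u = 0" "pform a x ?v = 0" by (simp_all add: pform_simps N_pform[OF x])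
    have "hol_metric (f x) (?T ?u) (?T ?v) = of_real (pform a ?u ?v)"
      using embedding x 0 unfolding isometric_embedding_SL2_def pquadric_tangent_def by blast
    then have "bf (?T ?u) (?T ?v) = of_real (pform a ?u ?v)"
      by (simp add: hol_metric_eq[OF f_SL2[OF x]] T(2)[OF 0(1)] T(2)[OF 0(2)])
    moreover have "bf (f x) (f x) = -1" using f_SL2[OF x] by (simp add: SL2_iff)
    moreover have "bf (?T ?u) (f x) = 0" using T(2)[OF 0(1)] by (simp add: bf_commute)
    ultimately have "bf (cone_map a N f x u) (cone_map a N f x v) =
        of_real (pform a ?u ?v) - of_real (pform a x u * pform a x v)"
      unfolding cone_map_def by (simp add: bf_diff bf_scaleR T(2)[OF 0(2)])
    also have "\<dots> = of_real (pform a u v)"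
      by (simp add: pform_simps N_pform[OF x] pform_commute[of a u x] flip: of_real_diff)
    finally show ?thesis .
  qed
  with lin show "isometric_linear a (cone_map a N f x)" unfolding isometric_linear_def by blast
  have "pform a x 0 = 0" using pform_simps(5)[of a 0 x x] by (simp add: pform_commute)
  then have "?T 0 = 0" using T(1)[of 0] linear_0[OF has_derivative_linear[OF dG]] by simp
  then show "cone_map a N f x x = f x" by (simp add: cone_map_def N_pform[OF x])
qed

text \<open>The cone extension is an isometry of flat spaces, so its second derivative vanishes. This is the
  rigidity behind the theorem: an isometric embedding of a quadric of constant curvature \<open>- 1\<close> is locally
  the restriction of a linear map.\<close>

lemma cone_map_locally_constant:
  assumes x: "x \<in> N"
  obtains B where "open B" "x \<in> B" "\<And>y. y \<in> B \<inter> N \<Longrightarrow> cone_map a N f y = cone_map a N f x"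
proof -
  let ?h = "\<lambda>y. inverse (sqrt (- pform a y y)) *\<^sub>R y"
  obtain W F where W: "open W" "x \<in> W" "smooth_on W F"
    and F: "\<And>y. y \<in> W \<Longrightarrow> ?h y \<in> N" "\<And>y. y \<in> W \<Longrightarrow> (F has_derivative cone_map a N f (?h y)) (at y)"
    using cone_extension[OF x] by metis
  have DF: "frechet_derivative F (at y) = cone_map a N f (?h y)" if "y \<in> W" for y
    using frechet_derivative_at[OF F(2)[OF that]] by simp
  obtain e where e: "e > 0" "ball x e \<subseteq> W" using W(1,2) open_contains_ball by blast
  have "cone_map a N f y u = cone_map a N f x u" if y: "y \<in> ball x e \<inter> N" for y u
  proof -
    have "((\<lambda>y. frechet_derivative F (at y) u) has_derivative (\<lambda>_. 0)) (at z within ball x e)" if "z \<in> ball x e" for z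
    proof -
      have zW: "z \<in> W" using that e by blast
      have "((\<lambda>y. frechet_derivative F (at y) u) has_derivative
          frechet_derivative (\<lambda>y. frechet_derivative F (at y) u) (at z)) (at z)"
        by (rule smooth_on_has_derivative[OF smooth_on_directional[OF W(3)] W(1) zW])
      moreover have "frechet_derivative (\<lambda>y. frechet_derivative F (at y) u) (at z) = (\<lambda>_. 0)"
        by (rule ext, rule flat_isometry_second_derivative[OF W(1,3) _ zW, of a])
          (simp add: DF cone_map_isometric(1) F(1))
      ultimately have "((\<lambda>y. frechet_derivative F (at y) u) has_derivative (\<lambda>_. 0)) (at z)" by simp
      then show ?thesis by (rule has_derivative_at_withinI)
    qed
    then obtain C where C: "\<And>z. z \<in> ball x e \<Longrightarrow> frechet_derivative F (at z) u = C"
      using has_derivative_zero_constant[OF convex_ball, of x e "\<lambda>y. frechet_derivative F (at y) u"] by blast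
    have "?h z = z" if "z \<in> N" for z by (simp add: N_pform[OF that])
    then show ?thesis using C[of y] C[of x] y x e DF[of x] DF[of y] by (auto simp: subset_iff)
  qed
  then show ?thesis using that[of "ball x e"] e by auto
qed

end

section \<open>Real symmetric forms\<close>

text \<open>Two subspaces, one spanned by the vectors of sign \<open>s\<close> and one by the standard basis
  vectors of sign \<open>- s\<close>, meet in zero, so their dimensions add up to at most four.\<close>

lemma sylvester_le:
  fixes w :: "4 \<Rightarrow> real^4"
  assumes w: "\<And>k l. pform a (w k) (w l) = (if k = l then \<epsilon> k else 0)"
    and \<epsilon>: "\<And>k. \<epsilon> k = 1 \<or> \<epsilon> k = -1" and s: "s = 1 \<or> s = -1"
  shows "card {k. \<epsilon> k = s} + card {k. psign a k = - s} \<le> 4"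
proof -
  define W :: "real^4 \<Rightarrow> real^4" where "W c = (\<Sum>k\<in>UNIV. c $ k *\<^sub>R w k)" for c
  have lin: "linear W"
    unfolding W_def by (auto intro!: linearI simp: scaleR_add_left sum.distrib scaleR_sum_right)
  have psum: "pform a (\<Sum>k\<in>A. f k) z = (\<Sum>k\<in>A. pform a (f k) z)" for A z and f :: "4 \<Rightarrow> real^4"
    by (rule linear_sum) (auto intro!: linearI simp: pform_simps)
  have Wz: "pform a (W c) z = (\<Sum>k\<in>UNIV. c $ k * pform a (w k) z)" for c z
    by (simp add: W_def psum pform_simps)
  have Ww: "pform a (W c) (w l) = \<epsilon> l * c $ l" for c l
    by (simp add: Wz w if_distrib cong: if_cong)
  have wW: "pform a (w l) (W c) = \<epsilon> l * c $ l" for c l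
    by (subst pform_commute) (rule Ww)
  have WW: "pform a (W c) (W c) = (\<Sum>k\<in>UNIV. \<epsilon> k * (c $ k)\<^sup>2)" for c
    by (simp add: Wz wW power2_eq_square mult.left_commute)
  have inj: "inj W"
    unfolding linear_injective_0[OF lin]
  proof (intro allI impI)
    fix c assume "W c = 0"
    moreover have "pform a 0 x = 0" for x by (simp add: pform_eq)
    ultimately have "\<epsilon> l * c $ l = 0" for l using Ww[of c l] by simp
    then have "c $ l = 0" for l using \<epsilon>[of l] by (metis mult_eq_0_iff neg_equal_0_iff_equal zero_neq_one)
    then show "c = 0" by (simp add: vec_eq_iff)
  qed
  let ?supp = "\<lambda>I. {x::real^4. \<forall>i. i \<notin> I \<longrightarrow> x $ i = 0}"
  let ?I = "{k. \<epsilon> k = s}" and ?J = "{k. psign a k = - s}"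
  have sub: "subspace (?supp I)" for I by (auto simp: subspace_def)
  have dim: "dim (?supp I) = card I" for I
    using dim_substandard_cart[of I, where 'a=real] by (simp add: dim_vec_eq)
  have int: "W ` ?supp ?I \<inter> ?supp ?J \<subseteq> {0}"
  proof
    fix x assume "x \<in> W ` ?supp ?I \<inter> ?supp ?J"
    then obtain c where c: "x = W c" "\<And>i. \<epsilon> i \<noteq> s \<Longrightarrow> c $ i = 0" and x: "\<And>i. psign a i \<noteq> - s \<Longrightarrow> x $ i = 0"
      by auto
    have ss: "s * s = 1" using s by auto
    have "pform a x x = (\<Sum>k\<in>UNIV. s * (c $ k)\<^sup>2)"
      unfolding c(1) WW
    proof (rule sum.cong[OF refl])
      fix k show "\<epsilon> k * (c $ k)\<^sup>2 = s * (c $ k)\<^sup>2" using c(2)[of k] by (cases "\<epsilon> k = s") simp_all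
    qed
    moreover have "pform a x x = (\<Sum>k\<in>UNIV. - s * (x $ k)\<^sup>2)"
      unfolding pform_eq
    proof (rule sum.cong[OF refl])
      fix k show "psign a k * x $ k * x $ k = - s * (x $ k)\<^sup>2"
        using x[of k] by (cases "psign a k = - s") (simp_all add: power2_eq_square)
    qed
    ultimately have "s * (\<Sum>k\<in>UNIV. (c $ k)\<^sup>2) = - s * (\<Sum>k\<in>UNIV. (x $ k)\<^sup>2)"
      by (simp add: sum_distrib_left)
    then have "(s * s) * (\<Sum>k\<in>UNIV. (c $ k)\<^sup>2) = (s * s) * (- (\<Sum>k\<in>UNIV. (x $ k)\<^sup>2))"
      by (simp only: mult.assoc mult_minus_left mult_minus_right)
    then have "(\<Sum>k\<in>UNIV. (c $ k)\<^sup>2) = - (\<Sum>k\<in>UNIV. (x $ k)\<^sup>2)" unfolding ss by simp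
    moreover have "(\<Sum>k\<in>UNIV. (c $ k)\<^sup>2) \<ge> 0" "(\<Sum>k\<in>UNIV. (x $ k)\<^sup>2) \<ge> 0"
      by (simp_all add: sum_nonneg)
    ultimately have "(\<Sum>k\<in>UNIV. (x $ k)\<^sup>2) = 0" by linarith
    then have "x $ k = 0" for k by (simp add: sum_nonneg_eq_0_iff)
    then show "x \<in> {0}" by (simp add: vec_eq_iff)
  qed
  have "dim (W ` ?supp ?I) = card ?I"
    using dim_image_eq[OF lin, of "?supp ?I"] inj dim[of ?I] by (simp add: inj_on_subset)
  moreover have "dim {x + y |x y. x \<in> W ` ?supp ?I \<and> y \<in> ?supp ?J} + dim (W ` ?supp ?I \<inter> ?supp ?J)
      = dim (W ` ?supp ?I) + dim (?supp ?J)"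
    by (intro dim_sums_Int sub linear_subspace_image lin)
  moreover have "dim (W ` ?supp ?I \<inter> ?supp ?J) = 0"
    using int by simp
  moreover have "dim {x + y |x y. x \<in> W ` ?supp ?I \<and> y \<in> ?supp ?J} \<le> 4"
    using dim_subset_UNIV[of "{x + y |x y. x \<in> W ` ?supp ?I \<and> y \<in> ?supp ?J}"] by simp
  ultimately show ?thesis using dim[of ?J] by linarith
qed

text \<open>The inequality for both signs gives the law of inertia for \<open>pform a\<close>.\<close>

lemma sylvester:
  fixes w :: "4 \<Rightarrow> real^4"
  assumes w: "\<And>k l. pform a (w k) (w l) = (if k = l then \<epsilon> k else 0)"
    and \<epsilon>: "\<And>k. \<epsilon> k = 1 \<or> \<epsilon> k = -1" and a: "a \<le> 4"
  shows "card {k. \<epsilon> k = 1} = a"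
proof -
  have split: "card {k. e k = (1::real)} + card {k. e k = -1} = 4" if "\<And>k. e k = 1 \<or> e k = -1" for e :: "4 \<Rightarrow> real"
  proof -
    have "{k. e k = 1} \<union> {k. e k = -1} = UNIV" "{k. e k = 1} \<inter> {k. e k = -1} = {}"
      using that by auto
    then have "card {k. e k = 1} + card {k. e k = -1} = card (UNIV :: 4 set)"
      by (metis card_Un_disjoint finite)
    then show ?thesis by simp
  qed
  have "card {k. psign a k = 1} = (\<Sum>k\<in>UNIV. if psign a k = 1 then 1 else 0)"
    by (simp add: sum.If_cases)
  also have "\<dots> = a" using a by (auto simp: sum_4 psign_def)
  finally have "card {k. psign a k = 1} = a" .
  then show ?thesis
    using sylvester_le[OF w \<epsilon>, of 1] sylvester_le[OF w \<epsilon>, of "-1"]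
      split[of \<epsilon>, OF \<epsilon>] split[of "psign a", OF psign_cases] by simp
qed

text \<open>The index \<open>m\<close> is the number of positive directions of a nondegenerate form on the plane.\<close>

definition metric_type :: "nat \<Rightarrow> (real^2 \<Rightarrow> real^2 \<Rightarrow> real) \<Rightarrow> bool" where
  "metric_type m = (if m = 2 then pos_definite else if m = 1 then signature_1_1 else neg_definite)"

definition sym_bilinear :: "(real^2 \<Rightarrow> real^2 \<Rightarrow> real) \<Rightarrow> bool" where
  "sym_bilinear b \<longleftrightarrow> (\<forall>u v. b u v = b v u) \<and> (\<forall>u v w. b (u + v) w = b u w + b v w) \<and>
     (\<forall>r u w. b (r *\<^sub>R u) w = r * b u w)"

text \<open>The condition \<open>\<epsilon>\<^sub>2 \<le> \<epsilon>\<^sub>1\<close> puts positive directions first, as in \<open>pform\<close>.\<close>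

definition orthonormal_pair where
  "orthonormal_pair b e\<^sub>1 e\<^sub>2 \<epsilon>\<^sub>1 \<epsilon>\<^sub>2 \<longleftrightarrow> b e\<^sub>1 e\<^sub>1 = \<epsilon>\<^sub>1 \<and> b e\<^sub>2 e\<^sub>2 = \<epsilon>\<^sub>2 \<and> b e\<^sub>1 e\<^sub>2 = 0 \<and>
     (\<epsilon>\<^sub>1 = 1 \<or> \<epsilon>\<^sub>1 = -1) \<and> (\<epsilon>\<^sub>2 = 1 \<or> \<epsilon>\<^sub>2 = (-1::real)) \<and> \<epsilon>\<^sub>2 \<le> \<epsilon>\<^sub>1"

lemma sym_bilinearD:
  assumes "sym_bilinear b"
  shows "b u v = b v u" "b (u + v) w = b u w + b v w" "b w (u + v) = b w u + b w v"
    "b (r *\<^sub>R u) w = r * b u w" "b w (r *\<^sub>R u) = r * b w u" "b (u - v) w = b u w - b v w" "b 0 w = 0"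
proof -
  have s: "\<And>u v. b u v = b v u" and add: "\<And>u v w. b (u + v) w = b u w + b v w"
    and sc: "\<And>r u w. b (r *\<^sub>R u) w = r * b u w"
    using assms unfolding sym_bilinear_def by auto
  show "b u v = b v u" "b (u + v) w = b u w + b v w" "b (r *\<^sub>R u) w = r * b u w" by (fact s add sc)+
  show "b w (u + v) = b w u + b w v" using s add by metis
  show "b w (r *\<^sub>R u) = r * b w u" using s sc by metis
  show "b (u - v) w = b u w - b v w" using add[of u "(-1) *\<^sub>R v" w] sc[of "-1" v w] by simp
  show "b 0 w = 0" using sc[of 0 0 w] by simp
qed

lemma orthonormal_pair_basis:
  assumes b: "sym_bilinear b" and o: "orthonormal_pair b e\<^sub>1 e\<^sub>2 \<epsilon>\<^sub>1 \<epsilon>\<^sub>2"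
  shows "e\<^sub>1 \<noteq> e\<^sub>2" "independent {e\<^sub>1, e\<^sub>2}" "\<exists>s t. u = s *\<^sub>R e\<^sub>1 + t *\<^sub>R e\<^sub>2"
proof -
  note bs = sym_bilinearD[OF b]
  have nz: "b e\<^sub>1 e\<^sub>1 \<noteq> 0" "b e\<^sub>2 e\<^sub>2 \<noteq> 0" "b e\<^sub>1 e\<^sub>2 = 0" using o unfolding orthonormal_pair_def by auto
  show ne: "e\<^sub>1 \<noteq> e\<^sub>2" using nz by auto
  have e: "e\<^sub>1 \<noteq> 0" "e\<^sub>2 \<noteq> 0" using nz bs(7) by auto
  have "e\<^sub>1 \<notin> span {e\<^sub>2}"
  proof
    assume "e\<^sub>1 \<in> span {e\<^sub>2}"
    then obtain k where k: "e\<^sub>1 = k *\<^sub>R e\<^sub>2" by (auto simp: span_singleton)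
    then have "k * b e\<^sub>2 e\<^sub>2 = 0" using nz(3) bs(4) by metis
    then show False using nz(2) k e(1) by simp
  qed
  then show ind: "independent {e\<^sub>1, e\<^sub>2}"
    using ne e by (simp add: independent_insert)
  have "UNIV \<subseteq> span {e\<^sub>1, e\<^sub>2}"
    by (rule card_ge_dim_independent) (use ind ne in auto)
  then have "u \<in> span {e\<^sub>1, e\<^sub>2}" by blast
  then obtain s where "u - s *\<^sub>R e\<^sub>1 \<in> span {e\<^sub>2}" using span_breakdown_eq by blast
  then obtain t where "u - s *\<^sub>R e\<^sub>1 = t *\<^sub>R e\<^sub>2" by (auto simp: span_singleton)
  then show "\<exists>s t. u = s *\<^sub>R e\<^sub>1 + t *\<^sub>R e\<^sub>2" by (metis add.commute diff_add_cancel)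
qed

lemma metric_type_of_pair:
  assumes b: "sym_bilinear b" and o: "orthonormal_pair b e\<^sub>1 e\<^sub>2 \<epsilon>\<^sub>1 \<epsilon>\<^sub>2"
  shows "metric_type (of_bool (\<epsilon>\<^sub>1 = 1) + of_bool (\<epsilon>\<^sub>2 = 1)) b"
proof -
  note bs = sym_bilinearD[OF b] and od = o[unfolded orthonormal_pair_def]
  have quad: "\<exists>s t. b u u = s\<^sup>2 * \<epsilon>\<^sub>1 + t\<^sup>2 * \<epsilon>\<^sub>2 \<and> (s \<noteq> 0 \<or> t \<noteq> 0)" if "u \<noteq> 0" for u
  proof -
    obtain s t where u: "u = s *\<^sub>R e\<^sub>1 + t *\<^sub>R e\<^sub>2" using orthonormal_pair_basis(3)[OF b o] by blast
    have "b u u = s\<^sup>2 * \<epsilon>\<^sub>1 + t\<^sup>2 * \<epsilon>\<^sub>2"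
      unfolding u using od bs(1)[of e\<^sub>2 e\<^sub>1] by (simp add: bs(2-5) power2_eq_square)
    moreover have "s \<noteq> 0 \<or> t \<noteq> 0" using that u by auto
    ultimately show ?thesis by blast
  qed
  have pos: "s\<^sup>2 + t\<^sup>2 > 0" if "s \<noteq> 0 \<or> t \<noteq> 0" for s t :: real
    using that by (simp add: sum_power2_gt_zero_iff)
  consider "\<epsilon>\<^sub>1 = 1" "\<epsilon>\<^sub>2 = 1" | "\<epsilon>\<^sub>1 = 1" "\<epsilon>\<^sub>2 = -1" | "\<epsilon>\<^sub>1 = -1" "\<epsilon>\<^sub>2 = -1" using od by fastforce
  then show ?thesis
  proof cases
    case 1
    have "pos_definite b" unfolding pos_definite_def
    proof (intro allI impI)
      fix u :: "real^2" assume "u \<noteq> 0"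
      from quad[OF this] obtain s t where "b u u = s\<^sup>2 + t\<^sup>2" "s \<noteq> 0 \<or> t \<noteq> 0" using 1 by auto
      then show "b u u > 0" using pos[of s t] by linarith
    qed
    then show ?thesis using 1 by (simp add: metric_type_def)
  next
    case 2
    then have "signature_1_1 b"
      unfolding signature_1_1_def using orthonormal_pair_basis(1,2)[OF b o] od by blast
    then show ?thesis using 2 by (simp add: metric_type_def)
  next
    case 3
    have "neg_definite b" unfolding neg_definite_def
    proof (intro allI impI)
      fix u :: "real^2" assume "u \<noteq> 0"
      from quad[OF this] obtain s t where "b u u = - (s\<^sup>2 + t\<^sup>2)" "s \<noteq> 0 \<or> t \<noteq> 0" using 3 by auto
      then show "b u u < 0" using pos[of s t] by linarith
    qed
    then show ?thesis using 3 by (simp add: metric_type_def)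
  qed
qed

text \<open>By polarisation some \<open>u\<close> is not null. The kernel of \<open>b u\<close> is a line, spanned by \<open>w\<close>, and \<open>w\<close> is not null
  by nondegeneracy. It remains to normalise and to sort.\<close>

lemma orthonormal_pair_exists:
  assumes b: "sym_bilinear b" and nd: "\<And>u. u \<noteq> 0 \<Longrightarrow> \<exists>v. b u v \<noteq> 0"
  obtains e\<^sub>1 e\<^sub>2 \<epsilon>\<^sub>1 \<epsilon>\<^sub>2 where "orthonormal_pair b e\<^sub>1 e\<^sub>2 \<epsilon>\<^sub>1 \<epsilon>\<^sub>2"
proof -
  note bs = sym_bilinearD[OF b]
  have "\<exists>u. b u u \<noteq> 0"
  proof (rule ccontr)
    assume "\<nexists>u. b u u \<noteq> 0"
    then have z: "b u u = 0" for u by blast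
    have "b u v = 0" for u v
    proof -
      have "b (u + v) (u + v) = b u u + 2 * b u v + b v v" by (simp add: bs(2,3) bs(1)[of v u])
      then show ?thesis by (simp add: z)
    qed
    then show False using nd[of "axis 1 1"] by (simp add: axis_eq_0_iff)
  qed
  then obtain u where u: "b u u \<noteq> 0" by blast
  define p q where "p = b u (axis 1 1)" and "q = b u (axis 2 1)"
  have bu: "b u v = v $ 1 * p + v $ 2 * q" for v
    by (subst real2_expansion[of v]) (simp only: bs(3,5) p_def q_def)
  have pq: "p\<^sup>2 + q\<^sup>2 \<noteq> 0" using u bu[of u] by (auto simp: sum_power2_eq_zero_iff)
  \<comment> \<open>A generator of the kernel of the linear functional \<open>b u\<close>.\<close>
  define w :: "real^2" where "w = vector [q, - p]"
  have w: "w $ 1 = q" "w $ 2 = - p" by (simp_all add: w_def)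
  have uw: "b u w = 0" by (simp add: bu w)
  have ker: "v = ((v $ 1 * q - v $ 2 * p) / (p\<^sup>2 + q\<^sup>2)) *\<^sub>R w" if "b u v = 0" for v
  proof -
    have "v $ 1 * p + v $ 2 * q = 0" using that bu by simp
    then have "(v $ 1 * q - v $ 2 * p) * q = v $ 1 * (p\<^sup>2 + q\<^sup>2)" "(v $ 1 * q - v $ 2 * p) * (- p) = v $ 2 * (p\<^sup>2 + q\<^sup>2)"
      by algebra+
    then show ?thesis using pq by (simp add: vec_eq_iff forall_2 w field_simps)
  qed
  have "w \<noteq> 0" using pq w by (auto simp: vec_eq_iff forall_2)
  have ww: "b w w \<noteq> 0"
  proof
    assume ww: "b w w = 0"
    have "b w v = 0" for v
    proof -
      let ?v = "v - (b u v / b u u) *\<^sub>R u"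
      have "b u ?v = 0" using u bs(1)[of u ?v] by (simp add: bs(4,6) bs(1)[of v u])
      from ker[OF this] obtain t where "?v = t *\<^sub>R w" by blast
      then have "v = t *\<^sub>R w + (b u v / b u u) *\<^sub>R u" by (metis diff_add_cancel)
      then have "b w v = t * b w w + (b u v / b u u) * b w u" using bs(3,5) by metis
      then show ?thesis using ww uw bs(1)[of w u] by simp
    qed
    then show False using nd[OF \<open>w \<noteq> 0\<close>] by blast
  qed
  \<comment> \<open>Normalisation of a vector that is not null.\<close>
  define n where "n v = (1 / sqrt \<bar>b v v\<bar>) *\<^sub>R v" for v
  have n: "b (n v) (n v) = sgn (b v v)" if "b v v \<noteq> 0" for v
  proof -
    have "b (n v) (n v) = b v v / (sqrt \<bar>b v v\<bar> * sqrt \<bar>b v v\<bar>)" by (simp add: n_def bs(4,5))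
    also have "\<dots> = sgn (b v v)" using that by (simp add: sgn_real_def)
    finally show ?thesis .
  qed
  have nn: "b (n u) (n w) = 0" "b (n w) (n u) = 0" using uw bs(1)[of w u] by (simp_all add: n_def bs(4,5))
  have sg: "sgn (b u u) = 1 \<or> sgn (b u u) = -1" "sgn (b w w) = 1 \<or> sgn (b w w) = -1"
    using u ww by (auto simp: sgn_real_def)
  show ?thesis
  proof (cases "sgn (b w w) \<le> sgn (b u u)")
    case True
    then show ?thesis using that[of "n u" "n w" "sgn (b u u)" "sgn (b w w)"] n[OF u] n[OF ww] nn sg
      unfolding orthonormal_pair_def by blast
  next
    case False
    then have "sgn (b u u) \<le> sgn (b w w)" by simp
    then show ?thesis using that[of "n w" "n u" "sgn (b w w)" "sgn (b u u)"] n[OF u] n[OF ww] nn sg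
      unfolding orthonormal_pair_def by blast
  qed
qed

lemma metric_type_pair:
  assumes b: "sym_bilinear b" and nd: "\<And>u. u \<noteq> 0 \<Longrightarrow> \<exists>v. b u v \<noteq> 0" and m: "m \<le> 2" "metric_type m b"
  obtains e\<^sub>1 e\<^sub>2 \<epsilon>\<^sub>1 \<epsilon>\<^sub>2 where "orthonormal_pair b e\<^sub>1 e\<^sub>2 \<epsilon>\<^sub>1 \<epsilon>\<^sub>2" "of_bool (\<epsilon>\<^sub>1 = 1) + of_bool (\<epsilon>\<^sub>2 = 1) = m"
proof -
  obtain e\<^sub>1 e\<^sub>2 \<epsilon>\<^sub>1 \<epsilon>\<^sub>2 where o: "orthonormal_pair b e\<^sub>1 e\<^sub>2 \<epsilon>\<^sub>1 \<epsilon>\<^sub>2"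
    using orthonormal_pair_exists[OF b nd] by blast
  note bs = sym_bilinearD[OF b] and od = o[unfolded orthonormal_pair_def]
  have e: "e\<^sub>1 \<noteq> 0" "e\<^sub>2 \<noteq> 0" using od bs(7)[of e\<^sub>1] bs(7)[of e\<^sub>2] by auto
  consider "m = 2" | "m = 1" | "m = 0" using m(1) by linarith
  then show ?thesis
  proof cases
    case 1
    then have "b e\<^sub>1 e\<^sub>1 > 0" "b e\<^sub>2 e\<^sub>2 > 0" using m(2) e by (simp_all add: metric_type_def pos_definite_def)
    then show ?thesis using that[OF o] od 1 by auto
  next
    case 2
    then obtain f\<^sub>1 f\<^sub>2 where "b f\<^sub>1 f\<^sub>1 = 1" "b f\<^sub>2 f\<^sub>2 = -1" "b f\<^sub>1 f\<^sub>2 = 0"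
      using m(2) by (auto simp: metric_type_def signature_1_1_def)
    then show ?thesis using that[of f\<^sub>1 f\<^sub>2 1 "-1"] 2 by (simp add: orthonormal_pair_def)
  next
    case 3
    then have "b e\<^sub>1 e\<^sub>1 < 0" "b e\<^sub>2 e\<^sub>2 < 0" using m(2) e by (simp_all add: metric_type_def neg_definite_def)
    then show ?thesis using that[OF o] od 3 by auto
  qed
qed

section \<open>Surfaces in a linear section\<close>

text \<open>The linear map that extends the embedding near \<open>x\<close> is locally constant in \<open>x\<close>. Pulled back to the
  connected surface by the continuous inverse of the embedding, it is constant.\<close>

lemma linear_container:
  assumes "isometric_embedding a N O' f" and "admissible_surface \<A> \<sigma>"
    and conn: "connected (UNIV :: 'a::{t2_space, second_countable_topology} set)"
    and range: "range (\<sigma> :: 'a \<Rightarrow> cmat) \<subseteq> f ` N"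
  obtains L where "isometric_linear a L" "range \<sigma> \<subseteq> range L"
proof -
  interpret isometric_embedding a N O' f by fact
  interpret admissible_surface \<A> \<sigma> by fact
  obtain h where h: "homeomorphism N (f ` N) f h"
    using embedding unfolding isometric_embedding_SL2_def by blast
  define g where "g p = h (\<sigma> p)" for p
  have "f (g p) = \<sigma> p \<and> g p \<in> N" for p
  proof -
    have "\<sigma> p \<in> f ` N" using range by blast
    then show ?thesis using h unfolding g_def homeomorphism_def by (metis imageI)
  qed
  then have fg: "f (g p) = \<sigma> p" and gN: "g p \<in> N" for p by auto
  have "continuous_on (f ` N) h" using h by (simp add: homeomorphism_def)
  then have g: "continuous_on UNIV g"
    unfolding g_def by (rule continuous_on_compose2[OF _ \<sigma>_continuous range])
  \<comment> \<open>The linear map near the point of the quadric that lies over \<open>\<sigma> p\<close>.\<close>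
  define M where "M p = cone_map a N f (g p)" for p
  have const: "M p = M q" for p q
  proof (rule connected_local_const[OF conn])
    show "\<forall>p\<in>UNIV. \<forall>\<^sub>F q in at p within UNIV. M p = M q"
    proof
      fix p
      obtain B where B: "open B" "g p \<in> B" "\<And>y. y \<in> B \<inter> N \<Longrightarrow> cone_map a N f y = cone_map a N f (g p)"
        using cone_map_locally_constant[OF gN] by blast
      have "(g \<longlongrightarrow> g p) (at p within UNIV)" using g by (simp add: continuous_on_def)
      then have "\<forall>\<^sub>F q in at p within UNIV. g q \<in> B" using B(1,2) by (rule topological_tendstoD)
      then show "\<forall>\<^sub>F q in at p within UNIV. M p = M q"
        by eventually_elim (simp add: M_def B(3) gN)
    qed
  qed auto
  obtain p\<^sub>0 :: 'a where True by blast
  have "\<sigma> p \<in> range (M p\<^sub>0)" for p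
  proof -
    have "M p (g p) = \<sigma> p" unfolding M_def using cone_map_isometric(2)[OF gN] fg by simp
    then show ?thesis using const[of p\<^sub>0 p] by (metis rangeI)
  qed
  moreover have "isometric_linear a (M p\<^sub>0)" unfolding M_def by (rule cone_map_isometric(1)[OF gN])
  ultimately show ?thesis using that by blast
qed

text \<open>A linear retraction onto the range is its own derivative and fixes the map.\<close>

lemma derivative_in_range:
  assumes L: "isometric_linear a L" and g: "(g has_derivative g') (at x)" and U: "open U" "x \<in> U"
    and in_range: "\<And>y. y \<in> U \<Longrightarrow> g y \<in> range L"
  shows "g' u \<in> range L"
proof -
  obtain P where P: "linear P" "P \<circ> L = id"
    using linear_injective_left_inverse[OF isometric_linearD(1)[OF L] isometric_inj[OF L]] by blast
  have LP: "linear (\<lambda>z. L (P z))"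
    using linear_compose[OF P(1) isometric_linearD(1)[OF L]] by (simp add: o_def)
  have "((\<lambda>y. L (P (g y))) has_derivative (\<lambda>u. L (P (g' u)))) (at x)"
    by (rule bounded_linear.has_derivative[OF LP[unfolded linear_conv_bounded_linear] g])
  then have "(g has_derivative (\<lambda>u. L (P (g' u)))) (at x)"
  proof (rule has_derivative_transform_within_open[OF _ U])
    fix y assume "y \<in> U"
    then obtain v where "g y = L v" using in_range by blast
    then show "L (P (g y)) = g y" using P(2) by (metis comp_apply id_apply)
  qed
  then have "g' = (\<lambda>u. L (P (g' u)))" using g has_derivative_unique by blast
  then show ?thesis by (metis rangeI)
qed

context admissible_surface
begin

definition first_form :: "'a chart \<Rightarrow> 'a \<Rightarrow> real^2 \<Rightarrow> real^2 \<Rightarrow> real" where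
  "first_form c p u v = Re (bf (dmap c \<sigma> p u) (dmap c \<sigma> p v))"

lemma first_form_bilinear: "c \<in> \<A> \<Longrightarrow> p \<in> fst c \<Longrightarrow> sym_bilinear (first_form c p)"
  unfolding sym_bilinear_def first_form_def
  by (simp add: bf_simps linear_add[OF d\<sigma>_linear] linear_cmul[OF d\<sigma>_linear] bf_commute)

lemma metric_of_type_iff:
  "metric_of_type T \<A> \<sigma> \<longleftrightarrow> (\<forall>c\<in>\<A>. \<forall>p\<in>fst c.
     (\<forall>u v. bf (dmap c \<sigma> p u) (dmap c \<sigma> p v) \<in> \<real>) \<and> T (first_form c p))"
proof -
  have "(\<exists>b. (\<forall>u v. pullback_metric c \<sigma> p (cplx u) (cplx v) = complex_of_real (b u v)) \<and> T b) \<longleftrightarrow>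
     (\<forall>u v. bf (dmap c \<sigma> p u) (dmap c \<sigma> p v) \<in> \<real>) \<and> T (first_form c p)" if c: "c \<in> \<A>" "p \<in> fst c" for c p
  proof -
    have "b = first_form c p" if "\<forall>u v. bf (dmap c \<sigma> p u) (dmap c \<sigma> p v) = complex_of_real (b u v)" for b
      using that by (simp add: fun_eq_iff first_form_def)
    moreover have "(\<forall>u v. bf (dmap c \<sigma> p u) (dmap c \<sigma> p v) \<in> \<real>) \<longleftrightarrow>
        (\<forall>u v. bf (dmap c \<sigma> p u) (dmap c \<sigma> p v) = complex_of_real (first_form c p u v))"
      unfolding first_form_def by (metis Reals_of_real of_real_Re)
    ultimately show ?thesis
      unfolding pullback_metric_eq[OF c] cdmap_cplx[OF c] by metis
  qed
  then show ?thesis unfolding metric_of_type_def by simp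
qed

lemma first_form_nondegenerate:
  assumes c: "c \<in> \<A>" "p \<in> fst c" and real: "\<And>u v. bf (dmap c \<sigma> p u) (dmap c \<sigma> p v) \<in> \<real>" and u: "u \<noteq> 0"
  shows "\<exists>v. first_form c p u v \<noteq> 0"
proof (rule ccontr)
  assume "\<nexists>v. first_form c p u v \<noteq> 0"
  then have 0: "bf (dmap c \<sigma> p u) (dmap c \<sigma> p v) = 0" for v
    using real[of u v] unfolding first_form_def by (metis of_real_0 of_real_Re)
  have "cplx u \<noteq> 0" using u by (simp add: cplx_def vec_eq_iff)
  then obtain w where "bf (cdmap c \<sigma> p (cplx u)) (cdmap c \<sigma> p w) \<noteq> 0" using nondegenerate[OF c] by blast
  then show False unfolding cdmap_cplx[OF c] cdmap_eq[OF c, of w] by (simp add: bf_simps 0)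
qed

text \<open>The coefficients in the frame expansion are rational functions, with rational coefficients, of pairings
  that are real.\<close>

lemma real_tangent_combination:
  assumes c: "c \<in> \<A>" "p \<in> fst c" and real: "\<And>u v. bf (dmap c \<sigma> p u) (dmap c \<sigma> p v) \<in> \<real>"
    and n: "unit_normal p n" and X: "bf X (\<sigma> p) = 0" "bf X n = 0" "\<And>u. bf X (dmap c \<sigma> p u) \<in> \<real>"
  shows "X \<in> range (dmap c \<sigma> p)"
proof -
  let ?a = "(bf (dmap c \<sigma> p (axis 2 1)) (dmap c \<sigma> p (axis 2 1)) * bf X (dmap c \<sigma> p (axis 1 1))
        - bf (dmap c \<sigma> p (axis 1 1)) (dmap c \<sigma> p (axis 2 1)) * bf X (dmap c \<sigma> p (axis 2 1))) / gram c p"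
  let ?b = "(bf (dmap c \<sigma> p (axis 1 1)) (dmap c \<sigma> p (axis 1 1)) * bf X (dmap c \<sigma> p (axis 2 1))
        - bf (dmap c \<sigma> p (axis 1 1)) (dmap c \<sigma> p (axis 2 1)) * bf X (dmap c \<sigma> p (axis 1 1))) / gram c p"
  have "?a \<in> \<real>" "?b \<in> \<real>"
    unfolding gram_def by (intro Reals_divide Reals_diff Reals_mult real X(3))+
  then obtain r s where rs: "?a = of_real r" "?b = of_real s" by (auto elim!: Reals_cases)
  have "X = cscale ?a (dmap c \<sigma> p (axis 1 1)) + cscale ?b (dmap c \<sigma> p (axis 2 1))"
    using expansion[OF c n, of X] X by (simp add: cscale_simps)
  also have "\<dots> = dmap c \<sigma> p (vector [r, s])"
    unfolding rs by (simp add: cscale_simps linear_real2[OF d\<sigma>_linear[OF c], of "vector [r, s]"])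
  finally show ?thesis by blast
qed

end

text \<open>The situation of one direction of the theorem: the surface lies in the image \<open>E\<close> of an isometric linear map.
  Reality of the metric and of the shape operator, the type of the metric and the factor of \<open>\<Psi>\<close> are
  read off from \<open>E\<close>.\<close>

locale linear_section = admissible_surface \<A> \<sigma>
  for \<A> :: "('a::{t2_space, second_countable_topology}) chart set" and \<sigma> +
  fixes a :: nat and L :: "real^4 \<Rightarrow> cmat"
  assumes L: "isometric_linear a L" and range: "range \<sigma> \<subseteq> range L"
begin

lemma \<sigma>_L: obtains x where "\<sigma> p = L x"
  using range by blast

lemma d\<sigma>_L: 
  assumes "c \<in> \<A>" "p \<in> fst c" obtains v where "dmap c \<sigma> p u = L v"
proof -
  have "dmap c \<sigma> p u \<in> range L"
    by (rule derivative_in_range[OF L d\<sigma>_has_derivative[OF assms] open_UNIV UNIV_I])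
      (use range in \<open>auto simp: coord_def\<close>)
  then show ?thesis using that by blast
qed

lemma metric_real:
  assumes "c \<in> \<A>" "p \<in> fst c" shows "bf (dmap c \<sigma> p u) (dmap c \<sigma> p v) \<in> \<real>"
proof -
  obtain y z where "dmap c \<sigma> p u = L y" "dmap c \<sigma> p v = L z" using d\<sigma>_L[OF assms] by metis
  then show ?thesis by (simp add: isometric_linearD(2)[OF L])
qed

text \<open>Write a unit normal as \<open>n = L y + \<i> L z\<close>. As the position vector and the tangent vectors are in the
  real form, \<open>L y\<close> and \<open>L z\<close> are separately normal, hence multiples of \<open>n\<close>. The imaginary part of
  \<open>bf n n = 1\<close> shows that \<open>L y\<close> and \<open>L z\<close> are orthogonal, so one of these multiples is zero.\<close>

lemma unit_normal_dichotomy: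
  assumes n: "unit_normal p n"
  shows "(\<exists>y. n = L y \<and> pform a y y = 1) \<or> (\<exists>z. n = cscale \<i> (L z) \<and> pform a z z = -1)"
    and "n \<notin> range L \<or> cscale \<i> n \<notin> range L"
proof -
  obtain c where c: "c \<in> \<A>" "p \<in> fst c" by (rule chart_ex)
  obtain y z where yz: "n = L y + cscale \<i> (L z)" using isometric_split[OF L] by blast
  have orth: "bf (L y) (L v) = 0" "bf (L z) (L v) = 0" if "bf n (L v) = 0" for v
  proof -
    have "of_real (pform a y v) + \<i> * of_real (pform a z v) = (0::complex)"
      using that by (simp add: yz bf_simps isometric_linearD(2)[OF L])
    then have "pform a y v = 0" "pform a z v = 0" by (simp_all add: complex_eq_iff)
    then show "bf (L y) (L v) = 0" "bf (L z) (L v) = 0" by (simp_all add: isometric_linearD(2)[OF L])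
  qed
  have mult: "Y = cscale (bf Y n) n" if Y: "Y = L y \<or> Y = L z" for Y
  proof -
    have "bf n (\<sigma> p) = 0" using unit_normalD(2)[OF n] by (simp only: bf_commute[of n])
    then have "bf Y (\<sigma> p) = 0" using orth \<sigma>_L[of p] Y by metis
    moreover have "bf Y (dmap c \<sigma> p u) = 0" for u
      using orth d\<sigma>_L[OF c, of u] unit_normalD(3)[OF n c, of u] Y by metis
    ultimately show ?thesis using expansion[OF c n, of Y] by (simp add: cscale_simps)
  qed
  let ?s = "bf (L y) n" and ?t = "bf (L z) n"
  have "1 = bf n n" using unit_normalD(1)[OF n] by simp
  also have "\<dots> = bf (L y) (L y) - bf (L z) (L z) + 2 * \<i> * bf (L y) (L z)"
    unfolding yz by (simp add: bf_simps bf_commute[of "L z" "L y"] algebra_simps)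
  finally have one: "1 = of_real (pform a y y - pform a z z) + \<i> * of_real (2 * pform a y z)"
    by (simp add: isometric_linearD(2)[OF L] mult.assoc mult.left_commute)
  then have p1: "pform a y y - pform a z z = 1" and p0: "pform a y z = 0" by (simp_all add: complex_eq_iff)
  have "bf (L y) (L z) = bf (cscale ?s n) (cscale ?t n)"
    using mult by metis
  also have "\<dots> = ?s * ?t" by (simp add: bf_simps unit_normalD(1)[OF n])
  finally have "?s * ?t = 0" using p0 by (simp add: isometric_linearD(2)[OF L])
  then have "L y = 0 \<or> L z = 0" using mult[of "L y"] mult[of "L z"] by (metis cscale_simps(7) mult_eq_0_iff)
  then show "(\<exists>y. n = L y \<and> pform a y y = 1) \<or> (\<exists>z. n = cscale \<i> (L z) \<and> pform a z z = -1)"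
  proof
    assume "L y = 0"
    then have "n = cscale \<i> (L z)" "pform a y y = 0"
      using yz isometric_linearD(2)[OF L, of y y] by simp_all
    then show ?thesis using p1 by auto
  next
    assume "L z = 0"
    then have "n = L y" "pform a z z = 0"
      using yz isometric_linearD(2)[OF L, of z z] by (simp_all add: cscale_simps)
    then show ?thesis using p1 by auto
  qed
  show "n \<notin> range L \<or> cscale \<i> n \<notin> range L"
  proof (rule ccontr)
    assume "\<not> ?thesis"
    then obtain v w where "n = L v" "cscale \<i> n = L w" by blast
    moreover have "bf n (cscale \<i> n) = \<i>" by (simp add: bf_simps unit_normalD(1)[OF n])
    ultimately have "of_real (pform a v w) = \<i>"
      using isometric_linearD(2)[OF L, of v w] by metis
    then show False by (simp add: complex_eq_iff)
  qed
qed

lemma range_iff: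
  assumes n: "unit_normal p n" shows "cscale \<i> n \<in> range L \<longleftrightarrow> n \<notin> range L"
proof -
  have "cscale \<i> (cscale \<i> (L z)) = L (- z)" for z
    by (simp add: cscale_simps linear_neg[OF isometric_linearD(1)[OF L]])
  then show ?thesis using unit_normal_dichotomy[OF n] by (metis rangeI)
qed

lemma closed_range_L: "closed (range L)"
  by (rule closed_subspace[OF linear_subspace_image[OF isometric_linearD(1)[OF L] subspace_UNIV]])

text \<open>Along a continuous unit normal field, being in \<open>E\<close> and being in \<open>\<i> E\<close> are two closed conditions that
  exclude each other, and one of them always holds. So neither can change on a connected surface.\<close>

lemma normal_type_constant:
  assumes conn: "connected (UNIV :: 'a set)"
  obtains "\<And>p n. unit_normal p n \<Longrightarrow> n \<in> range L" | "\<And>p n. unit_normal p n \<Longrightarrow> cscale \<i> n \<in> range L"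
proof -
  define K where "K p \<longleftrightarrow> (\<exists>n. unit_normal p n \<and> n \<in> range L)" for p
  have all: "n \<in> range L \<longleftrightarrow> K p" if n: "unit_normal p n" for p n
  proof -
    have "- n \<in> range L \<longleftrightarrow> n \<in> range L"
      using linear_neg[OF isometric_linearD(1)[OF L]] by (metis (mono_tags, lifting) add.inverse_inverse image_iff UNIV_I)
    then show ?thesis using unit_normal_sign[OF n] n unfolding K_def by metis
  qed
  have "K p = K q" for p q
  proof (rule connected_local_const[OF conn])
    show "\<forall>p\<in>UNIV. \<forall>\<^sub>F q in at p within UNIV. K p = K q"
    proof
      fix p
      obtain c where c: "c \<in> \<A>" "p \<in> fst c" by (rule chart_ex)
      obtain V \<nu> where nf: "normal_field \<A> \<sigma> V \<nu>" and V: "p \<in> V"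
        using local_normal_field[OF c metric_real[OF c(1)]] by metis
      have oV: "open V" by (rule normal_fieldD(1)[OF nf])
      have "continuous_on V \<nu>"
        by (rule smooth_map_continuous[OF normal_fieldD(2,1)[OF nf]])
      then have lim: "(\<nu> \<longlongrightarrow> \<nu> p) (at p)"
        using V oV by (simp add: continuous_on_eq_continuous_at isCont_def)
      have inV: "\<forall>\<^sub>F q in at p. q \<in> V" using V oV by (simp add: eventually_at_in_open')
      define E where "E = (if K p then cscale \<i> -` range L else range L)"
      have "closed (cscale \<i> -` range L)"
        using linear_continuous_on[OF linear_cscale[unfolded linear_conv_bounded_linear], of UNIV]
        by (intro closed_vimage closed_range_L)
      then have "open (- E)" unfolding E_def using closed_range_L by (simp add: open_Compl)
      moreover have "\<nu> p \<in> - E"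
        using all[OF normal_fieldD(3)[OF nf V]] range_iff[OF normal_fieldD(3)[OF nf V]] by (simp add: E_def)
      ultimately have "\<forall>\<^sub>F q in at p. \<nu> q \<in> - E" using lim topological_tendstoD by blast
      then show "\<forall>\<^sub>F q in at p within UNIV. K p = K q"
        using inV
      proof eventually_elim
        case (elim q)
        have "unit_normal q (\<nu> q)" by (rule normal_fieldD(3)[OF nf elim(2)])
        from all[OF this] range_iff[OF this] elim(1) show ?case
          by (auto simp: E_def split: if_splits)
      qed
    qed
  qed auto
  then have "(\<forall>p. K p) \<or> (\<forall>p. \<not> K p)" by metis
  then show ?thesis
  proof
    assume "\<forall>p. K p" then show ?thesis using that(1) all by blast
  next
    assume "\<forall>p. \<not> K p" then show ?thesis using that(2) all range_iff by blast
  qed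
qed

text \<open>If \<open>k \<nu>\<close> stays in the real form, so does its derivative, which is tangent to the surface.\<close>

lemma shape_real_of_normals:
  assumes n: "\<And>p n. unit_normal p n \<Longrightarrow> cscale k n \<in> range L"
  shows "k_shape_real k"
  unfolding k_shape_real_def
proof (intro allI impI ballI)
  fix V \<nu> c p u assume nf: "normal_field \<A> \<sigma> V \<nu>" and "c \<in> \<A>" "p \<in> fst c \<inter> V"
  then have c: "c \<in> \<A>" "p \<in> fst c" "p \<in> V" by auto
  let ?U = "snd c ` (fst c \<inter> V)"
  have U: "open ?U" "snd c p \<in> ?U" using chart_image_open[OF c(1) normal_fieldD(1)[OF nf]] c by auto
  have "((\<lambda>x. cscale k (coord c \<nu> x)) has_derivative (\<lambda>u. cscale k (dmap c \<nu> p u))) (at (snd c p))"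
    by (rule bounded_linear.has_derivative[OF linear_cscale[unfolded linear_conv_bounded_linear] normal_derivative(4)[OF nf c]])
  then have "cscale k (dmap c \<nu> p u) \<in> range L"
  proof (rule derivative_in_range[OF L _ U])
    fix x assume "x \<in> ?U"
    then obtain q where "q \<in> fst c" "q \<in> V" "x = snd c q" by auto
    then show "cscale k (coord c \<nu> x) \<in> range L"
      using n[OF normal_fieldD(3)[OF nf \<open>q \<in> V\<close>]] by (simp add: coord_apply[OF c(1)])
  qed
  then obtain v where v: "cscale k (dmap c \<nu> p u) = L v" by blast
  show "cscale k (dmap c \<nu> p u) \<in> range (dmap c \<sigma> p)"
  proof (rule real_tangent_combination[OF c(1,2) metric_real[OF c(1,2)] normal_fieldD(3)[OF nf c(3)]])
    show "bf (cscale k (dmap c \<nu> p u)) (\<sigma> p) = 0" "bf (cscale k (dmap c \<nu> p u)) (\<nu> p) = 0"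
      using normal_derivative(1,2)[OF nf c] by (simp_all add: bf_simps bf_commute[of "dmap c \<nu> p u"])
    show "bf (cscale k (dmap c \<nu> p u)) (dmap c \<sigma> p w) \<in> \<real>" for w
    proof -
      obtain z where "dmap c \<sigma> p w = L z" using d\<sigma>_L[OF c(1,2)] by metis
      then show ?thesis unfolding v by (simp add: isometric_linearD(2)[OF L])
    qed
  qed
qed

text \<open>The position vector, an orthonormal tangent pair and \<open>n\<close> or \<open>- \<i> n\<close> form an orthonormal basis of the real
  form, and the position vector is negative. By the law of inertia, the positive vectors among the
  other three are \<open>a\<close> in number.\<close>

lemma index_count:
  assumes c: "c \<in> \<A>" "p \<in> fst c" and n: "unit_normal p n" and a: "a \<le> 4"
    and o: "orthonormal_pair (first_form c p) e\<^sub>1 e\<^sub>2 \<epsilon>\<^sub>1 \<epsilon>\<^sub>2"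
  shows "of_bool (\<epsilon>\<^sub>1 = 1) + of_bool (\<epsilon>\<^sub>2 = 1) + of_bool (n \<in> range L) = a"
proof -
  note od = o[unfolded orthonormal_pair_def first_form_def]
  obtain x y\<^sub>1 y\<^sub>2 where x: "\<sigma> p = L x" and y1: "dmap c \<sigma> p e\<^sub>1 = L y\<^sub>1" and y2: "dmap c \<sigma> p e\<^sub>2 = L y\<^sub>2"
    using \<sigma>_L d\<sigma>_L[OF c] by metis
  obtain z \<epsilon>\<^sub>3 \<mu> where z: "n = cscale \<mu> (L z)" "pform a z z = \<epsilon>\<^sub>3" "\<mu> \<noteq> 0"
    and e3: "\<epsilon>\<^sub>3 = (if n \<in> range L then 1 else -1)"
  proof (cases "n \<in> range L")
    case True
    then have "cscale \<i> n \<notin> range L" using range_iff[OF n] by simp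
    moreover have "cscale \<i> (cscale \<i> (L z)) = L (- z)" for z
      by (simp add: cscale_simps linear_neg[OF isometric_linearD(1)[OF L]])
    ultimately obtain y where "n = L y" "pform a y y = 1" using unit_normal_dichotomy(1)[OF n] by (metis rangeI)
    then show ?thesis using that[of 1 y 1] True by (simp add: cscale_simps)
  next
    case False
    then obtain z where "n = cscale \<i> (L z)" "pform a z z = -1" using unit_normal_dichotomy(1)[OF n] by blast
    then show ?thesis using that[of \<i> z "-1"] False by simp
  qed
  have pf: "pform a u v = 0" if "bf (L u) (L v) = 0" for u v
    using that isometric_linearD(2)[OF L, of u v] by simp
  have zn: "pform a z v = 0" if "bf n (L v) = 0" for v
    using that z by (intro pf) (simp add: bf_simps)
  define w where "w k = (if k = 1 then x else if k = 2 then y\<^sub>1 else if k = 3 then y\<^sub>2 else z)" for k :: 4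
  define \<epsilon> where "\<epsilon> k = (if k = 1 then -1 else if k = 2 then \<epsilon>\<^sub>1 else if k = 3 then \<epsilon>\<^sub>2 else \<epsilon>\<^sub>3)" for k :: 4
  have xx: "pform a x x = -1"
    using \<sigma>_unit[of p] isometric_linearD(2)[OF L, of x x] by (simp add: x complex_eq_iff)
  have xy: "pform a x y\<^sub>1 = 0" "pform a x y\<^sub>2 = 0"
    using d\<sigma>_tangent[OF c, of e\<^sub>1] d\<sigma>_tangent[OF c, of e\<^sub>2] unfolding x y1 y2 by (simp_all add: pf)
  have yy: "pform a y\<^sub>1 y\<^sub>1 = \<epsilon>\<^sub>1" "pform a y\<^sub>2 y\<^sub>2 = \<epsilon>\<^sub>2" "pform a y\<^sub>1 y\<^sub>2 = 0"
    using od isometric_linearD(2)[OF L] by (simp_all add: y1 y2)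
  have "bf n (\<sigma> p) = 0" using unit_normalD(2)[OF n] by (simp only: bf_commute[of n])
  then have zz: "pform a z x = 0" "pform a z y\<^sub>1 = 0" "pform a z y\<^sub>2 = 0"
    using unit_normalD(3)[OF n c, of e\<^sub>1] unit_normalD(3)[OF n c, of e\<^sub>2]
    unfolding x y1 y2 by (simp_all add: zn)
  have sym: "pform a y\<^sub>1 x = 0" "pform a y\<^sub>2 x = 0" "pform a y\<^sub>2 y\<^sub>1 = 0"
      "pform a x z = 0" "pform a y\<^sub>1 z = 0" "pform a y\<^sub>2 z = 0"
    using xy yy(3) zz by (simp_all only: pform_commute[of a y\<^sub>1 x] pform_commute[of a y\<^sub>2 x]
      pform_commute[of a y\<^sub>2 y\<^sub>1] pform_commute[of a x z] pform_commute[of a y\<^sub>1 z] pform_commute[of a y\<^sub>2 z])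
  have "\<forall>k l. pform a (w k) (w l) = (if k = l then \<epsilon> k else 0)"
    using xx xy yy zz sym z(2) by (simp add: forall_4 w_def \<epsilon>_def)
  moreover have "\<epsilon> k = 1 \<or> \<epsilon> k = -1" for k using od e3 by (auto simp: \<epsilon>_def)
  ultimately have "card {k. \<epsilon> k = 1} = a" by (intro sylvester[of a w] a) auto
  moreover have "card {k. \<epsilon> k = 1} = (\<Sum>k\<in>UNIV. if \<epsilon> k = 1 then 1 else 0)"
    by (simp add: sum.If_cases)
  ultimately show ?thesis by (simp add: sum_4 \<epsilon>_def e3 of_bool_def split: if_splits)
qed

text \<open>Whether the normals are in \<open>E\<close> or in \<open>\<i> E\<close> is constant on the surface, hence so is the number of positive
  tangent directions, which differs from \<open>a\<close> by one or by zero.\<close>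

lemma type_of_linear_section:
  assumes conn: "connected (UNIV :: 'a set)" and a: "a \<le> 4"
  shows "\<exists>m\<le>2. metric_of_type (metric_type m) \<A> \<sigma> \<and>
    (a = m + 1 \<and> k_shape_real 1 \<or> a = m \<and> k_shape_real \<i>)"
proof -
  have mt: "metric_of_type (metric_type m) \<A> \<sigma> \<and> m \<le> 2"
    if n: "\<And>p n. unit_normal p n \<Longrightarrow> a = m + of_bool (n \<in> range L)" for m
  proof -
    have *: "metric_type m (first_form c p) \<and> m \<le> 2" if c: "c \<in> \<A>" "p \<in> fst c" for c p
    proof -
      obtain e\<^sub>1 e\<^sub>2 \<epsilon>\<^sub>1 \<epsilon>\<^sub>2 where o: "orthonormal_pair (first_form c p) e\<^sub>1 e\<^sub>2 \<epsilon>\<^sub>1 \<epsilon>\<^sub>2"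
        using orthonormal_pair_exists[OF first_form_bilinear[OF c] first_form_nondegenerate[OF c metric_real[OF c]]] by blast
      obtain V \<nu> where nf: "normal_field \<A> \<sigma> V \<nu>" and V: "p \<in> V"
        using local_normal_field[OF c metric_real[OF c(1)]] by metis
      have un: "unit_normal p (\<nu> p)" by (rule normal_fieldD(3)[OF nf V])
      have "of_bool (\<epsilon>\<^sub>1 = 1) + of_bool (\<epsilon>\<^sub>2 = 1) = m"
        using index_count[OF c un a o] n[OF un] by simp
      then show ?thesis using metric_type_of_pair[OF first_form_bilinear[OF c] o] by (auto simp: of_bool_def split: if_splits)
    qed
    obtain p :: 'a where True by blast
    obtain c where "c \<in> \<A>" "p \<in> fst c" by (rule chart_ex)
    then show ?thesis using * metric_real unfolding metric_of_type_iff by blast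
  qed
  show ?thesis
  proof (rule normal_type_constant[OF conn])
    assume n: "\<And>p n. unit_normal p n \<Longrightarrow> n \<in> range L"
    have "k_shape_real 1" by (rule shape_real_of_normals) (simp add: cscale_simps n)
    moreover obtain m where "a = m + 1"
    proof -
      obtain p :: 'a where True by blast
      obtain c where c: "c \<in> \<A>" "p \<in> fst c" by (rule chart_ex)
      obtain e\<^sub>1 e\<^sub>2 \<epsilon>\<^sub>1 \<epsilon>\<^sub>2 where o: "orthonormal_pair (first_form c p) e\<^sub>1 e\<^sub>2 \<epsilon>\<^sub>1 \<epsilon>\<^sub>2"
        using orthonormal_pair_exists[OF first_form_bilinear[OF c] first_form_nondegenerate[OF c metric_real[OF c]]] by blast
      obtain V \<nu> where nf: "normal_field \<A> \<sigma> V \<nu>" and V: "p \<in> V"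
        using local_normal_field[OF c metric_real[OF c(1)]] by metis
      have un: "unit_normal p (\<nu> p)" by (rule normal_fieldD(3)[OF nf V])
      then show ?thesis using that index_count[OF c un a o] n[OF un] by simp metis
    qed
    moreover from this have "metric_of_type (metric_type m) \<A> \<sigma> \<and> m \<le> 2" using n by (intro mt) simp
    ultimately show ?thesis by blast
  next
    assume n: "\<And>p n. unit_normal p n \<Longrightarrow> cscale \<i> n \<in> range L"
    have "metric_of_type (metric_type a) \<A> \<sigma> \<and> a \<le> 2"
      by (rule mt) (use n range_iff in simp)
    moreover have "k_shape_real \<i>" by (rule shape_real_of_normals[OF n])
    ultimately show ?thesis by blast
  qed
qed

end

section \<open>Linear systems along a segment\<close>

text \<open>Gronwall: for a large constant \<open>C\<close>, depending on a bound for the coefficients, \<open>exp (- C t)\<close> times the square norm of the solution is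
  nonincreasing, nonnegative, and zero at the start.\<close>

lemma linear_ode_zero:
  fixes \<phi> :: "'n::finite \<Rightarrow> real \<Rightarrow> real"
  assumes deriv: "\<And>i t. 0 \<le> t \<Longrightarrow> t \<le> 1 \<Longrightarrow> (\<phi> i has_real_derivative (\<Sum>j\<in>UNIV. \<Omega> i j t * \<phi> j t)) (at t)"
    and cont: "\<And>i j. continuous_on {0..1} (\<Omega> i j)" and init: "\<And>i. \<phi> i 0 = 0"
  shows "\<phi> i 1 = 0"
proof -
  have "\<exists>K. \<forall>t\<in>{0..1}. \<bar>\<Omega> i j t\<bar> \<le> K" for i j
  proof -
    have "bounded (\<Omega> i j ` {0..1})" by (intro compact_imp_bounded compact_continuous_image cont) simp
    then show ?thesis by (auto simp: bounded_iff)
  qed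
  then obtain K where K: "\<And>i j t. t \<in> {0..1} \<Longrightarrow> \<bar>\<Omega> i j t\<bar> \<le> K i j" by metis
  define M where "M = (\<Sum>i\<in>UNIV. \<Sum>j\<in>UNIV. \<bar>K i j\<bar>)"
  have M: "\<bar>\<Omega> i j t\<bar> \<le> M" if "t \<in> {0..1}" for i j t
  proof -
    have "\<bar>K i j\<bar> \<le> (\<Sum>j\<in>UNIV. \<bar>K i j\<bar>)" by (rule member_le_sum) auto
    also have "\<dots> \<le> M" unfolding M_def by (rule member_le_sum) (auto simp: sum_nonneg)
    finally show ?thesis using K[OF that, of i j] by linarith
  qed
  define C where "C = 2 * M * real CARD('n)"
  define E where "E t = (\<Sum>i\<in>UNIV. (\<phi> i t)\<^sup>2)" for t
  define E' where "E' t = (\<Sum>i\<in>UNIV. 2 * \<phi> i t * (\<Sum>j\<in>UNIV. \<Omega> i j t * \<phi> j t))" for t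
  have dE: "(E has_real_derivative E' t) (at t)" if "0 \<le> t" "t \<le> 1" for t
    unfolding E_def E'_def using that by (auto intro!: derivative_eq_intros deriv simp: mult_ac)
  have E': "E' t \<le> C * E t" if "t \<in> {0..1}" for t
  proof -
    have "2 * \<phi> i t * (\<Omega> i j t * \<phi> j t) \<le> M * ((\<phi> i t)\<^sup>2 + (\<phi> j t)\<^sup>2)" for i j
    proof -
      have "2 * \<phi> i t * (\<Omega> i j t * \<phi> j t) \<le> \<bar>\<Omega> i j t\<bar> * \<bar>2 * \<phi> i t * \<phi> j t\<bar>"
        by (simp add: abs_mult[symmetric] mult.left_commute mult.assoc abs_ge_self)
      also have "\<dots> \<le> M * ((\<phi> i t)\<^sup>2 + (\<phi> j t)\<^sup>2)"
      proof (rule mult_mono[OF M[OF that]])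
        show "\<bar>2 * \<phi> i t * \<phi> j t\<bar> \<le> (\<phi> i t)\<^sup>2 + (\<phi> j t)\<^sup>2"
          using sum_squares_bound[of "\<bar>\<phi> i t\<bar>" "\<bar>\<phi> j t\<bar>"] by (simp add: abs_mult)
        show "0 \<le> M" using M[OF that, of i j] by linarith
      qed simp
      finally show ?thesis .
    qed
    then have "E' t \<le> (\<Sum>i\<in>UNIV. \<Sum>j\<in>UNIV. M * ((\<phi> i t)\<^sup>2 + (\<phi> j t)\<^sup>2))"
      unfolding E'_def sum_distrib_left by (intro sum_mono)
    also have "\<dots> = C * E t"
      by (simp add: sum_distrib_left[symmetric] sum.distrib E_def[symmetric] C_def)
    finally show ?thesis .
  qed
  have "exp (- C * 1) * E 1 \<le> exp (- C * 0) * E 0"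
  proof (rule DERIV_nonpos_imp_nonincreasing[of 0 1])
    fix t :: real assume t: "0 \<le> t" "t \<le> 1"
    have "((\<lambda>t. exp (- C * t) * E t) has_real_derivative exp (- C * t) * (E' t - C * E t)) (at t)"
      by (auto intro!: derivative_eq_intros dE t simp: algebra_simps)
    moreover have "exp (- C * t) * (E' t - C * E t) \<le> 0"
      using E'[of t] t by (intro mult_nonneg_nonpos) auto
    ultimately show "\<exists>y. ((\<lambda>t. exp (- C * t) * E t) has_real_derivative y) (at t) \<and> y \<le> 0" by blast
  qed simp
  moreover have "E 0 = 0" by (simp add: E_def init)
  ultimately have "exp (- C) * E 1 \<le> 0" by simp
  then have "E 1 \<le> 0" by (simp add: mult_le_0_iff not_le[symmetric])
  then have "E 1 = 0" unfolding E_def by (meson order_antisym sum_nonneg zero_le_power2)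
  then show ?thesis by (simp add: E_def sum_nonneg_eq_0_iff)
qed

section \<open>The real span of an adapted frame\<close>

text \<open>The situation of the other direction of the theorem, over a coordinate domain with a unit normal field. The
  factor \<open>\<kappa>\<close> is \<open>1\<close> or \<open>\<i>\<close>, up to sign, and \<open>\<epsilon> = \<kappa>\<^sup>2\<close> is the square norm of \<open>\<kappa> \<nu>\<close>. The frame consists of the
  position vector, the two coordinate fields and \<open>\<kappa> \<nu>\<close>. Its real span will turn out to be the same at
  all points.\<close>

locale adapted_frame = admissible_surface \<A> \<sigma>
  for \<A> :: "('a::{t2_space, second_countable_topology}) chart set" and \<sigma> +
  fixes c :: "'a chart" and V :: "'a set" and \<nu> :: "'a \<Rightarrow> cmat" and \<kappa> :: complex and \<epsilon> :: real
  assumes c: "c \<in> \<A>" and V: "V \<subseteq> fst c" and nf: "normal_field \<A> \<sigma> V \<nu>"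
    and real_metric: "\<And>q u v. q \<in> fst c \<Longrightarrow> bf (dmap c \<sigma> q u) (dmap c \<sigma> q v) \<in> \<real>"
    and shape: "k_shape_real \<kappa>" and \<kappa>: "\<kappa> * \<kappa> = of_real \<epsilon>" "\<epsilon> * \<epsilon> = 1"
begin

definition "s = coord c \<sigma>"

definition "Ds u x = frechet_derivative s (at x) u"

definition "Nk x = cscale \<kappa> (coord c \<nu> x)"

definition "U = snd c ` V"

definition frame :: "4 \<Rightarrow> real^2 \<Rightarrow> cmat" where
  "frame k = (if k = 1 then s else if k = 2 then Ds (axis 1 1) else if k = 3 then Ds (axis 2 1) else Nk)"

lemma frame_simps: "frame 1 = s" "frame 2 = Ds (axis 1 1)" "frame 3 = Ds (axis 2 1)" "frame 4 = Nk"
  by (simp_all add: frame_def)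

lemma oV: "open V" by (rule normal_fieldD(1)[OF nf])

lemma oU: "open U"
  using chart_image_open[OF c oV] V unfolding U_def by (simp add: Int_absorb1)

lemma smooth_s: "smooth_on U s" and smooth_Ds: "smooth_on U (Ds u)" and smooth_Nk: "smooth_on U Nk"
proof -
  have "smooth_on (snd c ` fst c) s"
    using smooth_in_chart[OF \<sigma>_smooth c] by (simp add: s_def)
  then show s: "smooth_on U s"
    by (rule smooth_on_subset) (use V in \<open>auto simp: U_def\<close>)
  show "smooth_on U (Ds u)"
    unfolding Ds_def using s by (rule smooth_on_directional)
  have "smooth_on U (coord c \<nu>)"
    using smooth_in_chart[OF normal_fieldD(2)[OF nf] c] V by (simp add: U_def Int_absorb1)
  then show "smooth_on U Nk"
    unfolding Nk_def by (rule smooth_on_linear_comp[OF oU linear_cscale])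
qed

lemma smooth_frame: "smooth_on U (frame k)"
  by (simp add: frame_def smooth_s smooth_Ds smooth_Nk)

lemma at_point:
  assumes q: "q \<in> V"
  shows "s (snd c q) = \<sigma> q" "Ds u (snd c q) = dmap c \<sigma> q u" "Nk (snd c q) = cscale \<kappa> (\<nu> q)"
    "frechet_derivative s (at (snd c q)) u = dmap c \<sigma> q u"
    "frechet_derivative Nk (at (snd c q)) u = cscale \<kappa> (dmap c \<nu> q u)"
proof -
  have q': "q \<in> fst c" using q V by blast
  show "s (snd c q) = \<sigma> q" "Ds u (snd c q) = dmap c \<sigma> q u" "Nk (snd c q) = cscale \<kappa> (\<nu> q)"
    "frechet_derivative s (at (snd c q)) u = dmap c \<sigma> q u"
    by (simp_all add: s_def Ds_def Nk_def dmap_def coord_apply[OF c q'])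
  have "(Nk has_derivative (\<lambda>u. cscale \<kappa> (dmap c \<nu> q u))) (at (snd c q))"
    unfolding Nk_def
    by (rule bounded_linear.has_derivative[OF linear_cscale[unfolded linear_conv_bounded_linear]
          normal_derivative(4)[OF nf c q' q]])
  from frechet_derivative_at[OF this]
  show "frechet_derivative Nk (at (snd c q)) u = cscale \<kappa> (dmap c \<nu> q u)" by metis
qed

lemma U_point: assumes "x \<in> U" obtains q where "q \<in> V" "q \<in> fst c" "x = snd c q"
  using assms V unfolding U_def by blast

text \<open>Real parts of the coefficients in the frame expansion, as functions of the coordinates. They are
  explicit in order to make their continuity evident.\<close>

definition coef :: "4 \<Rightarrow> cmat \<Rightarrow> real^2 \<Rightarrow> real" where
  "coef k v x = (if k = 1 then - Re (bf v (s x)) else if k = 4 then \<epsilon> * Re (bf v (Nk x))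
    else Re ((if k = 2
        then bf (frame 3 x) (frame 3 x) * bf v (frame 2 x) - bf (frame 2 x) (frame 3 x) * bf v (frame 3 x)
        else bf (frame 2 x) (frame 2 x) * bf v (frame 3 x) - bf (frame 2 x) (frame 3 x) * bf v (frame 2 x))
      / (bf (frame 2 x) (frame 2 x) * bf (frame 3 x) (frame 3 x) - bf (frame 2 x) (frame 3 x) * bf (frame 2 x) (frame 3 x))))"

lemma gram_frame:
  assumes "x \<in> U"
  shows "bf (frame 2 x) (frame 2 x) * bf (frame 3 x) (frame 3 x) - bf (frame 2 x) (frame 3 x) * bf (frame 2 x) (frame 3 x) \<noteq> 0"
proof -
  obtain q where q: "q \<in> V" "q \<in> fst c" "x = snd c q" by (rule U_point[OF assms])
  show ?thesis
    using gram_nonzero[OF c q(2)] unfolding gram_def by (simp add: q(3) frame_simps at_point[OF q(1)])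
qed

lemma coef_continuous:
  assumes v: "continuous_on U v"
  shows "continuous_on U (\<lambda>x. coef k (v x) x)"
proof -
  note fr = smooth_on_continuous[OF smooth_frame]
  have cont: "continuous_on U s" "continuous_on U Nk"
    using fr[of 1] fr[of 4] by (simp_all add: frame_simps)
  note cb = bounded_bilinear.continuous_on[OF bounded_bilinear_bf]
  consider "k = 1" | "k = 2" | "k = 3" | "k = 4" using exhaust_4 by blast
  then show ?thesis
  proof cases
    case 1
    then show ?thesis unfolding coef_def by simp (intro continuous_intros cb v cont)
  next
    case 2
    then show ?thesis unfolding coef_def
      by simp (intro continuous_intros cb v fr ballI gram_frame)
  next
    case 3
    then show ?thesis unfolding coef_def
      by simp (intro continuous_intros cb v fr ballI gram_frame)
  next
    case 4
    then show ?thesis unfolding coef_def by simp (intro continuous_intros cb v cont)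
  qed
qed

lemma frame_expansion_real:
  assumes x: "x \<in> U" and v: "\<And>k. bf v (frame k x) \<in> \<real>"
  shows "v = (\<Sum>k\<in>UNIV. coef k v x *\<^sub>R frame k x)"
proof -
  obtain q where q: "q \<in> V" "q \<in> fst c" "x = snd c q" by (rule U_point[OF x])
  have g: "bf (frame i x) (frame j x) \<in> \<real>" if "i \<in> {2, 3}" "j \<in> {2, 3}" for i j
    using that real_metric[OF q(2)] by (auto simp: q(3) frame_simps at_point[OF q(1)])
  have co: "cscale z X = Re z *\<^sub>R X" if "z \<in> \<real>" for z X
    using that cscale_simps(5)[of "Re z" X] by (simp add: of_real_Re)
  have n: "unit_normal q (\<nu> q)" by (rule normal_fieldD(3)[OF nf q(1)])
  have "cscale (bf v (\<nu> q)) (\<nu> q) = (\<epsilon> * Re (bf v (Nk x))) *\<^sub>R Nk x"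
  proof -
    have "cscale (bf v (\<nu> q)) (\<nu> q) = cscale ((of_real \<epsilon> * of_real \<epsilon>) * bf v (\<nu> q)) (\<nu> q)"
      using \<kappa>(2) by (simp flip: of_real_mult)
    also have "\<dots> = cscale (of_real \<epsilon> * (\<kappa> * bf v (\<nu> q))) (cscale \<kappa> (\<nu> q))"
      by (simp add: \<kappa>(1)[symmetric] cscale_simps mult_ac)
    also have "\<dots> = cscale (of_real \<epsilon> * bf v (Nk x)) (Nk x)"
      by (simp add: q(3) at_point[OF q(1)] bf_simps)
    also have "\<dots> = (\<epsilon> * Re (bf v (Nk x))) *\<^sub>R Nk x"
      using v[of 4] by (subst co) (simp_all add: frame_simps Reals_mult)
    finally show ?thesis .
  qed
  moreover have "cscale (- bf v (\<sigma> q)) (\<sigma> q) = (- Re (bf v (s x))) *\<^sub>R s x"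
    using v[of 1] by (subst co) (simp_all add: frame_simps q(3) at_point[OF q(1)] Reals_minus)
  moreover note expansion[OF c q(2) n, of v]
  ultimately have "v = (- Re (bf v (s x))) *\<^sub>R s x + (\<epsilon> * Re (bf v (Nk x))) *\<^sub>R Nk x
    + cscale ((bf (frame 3 x) (frame 3 x) * bf v (frame 2 x) - bf (frame 2 x) (frame 3 x) * bf v (frame 3 x))
      / (bf (frame 2 x) (frame 2 x) * bf (frame 3 x) (frame 3 x) - bf (frame 2 x) (frame 3 x) * bf (frame 2 x) (frame 3 x))) (frame 2 x)
    + cscale ((bf (frame 2 x) (frame 2 x) * bf v (frame 3 x) - bf (frame 2 x) (frame 3 x) * bf v (frame 2 x))
      / (bf (frame 2 x) (frame 2 x) * bf (frame 3 x) (frame 3 x) - bf (frame 2 x) (frame 3 x) * bf (frame 2 x) (frame 3 x))) (frame 3 x)"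
    by (simp add: q(3) frame_simps at_point[OF q(1)] gram_def)
  also have "\<dots> = (\<Sum>k\<in>UNIV. coef k v x *\<^sub>R frame k x)"
  proof -
    have r2: "(bf (frame 3 x) (frame 3 x) * bf v (frame 2 x) - bf (frame 2 x) (frame 3 x) * bf v (frame 3 x))
      / (bf (frame 2 x) (frame 2 x) * bf (frame 3 x) (frame 3 x) - bf (frame 2 x) (frame 3 x) * bf (frame 2 x) (frame 3 x)) \<in> \<real>"
      by (intro Reals_divide Reals_diff Reals_mult g v) auto
    have r3: "(bf (frame 2 x) (frame 2 x) * bf v (frame 3 x) - bf (frame 2 x) (frame 3 x) * bf v (frame 2 x))
      / (bf (frame 2 x) (frame 2 x) * bf (frame 3 x) (frame 3 x) - bf (frame 2 x) (frame 3 x) * bf (frame 2 x) (frame 3 x)) \<in> \<real>"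
      by (intro Reals_divide Reals_diff Reals_mult g v) auto
    show ?thesis unfolding co[OF r2] co[OF r3] sum_4 by (simp add: coef_def frame_simps)
  qed
  finally show ?thesis .
qed

lemma frame_pairing_derivative:
  assumes fg: "smooth_on U f" "smooth_on U g" and real: "\<And>x. x \<in> U \<Longrightarrow> bf (f x) (g x) \<in> \<real>" and x: "x \<in> U"
  shows "bf (f x) (frechet_derivative g (at x) u) + bf (frechet_derivative f (at x) u) (g x) \<in> \<real>"
proof -
  have d: "((\<lambda>x. bf (f x) (g x)) has_derivative
      (\<lambda>u. bf (f x) (frechet_derivative g (at x) u) + bf (frechet_derivative f (at x) u) (g x))) (at x)"
    by (intro bounded_bilinear.FDERIV[OF bounded_bilinear_bf] smooth_on_has_derivative[OF _ oU x] fg)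
  have "((\<lambda>x. Im (bf (f x) (g x))) has_derivative
      (\<lambda>u. Im (bf (f x) (frechet_derivative g (at x) u) + bf (frechet_derivative f (at x) u) (g x)))) (at x)"
    by (rule bounded_linear.has_derivative[OF bounded_linear_Im d])
  moreover have "((\<lambda>x. Im (bf (f x) (g x))) has_derivative (\<lambda>_. 0)) (at x)"
    by (rule has_derivative_transform_within_open[OF has_derivative_const[of 0] oU x])
      (use real in \<open>simp add: complex_is_Real_iff\<close>)
  ultimately have "(\<lambda>u. Im (bf (f x) (frechet_derivative g (at x) u) + bf (frechet_derivative f (at x) u) (g x))) = (\<lambda>_. 0)"
    by (rule has_derivative_unique)
  then show ?thesis unfolding complex_is_Real_iff by meson
qed

lemma Ds_pairing:
  assumes x: "x \<in> U"
  shows "bf (Ds u x) (s x) \<in> \<real>" "bf (Ds u x) (Nk x) \<in> \<real>" "bf (Ds u x) (Ds v x) \<in> \<real>" "bf (Ds u x) (frame k x) \<in> \<real>"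
    "\<exists>w. frechet_derivative Nk (at x) u = Ds w x"
proof -
  obtain q where q: "q \<in> V" "q \<in> fst c" "x = snd c q" by (rule U_point[OF x])
  have n: "unit_normal q (\<nu> q)" by (rule normal_fieldD(3)[OF nf q(1)])
  show 1: "bf (Ds u x) (s x) \<in> \<real>" "bf (Ds u x) (Nk x) \<in> \<real>" "bf (Ds u x) (Ds v x) \<in> \<real>" for u v
    using d\<sigma>_tangent[OF c q(2)] unit_normalD(4)[OF n c q(2)] real_metric[OF q(2)]
    by (simp_all add: q(3) at_point[OF q(1)] bf_simps bf_commute[of _ "\<sigma> q"])
  show "bf (Ds u x) (frame k x) \<in> \<real>"
    unfolding frame_def using 1 by simp
  have "cscale \<kappa> (dmap c \<nu> q u) \<in> range (dmap c \<sigma> q)"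
    using shape nf c q unfolding k_shape_real_def by blast
  then show "\<exists>w. frechet_derivative Nk (at x) u = Ds w x"
    by (auto simp: q(3) at_point[OF q(1)])
qed

text \<open>This is the structure equation: derivatives of the frame are real combinations of the frame. For the
  position vector this is clear, and for \<open>\<kappa> \<nu>\<close> it is the reality of the shape operator. For the second
  derivatives of the position vector, the normal and radial components follow by differentiating
  orthogonality relations. For the tangential components, the form \<open>T\<close> of imaginary parts is symmetric
  in two arguments and antisymmetric in two others, hence zero, as for the Christoffel symbols of a
  real metric.\<close>

lemma frame_derivative_real:
  assumes x: "x \<in> U" shows "bf (frechet_derivative (frame k) (at x) u) (frame l x) \<in> \<real>"
proof -
  define H where "H v w = frechet_derivative (Ds v) (at x) w" for v w
  have Ds': "frechet_derivative s (at x) u = Ds u x" for u by (simp add: Ds_def)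
  have sym: "H v w = H w v" for v w
    unfolding H_def Ds_def by (rule second_derivative_commute[OF oU smooth_s x])
  have s: "bf (H v w) (s x) \<in> \<real>" for v w
  proof -
    have "bf (Ds v x) (Ds w x) + bf (H v w) (s x) \<in> \<real>"
      using frame_pairing_derivative[OF smooth_Ds smooth_s Ds_pairing(1) x] unfolding H_def Ds' .
    then have "(bf (Ds v x) (Ds w x) + bf (H v w) (s x)) - bf (Ds v x) (Ds w x) \<in> \<real>"
      by (rule Reals_diff[OF _ Ds_pairing(3)[OF x]])
    then show ?thesis by simp
  qed
  have N: "bf (H v w) (Nk x) \<in> \<real>" for v w
  proof -
    obtain z where z: "frechet_derivative Nk (at x) w = Ds z x" using Ds_pairing(5)[OF x] by blast
    have "bf (Ds v x) (Ds z x) + bf (H v w) (Nk x) \<in> \<real>"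
      using frame_pairing_derivative[OF smooth_Ds smooth_Nk Ds_pairing(2) x, of v w] unfolding H_def z .
    then have "(bf (Ds v x) (Ds z x) + bf (H v w) (Nk x)) - bf (Ds v x) (Ds z x) \<in> \<real>"
      by (rule Reals_diff[OF _ Ds_pairing(3)[OF x]])
    then show ?thesis by simp
  qed
  \<comment> \<open>The antisymmetry in the first and last argument comes from the reality of the metric.\<close>
  define T where "T v w z = Im (bf (H v w) (Ds z x))" for v w z
  have T1: "T v w z = - T z w v" for v w z
  proof -
    have "bf (Ds v x) (H z w) + bf (H v w) (Ds z x) \<in> \<real>"
      using frame_pairing_derivative[OF smooth_Ds smooth_Ds Ds_pairing(3) x, of v z w] unfolding H_def .
    then show ?thesis unfolding T_def complex_is_Real_iff by (simp add: bf_commute[of "Ds v x"])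
  qed
  have T2: "T v w z = T w v z" for v w z unfolding T_def using sym by metis
  have "T v w z = 0" for v w z
  proof -
    have "T v w z = - T z w v" by (rule T1)
    also have "\<dots> = - T w z v" using T2 by simp
    also have "\<dots> = T v z w" using T1[of w z v] by simp
    also have "\<dots> = T z v w" by (rule T2)
    also have "\<dots> = - T w v z" by (rule T1)
    also have "\<dots> = - T v w z" using T2 by simp
    finally show ?thesis by simp
  qed
  then have D: "bf (H v w) (Ds z x) \<in> \<real>" for v w z by (simp add: T_def complex_is_Real_iff)
  have Hf: "bf (H v w) (frame l x) \<in> \<real>" for v w unfolding frame_def using s N D by simp
  obtain z where z: "frechet_derivative Nk (at x) u = Ds z x" using Ds_pairing(5)[OF x] by blast
  consider "k = 1" | "k = 2" | "k = 3" | "k = 4" using exhaust_4 by blast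
  then show ?thesis
    using Ds_pairing(4)[OF x] Hf z by cases (simp_all add: frame_simps Ds' H_def)
qed

text \<open>By the structure equation, the imaginary parts of the pairings of a fixed matrix \<open>X\<close> with the frame
  solve a linear system of ordinary differential equations along the segment.\<close>

lemma transport:
  assumes B: "convex B" "B \<subseteq> U" "x \<in> B" "y \<in> B" and X: "\<And>k. bf X (frame k x) \<in> \<real>"
  shows "bf X (frame k y) \<in> \<real>"
proof -
  define u where "u = y - x"
  define \<gamma> where "\<gamma> t = x + t *\<^sub>R u" for t :: real
  have \<gamma>: "\<gamma> t \<in> U" if "0 \<le> t" "t \<le> 1" for t
  proof -
    have "\<gamma> t = (1 - t) *\<^sub>R x + t *\<^sub>R y" by (simp add: \<gamma>_def u_def algebra_simps)
    then show ?thesis using convexD_alt[OF B(1,3,4) that] B(2) by auto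
  qed
  define D where "D i z = frechet_derivative (frame i) (at z) u" for i z
  define \<phi> where "\<phi> i t = Im (bf X (frame i (\<gamma> t)))" for i t
  have "\<phi> k 1 = 0"
  proof (rule linear_ode_zero)
    fix i and t :: real assume t: "0 \<le> t" "t \<le> 1"
    have "(\<gamma> has_derivative (\<lambda>t. t *\<^sub>R u)) (at t)"
      unfolding \<gamma>_def by (auto intro!: derivative_eq_intros)
    moreover have fr: "(frame i has_derivative frechet_derivative (frame i) (at (\<gamma> t))) (at (\<gamma> t))"
      by (rule smooth_on_has_derivative[OF smooth_frame oU \<gamma>[OF t]])
    ultimately have "((\<lambda>t. frame i (\<gamma> t)) has_derivative (\<lambda>r. frechet_derivative (frame i) (at (\<gamma> t)) (r *\<^sub>R u))) (at t)"
      by (rule has_derivative_compose)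
    moreover have "frechet_derivative (frame i) (at (\<gamma> t)) (r *\<^sub>R u) = r *\<^sub>R D i (\<gamma> t)" for r
      unfolding D_def by (rule linear_cmul[OF has_derivative_linear[OF fr]])
    ultimately have "((\<lambda>t. frame i (\<gamma> t)) has_vector_derivative D i (\<gamma> t)) (at t)"
      unfolding has_vector_derivative_def by simp
    from bounded_linear.has_vector_derivative[OF bounded_linear_Im
        bounded_linear.has_vector_derivative[OF bounded_bilinear.bounded_linear_right[OF bounded_bilinear_bf, of X] this]]
    have d: "(\<phi> i has_real_derivative Im (bf X (D i (\<gamma> t)))) (at t)"
      unfolding \<phi>_def has_real_derivative_iff_has_vector_derivative .
    have "D i (\<gamma> t) = (\<Sum>j\<in>UNIV. coef j (D i (\<gamma> t)) (\<gamma> t) *\<^sub>R frame j (\<gamma> t))"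
      unfolding D_def by (rule frame_expansion_real[OF \<gamma>[OF t] frame_derivative_real[OF \<gamma>[OF t]]])
    then have "bf X (D i (\<gamma> t)) = bf (\<Sum>j\<in>UNIV. coef j (D i (\<gamma> t)) (\<gamma> t) *\<^sub>R frame j (\<gamma> t)) X"
      by (metis bf_commute)
    also have "\<dots> = (\<Sum>j\<in>UNIV. of_real (coef j (D i (\<gamma> t)) (\<gamma> t)) * bf X (frame j (\<gamma> t)))"
      by (simp add: bf_sum bf_scaleR bf_commute[of X])
    finally have "Im (bf X (D i (\<gamma> t))) = (\<Sum>j\<in>UNIV. coef j (D i (\<gamma> t)) (\<gamma> t) * \<phi> j t)"
      by (simp add: \<phi>_def)
    with d show "(\<phi> i has_real_derivative (\<Sum>j\<in>UNIV. coef j (D i (\<gamma> t)) (\<gamma> t) * \<phi> j t)) (at t)" by simp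
  next
    fix i j
    have "continuous_on U (D i)" unfolding D_def by (intro smooth_on_continuous smooth_on_directional smooth_frame)
    then have "continuous_on U (\<lambda>z. coef j (D i z) z)" by (rule coef_continuous)
    then show "continuous_on {0..1} (\<lambda>t. coef j (D i (\<gamma> t)) (\<gamma> t))"
    proof (rule continuous_on_compose2)
      show "continuous_on {0..1} \<gamma>" unfolding \<gamma>_def by (intro continuous_intros)
      show "\<gamma> ` {0..1} \<subseteq> U" using \<gamma> by auto
    qed
  next
    show "\<phi> i 0 = 0" for i using X[of i] by (simp add: \<phi>_def \<gamma>_def complex_is_Real_iff)
  qed
  then show ?thesis by (simp add: \<phi>_def \<gamma>_def u_def complex_is_Real_iff)
qed

end

context admissible_surface
begin

text \<open>The matrices that have real pairing with the frame. The real span of the frame is its own real dual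
  under \<open>bf\<close>, so this is just that span, but membership is a closed condition on each matrix separately,
  which is what is transported along the surface.\<close>

definition real_form :: "complex \<Rightarrow> 'a \<Rightarrow> cmat set" where
  "real_form \<kappa> p = {X. bf X (\<sigma> p) \<in> \<real> \<and> (\<forall>c\<in>\<A>. p \<in> fst c \<longrightarrow> (\<forall>u. bf X (dmap c \<sigma> p u) \<in> \<real>)) \<and>
     (\<forall>n. unit_normal p n \<longrightarrow> \<kappa> * bf X n \<in> \<real>)}"

lemma real_form_iff:
  assumes c: "c \<in> \<A>" "p \<in> fst c" and n: "unit_normal p n"
  shows "X \<in> real_form \<kappa> p \<longleftrightarrow> bf X (\<sigma> p) \<in> \<real> \<and> bf X (dmap c \<sigma> p (axis 1 1)) \<in> \<real> \<and>
    bf X (dmap c \<sigma> p (axis 2 1)) \<in> \<real> \<and> bf X (cscale \<kappa> n) \<in> \<real>"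
proof
  assume "X \<in> real_form \<kappa> p"
  then show "bf X (\<sigma> p) \<in> \<real> \<and> bf X (dmap c \<sigma> p (axis 1 1)) \<in> \<real> \<and>
    bf X (dmap c \<sigma> p (axis 2 1)) \<in> \<real> \<and> bf X (cscale \<kappa> n) \<in> \<real>"
    using c n by (simp add: real_form_def bf_simps)
next
  assume R: "bf X (\<sigma> p) \<in> \<real> \<and> bf X (dmap c \<sigma> p (axis 1 1)) \<in> \<real> \<and>
    bf X (dmap c \<sigma> p (axis 2 1)) \<in> \<real> \<and> bf X (cscale \<kappa> n) \<in> \<real>"
  have d: "bf X (dmap c \<sigma> p u) \<in> \<real>" for u
    unfolding linear_real2[OF d\<sigma>_linear[OF c], of u] using R by (simp add: bf_simps Reals_add Reals_mult)
  have "bf X (dmap c' \<sigma> p u) \<in> \<real>" if "c' \<in> \<A>" "p \<in> fst c'" for c' u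
    unfolding dmap_chart_change[OF \<sigma>_smooth open_UNIV c that UNIV_I] by (rule d)
  moreover have "\<kappa> * bf X n' \<in> \<real>" if "unit_normal p n'" for n'
    using unit_normal_sign[OF n that] R by (auto simp: bf_simps)
  ultimately show "X \<in> real_form \<kappa> p" using R by (simp add: real_form_def)
qed

lemma real_form_constant:
  assumes conn: "connected (UNIV :: 'a set)"
    and real: "\<And>c q u v. c \<in> \<A> \<Longrightarrow> q \<in> fst c \<Longrightarrow> bf (dmap c \<sigma> q u) (dmap c \<sigma> q v) \<in> \<real>"
    and shape: "k_shape_real \<kappa>" and \<kappa>: "\<kappa> * \<kappa> = of_real \<epsilon>" "\<epsilon> * \<epsilon> = 1"
  shows "real_form \<kappa> p = real_form \<kappa> q"
proof (rule connected_local_const[OF conn])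
  show "\<forall>p\<in>UNIV. \<forall>\<^sub>F q in at p within UNIV. real_form \<kappa> p = real_form \<kappa> q"
  proof
    fix p
    obtain c where pc: "c \<in> \<A>" "p \<in> fst c" by (rule chart_ex)
    obtain V \<nu> where \<nu>:  "normal_field \<A> \<sigma> V \<nu>" and pV: "p \<in> V" "V \<subseteq> fst c"
      using local_normal_field[OF pc real[OF pc(1)]] by metis
    interpret adapted_frame \<A> \<sigma> c V \<nu> \<kappa> \<epsilon>
      by unfold_locales (use pc pV \<nu> real shape \<kappa> in auto)
    have form: "X \<in> real_form \<kappa> q \<longleftrightarrow> (\<forall>k. bf X (frame k (snd c q)) \<in> \<real>)" if q: "q \<in> V" for q X
    proof -
      have qc: "q \<in> fst c" using q pV by blast
      show ?thesis
        unfolding real_form_iff[OF pc(1) qc normal_fieldD(3)[OF \<nu> q]]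
        by (simp add: forall_4 frame_simps at_point[OF q])
    qed
    have "snd c p \<in> U" using pV unfolding U_def by blast
    then obtain e where e: "e > 0" "ball (snd c p) e \<subseteq> U" using oU open_contains_ball by blast
    have "isCont (snd c) p"
      using chart_continuous[OF pc(1)] chart_open(1)[OF pc(1)] pc(2) continuous_on_eq_continuous_at by blast
    then have "\<forall>\<^sub>F q in at p. snd c q \<in> ball (snd c p) e"
      unfolding isCont_def using e(1) by (intro topological_tendstoD) auto
    moreover have "\<forall>\<^sub>F q in at p. q \<in> V" using pV oV by (simp add: eventually_at_in_open')
    ultimately show "\<forall>\<^sub>F q in at p within UNIV. real_form \<kappa> p = real_form \<kappa> q"
    proof eventually_elim
      case (elim q)
      have pB: "snd c p \<in> ball (snd c p) e" using e(1) by simp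
      have "X \<in> real_form \<kappa> p \<longleftrightarrow> X \<in> real_form \<kappa> q" for X
        unfolding form[OF pV(1)] form[OF elim(2)]
        using transport[OF convex_ball e(2) pB elim(1), of X] transport[OF convex_ball e(2) elim(1) pB, of X] by blast
      then show ?case by blast
    qed
  qed
qed auto

end

section \<open>Linear isometric embeddings\<close>

lemma isometric_linear_of_basis:
  assumes b: "\<And>k l. bf (b k) (b l) = (if k = l then of_real (psign a k) else 0)"
  shows "isometric_linear a (\<lambda>x. \<Sum>k\<in>UNIV. x $ k *\<^sub>R b k)"
    and "(\<And>k. bf X (b k) \<in> \<real>) \<Longrightarrow> X \<in> range (\<lambda>x. \<Sum>k\<in>UNIV. x $ k *\<^sub>R b k)"
proof -
  let ?L = "\<lambda>x::real^4. \<Sum>k\<in>UNIV. x $ k *\<^sub>R b k"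
  have "linear ?L" by (auto intro!: linearI simp: scaleR_add_left sum.distrib scaleR_sum_right)
  moreover have "bf (?L u) (?L v) = of_real (pform a u v)" for u v
  proof -
    have e1: "bf (?L u) y = (\<Sum>k\<in>UNIV. of_real (u $ k) * bf (b k) y)" for u y
      by (simp add: bf_sum bf_scaleR)
    have "bf (b k) (?L v) = of_real (v $ k * psign a k)" for k
      unfolding bf_commute[of "b k"] e1 by (simp add: b if_distrib cong: if_cong)
    then show ?thesis unfolding e1 by (simp add: pform_eq mult_ac)
  qed
  ultimately show "isometric_linear a ?L" unfolding isometric_linear_def by blast
  assume X: "\<And>k. bf X (b k) \<in> \<real>"
  have "bf (b k) (cscale (of_real (psign a l)) (b l)) = (if k = l then 1 else 0)" for k l
    by (simp add: bf_simps b flip: of_real_mult)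
  from biorthogonal_expansion[of b "\<lambda>l. cscale (of_real (psign a l)) (b l)", OF this, of X]
  have "X = (\<Sum>k\<in>UNIV. cscale (of_real (psign a k) * bf X (b k)) (b k))" by (simp add: bf_simps)
  also have "\<dots> = ?L (\<chi> k. psign a k * Re (bf X (b k)))"
  proof -
    have "cscale (of_real r * z) Y = (r * Re z) *\<^sub>R Y" if "z \<in> \<real>" for r z Y
      using that cscale_simps(5)[of "r * Re z" Y] by (simp add: of_real_Re)
    then show ?thesis using X by simp
  qed
  finally show "X \<in> range ?L" by blast
qed

lemma isometric_linear_embedding:
  assumes L: "isometric_linear a L" and N: "N = pquadric a \<inter> O'" "open O'"
  shows "isometric_embedding_SL2 a N L"
proof -
  note lin = isometric_linearD(1)[OF L]
  have fd: "frechet_derivative L (at x within N) v = L v" if "x \<in> N" "v \<in> pquadric_tangent a x" for x v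
    using frechet_derivative_pquadric[OF N that(1) _ linear_imp_has_derivative[OF lin] open_UNIV UNIV_I, of v L] that(2)
    by (simp add: pquadric_tangent_def)
  have SL: "L x \<in> SL2" if "x \<in> N" for x
    using that N by (simp add: SL2_iff isometric_linearD(2)[OF L] pquadric_def)
  have inj: "inj_on (frechet_derivative L (at x within N)) (pquadric_tangent a x)" if "x \<in> N" for x
    using fd[OF that] isometric_inj[OF L] by (auto simp: inj_on_def)
  have tang: "bf (L x) (L v) = 0" if "v \<in> pquadric_tangent a x" for x v
    using that by (simp add: isometric_linearD(2)[OF L] pquadric_tangent_def)
  have met: "hol_metric (L x) (frechet_derivative L (at x within N) v) (frechet_derivative L (at x within N) w) =
      complex_of_real (pform a v w)" if "x \<in> N" "v \<in> pquadric_tangent a x" "w \<in> pquadric_tangent a x" for x v w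
    unfolding fd[OF that(1,2)] fd[OF that(1,3)]
    by (simp add: hol_metric_eq[OF SL[OF that(1)] tang[OF that(2)] tang[OF that(3)]] isometric_linearD(2)[OF L])
  obtain P where P: "linear P" "P \<circ> L = id"
    using linear_injective_left_inverse[OF lin isometric_inj[OF L]] by blast
  have PL: "P (L x) = x" for x using P(2) by (metis comp_apply id_apply)
  have "homeomorphism N (L ` N) L P"
    unfolding homeomorphism_def
    by (auto simp: PL image_image intro: linear_continuous_on lin[unfolded linear_conv_bounded_linear]
        P(1)[unfolded linear_conv_bounded_linear])
  then show ?thesis
    unfolding isometric_embedding_SL2_def
    using SL inj met smooth_on_linear_imp_subset[OF lin] by blast
qed

lemma hyperbolic_space_eq: "hyperbolic_space = pquadric 3 \<inter> {x. x $ 4 > 0}"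
  by (auto simp: hyperbolic_space_def)

lemma open_upper: "open {x::real^4. x $ 4 > 0}"
  by (intro open_Collect_less continuous_intros)

context admissible_surface
begin

text \<open>An orthonormal basis of the real span at one point spans it at all points. The basis has \<open>m\<close>
  positive tangent vectors, the negative position vector, and \<open>\<kappa> \<nu>\<close>, which is positive for \<open>\<kappa> = 1\<close> and
  negative for \<open>\<kappa> = \<i>\<close>.\<close>

lemma linear_section_exists:
  assumes conn: "connected (UNIV :: 'a set)" and m: "m \<le> 2" "metric_of_type (metric_type m) \<A> \<sigma>"
    and k: "a = m + 1 \<and> \<kappa> = 1 \<or> a = m \<and> \<kappa> = \<i>" and shape: "k_shape_real \<kappa>"
  obtains L where "isometric_linear a L" "range \<sigma> \<subseteq> range L"
proof -
  have real: "bf (dmap c \<sigma> q u) (dmap c \<sigma> q v) \<in> \<real>" and type: "metric_type m (first_form c q)"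
    if "c \<in> \<A>" "q \<in> fst c" for c q u v
    using m(2) that unfolding metric_of_type_iff by auto
  define \<epsilon> :: real where "\<epsilon> = (if \<kappa> = 1 then 1 else -1)"
  have \<kappa>: "\<kappa> * \<kappa> = of_real \<epsilon>" "\<epsilon> * \<epsilon> = 1" using k by (auto simp: \<epsilon>_def)
  obtain p\<^sub>0 :: 'a where True by blast
  obtain c where c: "c \<in> \<A>" "p\<^sub>0 \<in> fst c" by (rule chart_ex)
  obtain V \<nu> where nf: "normal_field \<A> \<sigma> V \<nu>" and V: "p\<^sub>0 \<in> V"
    using local_normal_field[OF c real[OF c(1)]] by metis
  define n where "n = \<nu> p\<^sub>0"
  have n: "unit_normal p\<^sub>0 n" unfolding n_def by (rule normal_fieldD(3)[OF nf V])
  obtain e\<^sub>1 e\<^sub>2 \<epsilon>\<^sub>1 \<epsilon>\<^sub>2 where o: "orthonormal_pair (first_form c p\<^sub>0) e\<^sub>1 e\<^sub>2 \<epsilon>\<^sub>1 \<epsilon>\<^sub>2"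
    and cnt: "of_bool (\<epsilon>\<^sub>1 = 1) + of_bool (\<epsilon>\<^sub>2 = 1) = m"
    using metric_type_pair[OF first_form_bilinear[OF c] first_form_nondegenerate[OF c real[OF c]] m(1) type[OF c]] by blast
  note od = o[unfolded orthonormal_pair_def first_form_def]
  let ?A = "\<sigma> p\<^sub>0" and ?X = "dmap c \<sigma> p\<^sub>0 e\<^sub>1" and ?Y = "dmap c \<sigma> p\<^sub>0 e\<^sub>2" and ?N = "cscale \<kappa> n"
  have ff: "bf (dmap c \<sigma> p\<^sub>0 u) (dmap c \<sigma> p\<^sub>0 v) = of_real (Re (bf (dmap c \<sigma> p\<^sub>0 u) (dmap c \<sigma> p\<^sub>0 v)))" for u v
    using real[OF c, of u v] by (simp add: of_real_Re)
  have pair: "bf ?X ?X = of_real \<epsilon>\<^sub>1" "bf ?Y ?Y = of_real \<epsilon>\<^sub>2" "bf ?X ?Y = 0" "bf ?Y ?X = 0"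
    using od ff[of e\<^sub>1 e\<^sub>1] ff[of e\<^sub>2 e\<^sub>2] ff[of e\<^sub>1 e\<^sub>2] by (simp_all add: bf_commute[of ?Y ?X])
  have AA: "bf ?A ?A = -1" by (rule \<sigma>_unit)
  have AX: "bf ?A ?X = 0" "bf ?A ?Y = 0" "bf ?X ?A = 0" "bf ?Y ?A = 0"
    using d\<sigma>_tangent[OF c] by (simp_all add: bf_commute[of _ ?A])
  have NN: "bf ?N ?N = of_real \<epsilon>" by (simp add: bf_simps unit_normalD(1)[OF n] \<kappa>)
  have AN: "bf ?A ?N = 0" "bf ?N ?A = 0" "bf ?N ?X = 0" "bf ?N ?Y = 0" "bf ?X ?N = 0" "bf ?Y ?N = 0"
    using unit_normalD[OF n] c by (simp_all add: bf_simps bf_commute[of n ?A])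
  \<comment> \<open>Positive vectors come first, as required by \<open>psign\<close>; the tangent pair is already sorted.\<close>
  define b where "b k = (if \<kappa> = 1
    then (if k = 1 then ?N else if k = 2 then ?X else if k = 3 then ?Y else ?A)
    else (if k = 1 then ?X else if k = 2 then ?Y else if k = 3 then ?N else ?A))" for k :: 4
  have "\<forall>k l. bf (b k) (b l) = (if k = l then of_real (psign a k) else 0)"
    using k
  proof
    assume k: "a = m + 1 \<and> \<kappa> = 1"
    then have "psign a 1 = 1" "psign a 2 = \<epsilon>\<^sub>1" "psign a 3 = \<epsilon>\<^sub>2" "psign a 4 = -1"
      using od cnt by (auto simp: psign_def)
    then show ?thesis using k pair AA AX NN AN by (simp add: forall_4 b_def \<epsilon>_def)
  next
    assume k: "a = m \<and> \<kappa> = \<i>"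
    then have "psign a 1 = \<epsilon>\<^sub>1" "psign a 2 = \<epsilon>\<^sub>2" "psign a 3 = -1" "psign a 4 = -1"
      using od cnt by (auto simp: psign_def)
    then show ?thesis using k pair AA AX NN AN by (simp add: forall_4 b_def \<epsilon>_def)
  qed
  then have b: "bf (b k) (b l) = (if k = l then of_real (psign a k) else 0)" for k l by blast
  let ?L = "\<lambda>x::real^4. \<Sum>k\<in>UNIV. x $ k *\<^sub>R b k"
  have "\<sigma> p \<in> range ?L" for p
  proof (rule isometric_linear_of_basis(2)[OF b])
    fix j
    have "\<sigma> p \<in> real_form \<kappa> p"
      using \<sigma>_unit[of p] d\<sigma>_tangent unit_normalD(2) by (simp add: real_form_def)
    also have "real_form \<kappa> p = real_form \<kappa> p\<^sub>0"
      by (rule real_form_constant[OF conn real shape \<kappa>])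
    finally have "bf (\<sigma> p) ?A \<in> \<real>" "bf (\<sigma> p) ?X \<in> \<real>" "bf (\<sigma> p) ?Y \<in> \<real>" "bf (\<sigma> p) ?N \<in> \<real>"
      using c n by (simp_all add: real_form_def bf_simps)
    then show "bf (\<sigma> p) (b j) \<in> \<real>" unfolding b_def by (cases "\<kappa> = 1") simp_all
  qed
  then show ?thesis using that[OF isometric_linear_of_basis(1)[OF b]] by blast
qed

lemma pquadric_preimage:
  assumes L: "isometric_linear a L" "\<sigma> p = L x" shows "x \<in> pquadric a"
proof -
  have "complex_of_real (pform a x x) = -1" using \<sigma>_unit[of p] L(2) isometric_linearD(2)[OF L(1), of x x] by simp
  then show ?thesis by (simp add: pquadric_def complex_eq_iff)
qed

text \<open>The two-sheeted hyperboloid is separated by the sign of the last coordinate, which is constant on a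
  connected surface. If it is negative, the linear map is composed with \<open>x \<mapsto> - x\<close>.\<close>

lemma upper_sheet:
  assumes conn: "connected (UNIV :: 'a set)" and L: "isometric_linear 3 L" and range: "range \<sigma> \<subseteq> range L"
  obtains L' where "isometric_linear 3 L'" "range \<sigma> \<subseteq> L' ` hyperbolic_space"
proof -
  note lin = isometric_linearD(1)[OF L]
  obtain P where P: "linear P" "P \<circ> L = id"
    using linear_injective_left_inverse[OF lin isometric_inj[OF L]] by blast
  have PL: "P (L x) = x" for x using P(2) by (metis comp_apply id_apply)
  have LP: "L (P (\<sigma> p)) = \<sigma> p" for p
  proof -
    obtain x where "\<sigma> p = L x" using range by blast
    then show ?thesis by (simp add: PL)
  qed
  have Q: "P (\<sigma> p) \<in> pquadric 3" for p by (rule pquadric_preimage[OF L LP[symmetric]])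
  have nz: "P (\<sigma> p) $ 4 \<noteq> 0" for p
  proof
    assume "P (\<sigma> p) $ 4 = 0"
    then have "pform 3 (P (\<sigma> p)) (P (\<sigma> p)) \<ge> 0" by (simp add: pform_eq sum_4 psign_def)
    then show False using Q[of p] by (simp add: pquadric_def)
  qed
  have "continuous_on UNIV P" using linear_continuous_on[OF P(1)[unfolded linear_conv_bounded_linear]] .
  then have "continuous_on UNIV (\<lambda>p. P (\<sigma> p))" by (rule continuous_on_compose2[OF _ \<sigma>_continuous]) simp
  then have "continuous_on UNIV (\<lambda>p. P (\<sigma> p) $ 4)" by (intro continuous_intros)
  then have "connected (range (\<lambda>p. P (\<sigma> p) $ 4))" by (rule connected_continuous_image[OF _ conn])
  then have I: "is_interval (range (\<lambda>p. P (\<sigma> p) $ 4))" by (simp add: is_interval_connected_1)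
  have "(\<forall>p. P (\<sigma> p) $ 4 > 0) \<or> (\<forall>p. P (\<sigma> p) $ 4 < 0)"
  proof (rule ccontr)
    assume "\<not> ?thesis"
    then obtain p q where "P (\<sigma> p) $ 4 \<le> 0" "0 \<le> P (\<sigma> q) $ 4" by (meson not_le)
    then have "0 \<in> range (\<lambda>p. P (\<sigma> p) $ 4)" using I unfolding is_interval_1 by blast
    then show False using nz by auto
  qed
  then show ?thesis
  proof
    assume "\<forall>p. P (\<sigma> p) $ 4 > 0"
    then have "\<sigma> p \<in> L ` hyperbolic_space" for p
      using Q LP[of p] by (intro image_eqI[of _ _ "P (\<sigma> p)"]) (simp_all add: hyperbolic_space_def)
    then show ?thesis using that[OF L] by blast
  next
    assume neg: "\<forall>p. P (\<sigma> p) $ 4 < 0"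
    have "linear (\<lambda>x. L (- x))" by (auto intro!: linearI simp: linear_neg[OF lin] linear_add[OF lin] linear_diff[OF lin] linear_cmul[OF lin])
    then have "isometric_linear 3 (\<lambda>x. L (- x))"
      unfolding isometric_linear_def by (simp add: isometric_linearD(2)[OF L] pform_simps)
    moreover have "\<sigma> p \<in> (\<lambda>x. L (- x)) ` hyperbolic_space" for p
      using Q[of p] LP[of p] neg
      by (intro image_eqI[of _ _ "- P (\<sigma> p)"]) (simp_all add: hyperbolic_space_def pquadric_def pform_simps)
    ultimately show ?thesis using that by blast
  qed
qed

text \<open>All four parts of the theorem at once: the index \<open>a\<close> of the quadric is the number of positive tangent
  directions, increased by one when \<open>\<Psi>\<close> itself is real.\<close>

lemma contained_iff:
  assumes conn: "connected (UNIV :: 'a set)" and a: "a \<le> 3"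
    and N: "N = (if a = 3 then hyperbolic_space else pquadric a)"
  shows "(\<exists>f. isometric_embedding_SL2 a N f \<and> range \<sigma> \<subseteq> f ` N) \<longleftrightarrow>
    (\<exists>m\<le>2. metric_of_type (metric_type m) \<A> \<sigma> \<and> (a = m + 1 \<and> k_shape_real 1 \<or> a = m \<and> k_shape_real \<i>))"
    (is "?lhs \<longleftrightarrow> ?rhs")
proof -
  define O' :: "(real^4) set" where "O' = (if a = 3 then {x. x $ 4 > 0} else UNIV)"
  have NO: "N = pquadric a \<inter> O'" "open O'"
    unfolding N O'_def using open_upper by (simp_all add: hyperbolic_space_eq)
  show ?thesis
  proof
    assume ?lhs
    then obtain f where f: "isometric_embedding_SL2 a N f" "range \<sigma> \<subseteq> f ` N" by blast
    interpret isometric_embedding a N O' f by unfold_locales (fact f(1), fact NO(1), fact NO(2))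
    obtain L where "isometric_linear a L" "range \<sigma> \<subseteq> range L"
      using linear_container[OF isometric_embedding_axioms admissible_surface_axioms conn f(2)] by blast
    then interpret linear_section \<A> \<sigma> a L by unfold_locales
    show ?rhs using type_of_linear_section[OF conn] a by simp
  next
    assume ?rhs
    then obtain m \<kappa> where m: "m \<le> 2" "metric_of_type (metric_type m) \<A> \<sigma>"
      "a = m + 1 \<and> \<kappa> = 1 \<or> a = m \<and> \<kappa> = \<i>" "k_shape_real \<kappa>" by blast
    obtain L where L: "isometric_linear a L" "range \<sigma> \<subseteq> range L"
      using linear_section_exists[OF conn m] by blast
    have "\<exists>L. isometric_linear a L \<and> range \<sigma> \<subseteq> L ` N"
    proof (cases "a = 3")
      case True
      then show ?thesis using upper_sheet[OF conn] L N by metis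
    next
      case False
      have "\<sigma> p \<in> L ` N" for p
      proof -
        obtain x where "\<sigma> p = L x" using L(2) by blast
        then show ?thesis using pquadric_preimage[OF L(1)] False N by simp
      qed
      then show ?thesis using L(1) by blast
    qed
    then show ?lhs using isometric_linear_embedding[OF _ NO] by blast
  qed
qed

end

theorem theorem3:
  fixes \<A> :: "('a::{t2_space, second_countable_topology}) chart set"
    and \<sigma> :: "'a \<Rightarrow> cmat"
    and D :: "(cmat \<Rightarrow> cmat) \<Rightarrow> (cmat \<Rightarrow> cmat) \<Rightarrow> cmat \<Rightarrow> cmat"
  assumes surface: "surface_atlas \<A>"
    and connected: "connected (UNIV :: 'a set)"
    and levi_civita: "levi_civita_SL2 D"
    and admissible: "admissible_immersion \<A> \<sigma>"
  shows
    "((\<exists>f. isometric_embedding_SL2 3 hyperbolic_space f \<and> range \<sigma> \<subseteq> f ` hyperbolic_space) \<longleftrightarrow>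
        metric_of_type pos_definite \<A> \<sigma> \<and> shape_real D \<A> \<sigma>) \<and>
     ((\<exists>f. isometric_embedding_SL2 2 (pquadric 2) f \<and> range \<sigma> \<subseteq> f ` pquadric 2) \<longleftrightarrow>
        (metric_of_type pos_definite \<A> \<sigma> \<and> i_shape_real D \<A> \<sigma>) \<or>
        (metric_of_type signature_1_1 \<A> \<sigma> \<and> shape_real D \<A> \<sigma>)) \<and>
     ((\<exists>f. isometric_embedding_SL2 1 (pquadric 1) f \<and> range \<sigma> \<subseteq> f ` pquadric 1) \<longleftrightarrow>
        (metric_of_type signature_1_1 \<A> \<sigma> \<and> i_shape_real D \<A> \<sigma>) \<or>
        (metric_of_type neg_definite \<A> \<sigma> \<and> shape_real D \<A> \<sigma>)) \<and>
     ((\<exists>f. isometric_embedding_SL2 0 (pquadric 0) f \<and> range \<sigma> \<subseteq> f ` pquadric 0) \<longleftrightarrow>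
        metric_of_type neg_definite \<A> \<sigma> \<and> i_shape_real D \<A> \<sigma>)"
proof -
  interpret admissible_surface \<A> \<sigma>
    by unfold_locales (fact surface, fact admissible)
  note shape = shape_real_iff[OF levi_civita]
  have "m \<le> 2 \<longleftrightarrow> m = 0 \<or> m = 1 \<or> m = 2" for m :: nat by arith
  then have small: "(\<exists>m\<le>2. P m) \<longleftrightarrow> P 0 \<or> P 1 \<or> P 2" for P :: "nat \<Rightarrow> bool" by simp metis
  note iff = contained_iff[OF connected _ refl, unfolded small shape[symmetric]]
  show ?thesis
    using iff[of 3] iff[of 2] iff[of 1] iff[of 0] by (auto simp: metric_type_def)
qed

end
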